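(* (a) Let $I$ be the radical ideal of a finite set $Z$ of points in $\mathbb{P}^2$. If there exists $m\geq 1$ such that $\beta_m(I)=\beta_{m+1}(I)=1$, then $\alpha(I)=1$, i.e. $Z$ is contained in a line. (b) Let $I$ be the radical ideal of a finite set $Z$ of points in $\mathbb{P}^2$. If there exists $m\geq 1$ such that $\beta_m(I)=\beta_{m+1}(I)=\beta_{m+2}(I)=\beta_{m+3}(I)=\beta_{m+4}(I)=2$, then $\alpha(I)=2$, i.e. $Z$ is contained in a conic. (c) For every integer $d\geq 3$ there exists a finite set of points in $\mathbb{P}^2$ whose radical ideal $I$ satisfies $\beta_m(I)=d$ for all $m\geq 2$ but $\alpha(I)\geq d+1$.
   Context: The ground field is algebraically closed of characteristic $0$. For a finite set $Z=\{P_1,\dots,P_s\}\subset\mathbb{P}^2$, $I(P_i)$ is the homogeneous ideal of all forms vanishing at $P_i$, $I=I(Z)=\bigcap_i I(P_i)$, and for $m\geq 1$ the symbolic power is $I^{(m)}=\bigcap_i I(P_i)^m$. For a nonzero homogeneous ideal $J=\bigoplus_{d\geq 0}J_d$, the initial degree is $\alpha(J)=\min\{d: J_d\neq 0\}$. The $\beta$-sequence of $I$ is defined by $\beta_0(I)=\alpha(I)$ and $\beta_m(I)=\alpha(I^{(m+1)})-\alpha(I^{(m)})$ for $m\geq 1$. A conic is a (possibly reducible) curve of degree $2$. *)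

theory Defs
  imports "HOL-Library.Poly_Mapping" "HOL-Library.Numeral_Type"
    "HOL-Computational_Algebra.Polynomial" "HOL-Analysis.Cartesian_Space"
begin

subsection \<open>Ternary polynomials and ideals\<close>

text \<open>The ring \<open>k[x\<^sub>0, x\<^sub>1, x\<^sub>2]\<close>: a polynomial maps each exponent vector to its coefficient, and
  multiplication is the convolution product of \<open>Poly_Mapping\<close>.\<close>

type_synonym 'k poly3 = "(3 \<Rightarrow>\<^sub>0 nat) \<Rightarrow>\<^sub>0 'k"

definition poly3_eval :: "'k::comm_ring_1 poly3 \<Rightarrow> 'k ^ 3 \<Rightarrow> 'k" where
  "poly3_eval F v =
     (\<Sum>e\<in>Poly_Mapping.keys F. Poly_Mapping.lookup F e * (\<Prod>i\<in>UNIV. (v $ i) ^ Poly_Mapping.lookup e i))"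

definition is_form :: "nat \<Rightarrow> 'k::comm_ring_1 poly3 \<Rightarrow> bool" where
  "is_form d F \<longleftrightarrow> (\<forall>e\<in>Poly_Mapping.keys F. (\<Sum>i\<in>UNIV. Poly_Mapping.lookup e i) = d)"

text \<open>Ideals of a commutative ring are its submodules; \<open>ring_ideal.span\<close> is the ideal generated
  by a set.\<close>

interpretation ring_ideal: module "(*) :: 'r::comm_ring_1 \<Rightarrow> 'r \<Rightarrow> 'r"
  by standard (simp_all add: algebra_simps)

definition ideal_mult :: "'r::comm_ring_1 set \<Rightarrow> 'r set \<Rightarrow> 'r set" where
  "ideal_mult I J = ring_ideal.span {a * b | a b. a \<in> I \<and> b \<in> J}"

primrec ideal_power :: "'r::comm_ring_1 set \<Rightarrow> nat \<Rightarrow> 'r set" where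
  "ideal_power I 0 = UNIV"
| "ideal_power I (Suc m) = ideal_mult I (ideal_power I m)"

subsection \<open>The projective plane\<close>

definition proj_equiv :: "'k::field ^ 3 \<Rightarrow> 'k ^ 3 \<Rightarrow> bool" where
  "proj_equiv v w \<longleftrightarrow> v \<noteq> 0 \<and> w \<noteq> 0 \<and> (\<exists>c. c \<noteq> 0 \<and> w = c *s v)"

lemma part_equivp_proj_equiv: "part_equivp (proj_equiv :: 'k::field ^ 3 \<Rightarrow> _)"
proof (rule part_equivpI)
  have "proj_equiv (vec 1) (vec 1 :: 'k ^ 3)"
    unfolding proj_equiv_def by (auto simp: vec_eq_iff intro!: exI[of _ 1])
  then show "\<exists>v :: 'k ^ 3. proj_equiv v v" ..
  show "symp (proj_equiv :: 'k ^ 3 \<Rightarrow> _)"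
  proof (rule sympI)
    fix v w :: "'k ^ 3"
    assume "proj_equiv v w"
    then obtain c where "v \<noteq> 0" "w \<noteq> 0" "c \<noteq> 0" "w = c *s v"
      unfolding proj_equiv_def by blast
    then show "proj_equiv w v"
      unfolding proj_equiv_def by (auto simp: vector_smult_assoc intro!: exI[of _ "inverse c"])
  qed
  show "transp (proj_equiv :: 'k ^ 3 \<Rightarrow> _)"
  proof (rule transpI)
    fix u v w :: "'k ^ 3"
    assume "proj_equiv u v" "proj_equiv v w"
    then obtain b c where "u \<noteq> 0" "w \<noteq> 0" "b \<noteq> 0" "v = b *s u" "c \<noteq> 0" "w = c *s v"
      unfolding proj_equiv_def by blast
    then show "proj_equiv u w"
      unfolding proj_equiv_def by (auto simp: vector_smult_assoc intro!: exI[of _ "c * b"])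
  qed
qed

quotient_type (overloaded) 'k proj_plane = "'k::field ^ 3" / partial: proj_equiv
  by (rule part_equivp_proj_equiv)

text \<open>All coordinate vectors of the point are tested, so that the notion is well defined for
  arbitrary polynomials; for a form a single coordinate vector decides.\<close>

lift_definition vanishes_at :: "'k::field poly3 \<Rightarrow> 'k proj_plane \<Rightarrow> bool" is
  "\<lambda>F v. \<forall>c. c \<noteq> 0 \<longrightarrow> poly3_eval F (c *s v) = 0"
proof -
  fix F :: "'k poly3" and v w :: "'k ^ 3"
  assume "proj_equiv v w"
  then obtain b where b: "b \<noteq> 0" "w = b *s v"
    unfolding proj_equiv_def by blast
  have "poly3_eval F (c *s v) = 0"
    if "\<forall>c. c \<noteq> 0 \<longrightarrow> poly3_eval F (c *s w) = 0" "c \<noteq> 0" for c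
    using that(1)[rule_format, of "c / b"] that(2) b by (simp add: vector_smult_assoc)
  then show "(\<forall>c. c \<noteq> 0 \<longrightarrow> poly3_eval F (c *s v) = 0) \<longleftrightarrow>
    (\<forall>c. c \<noteq> 0 \<longrightarrow> poly3_eval F (c *s w) = 0)"
    using b by (auto simp: vector_smult_assoc)
qed

definition plane_curve :: "nat \<Rightarrow> 'k::field proj_plane set \<Rightarrow> bool" where
  "plane_curve d C \<longleftrightarrow> (\<exists>F. F \<noteq> 0 \<and> is_form d F \<and> C = {P. vanishes_at F P})"

subsection \<open>Ideals of points, symbolic powers and the \<open>\<beta>\<close>-sequence\<close>

definition point_ideal :: "'k::field proj_plane \<Rightarrow> 'k poly3 set" where
  "point_ideal P = ring_ideal.span {F. (\<exists>d. is_form d F) \<and> vanishes_at F P}"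

definition radical_ideal :: "'k::field proj_plane set \<Rightarrow> 'k poly3 set" where
  "radical_ideal Z = (\<Inter>P\<in>Z. point_ideal P)"

definition symbolic_power :: "'k::field proj_plane set \<Rightarrow> nat \<Rightarrow> 'k poly3 set" where
  "symbolic_power Z m = (\<Inter>P\<in>Z. ideal_power (point_ideal P) m)"

text \<open>Meaningful for nonzero homogeneous ideals only, as \<open>LEAST\<close> is otherwise unspecified.\<close>

definition initial_degree :: "'k::field poly3 set \<Rightarrow> nat" where
  "initial_degree J = (LEAST d. \<exists>F\<in>J. F \<noteq> 0 \<and> is_form d F)"

text \<open>Indexed by \<open>Z\<close>, which determines and is determined by its radical ideal. The values
  are integers to avoid truncated subtraction.\<close>

definition beta_seq :: "'k::field proj_plane set \<Rightarrow> nat \<Rightarrow> int" where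
  "beta_seq Z m =
     (if m = 0 then int (initial_degree (radical_ideal Z))
      else int (initial_degree (symbolic_power Z (m + 1))) - int (initial_degree (symbolic_power Z m)))"

end

theory Submission
  imports Defs "Berlekamp_Zassenhaus.Unique_Factorization_Poly" "HOL-Analysis.Convex"
begin

text \<open>Write \<open>\<alpha>\<^sub>m\<close> for the initial degree of the \<open>m\<close>-th symbolic power. The main tool is the inequality
  of Esnault and Viehweg, \<open>(\<alpha>\<^sub>m + 1) / (m + 1) \<le> \<alpha>\<^sub>n / n\<close> whenever \<open>\<alpha>\<^sub>m / m > \<alpha>\<^sub>n / n\<close>, obtained from a Zariski
  decomposition on the blown-up plane, with Bezout's theorem as the only geometric input. Two jumps by one then
  force \<open>\<alpha>\<^sub>m \<le> m\<close>, and a form of degree at most \<open>m\<close> with multiplicity \<open>m\<close> at all points is a power of a line.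
  Five jumps by two force \<open>4 \<alpha>\<^sub>n \<le> 9 n\<close> for \<open>n = m + 5\<close>. If no conic contained the points, a suitable configuration of
  lines and conics through few of them would divide the form of degree \<open>\<alpha>\<^sub>n\<close>: either too often for its degree, or,
  as a curve of degree above \<open>2 j\<close> with multiplicity at most \<open>j\<close> at the points, contradicting \<open>\<alpha>\<^sub>n\<^sub>-\<^sub>j = \<alpha>\<^sub>n - 2 j\<close>.
  For (c), a \<open>d\<close> by \<open>d\<close> grid has \<open>\<alpha>\<^sub>m = d m\<close>; adding the points at infinity of both directions does not change
  this for \<open>m \<ge> 2\<close>, but destroys the curves of degree \<open>d\<close>.\<close>

text \<open>The vanishing theorem usually behind the growth inequality is replaced by counting
  coefficients: with too few conditions, a form of multiplicity \<open>m\<close> would exist in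
  degree one below the initial degree. Two facts about intersection numbers carry the count. For the
  diagonal form d d' - sum u_v u'_v the index theorem is the Cauchy-Schwarz inequality. The error
  made by rounding up is absorbed by Bezout between a component and one of its partial derivatives,
  which is where characteristic 0 enters the inequality. Origin of the slope 9/4: with a the initial
  degree at m, n = m + 5 and a + 10 the one at n, the inequality reads (a + 1)(m + 5) <= (m + 1)(a +
  10), that is 4 (a + 10) <= 9 (m + 5). This slope lies below 30/13 and 7/3, the thresholds that
  three conics, or lines together with a further curve or point, would require. The six vertices of
  a complete quadrilateral have slope at most 2 and are excluded by a parity argument instead. In
  (c) the two pencils of grid lines share the exponent m about equally; at m = 1 one of them gets
  exponent 0, which leaves a point at infinity uncovered.\<close>

hide_const (open) Divisibility.prime Polynomial.content

no_notation Matrix.vec_index (infixl \<open>$\<close> 100)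

text \<open>The interpretation \<open>ring_ideal\<close> makes reassociation of products to the left a simp rule, which
  loops with \<open>algebra_simps\<close>.\<close>

declare ring_ideal.scale_scale [simp del]

section \<open>Ternary polynomials\<close>

type_synonym mon3 = "3 \<Rightarrow>\<^sub>0 nat"

abbreviation coef :: "'k::zero poly3 \<Rightarrow> mon3 \<Rightarrow> 'k" where
  "coef \<equiv> Poly_Mapping.lookup"

abbreviation expo :: "mon3 \<Rightarrow> 3 \<Rightarrow> nat" where
  "expo \<equiv> Poly_Mapping.lookup"

definition mdeg :: "mon3 \<Rightarrow> nat" where
  "mdeg e = (\<Sum>i\<in>UNIV. expo e i)"

definition var :: "3 \<Rightarrow> 'k::comm_ring_1 poly3" where
  "var i = Poly_Mapping.single (Poly_Mapping.single i 1) 1"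

abbreviation const :: "'k::comm_ring_1 \<Rightarrow> 'k poly3" where
  "const \<equiv> Poly_Mapping.single 0"

text \<open>The universal homomorphism out of the polynomial ring. Evaluation, translation, linear
  changes of coordinates, restriction to a plane and the passage to nested univariate polynomials
  are all instances, so their homomorphism laws are proved once.\<close>

definition subst :: "('k::comm_ring_1 \<Rightarrow> 'r::comm_ring_1) \<Rightarrow> (3 \<Rightarrow> 'r) \<Rightarrow> 'k poly3 \<Rightarrow> 'r" where
  "subst h s F = (\<Sum>e\<in>Poly_Mapping.keys F. h (coef F e) * (\<Prod>i\<in>UNIV. s i ^ expo e i))"

lemma is_form_iff: "is_form d F \<longleftrightarrow> (\<forall>e\<in>Poly_Mapping.keys F. mdeg e = d)"
  by (simp add: is_form_def mdeg_def)

lemma mdeg_add [simp]: "mdeg (a + b) = mdeg a + mdeg b"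
  by (simp add: mdeg_def lookup_add sum.distrib)

lemma mdeg_0 [simp]: "mdeg 0 = 0"
  by (simp add: mdeg_def)

lemma mdeg_single [simp]: "mdeg (Poly_Mapping.single i n) = n"
  by (simp add: mdeg_def lookup_single when_def)

lemma mdeg_eq_0_iff [simp]: "mdeg e = 0 \<longleftrightarrow> e = 0"
  by (auto simp: mdeg_def intro: poly_mapping_eqI)

lemma mdeg_eq: "mdeg e = expo e 1 + expo e 2 + expo e 3"
  unfolding mdeg_def sum_3 ..

lemma expo_le_mdeg: "expo e i \<le> mdeg e"
  unfolding mdeg_def by (rule member_le_sum) auto

lemma sum_single_eq: "(\<Sum>e\<in>Poly_Mapping.keys F. Poly_Mapping.single e (Poly_Mapping.lookup F e)) = F"
  by (rule poly_mapping_eqI) (simp add: lookup_sum lookup_single when_def in_keys_iff)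

lemma poly3_induct [case_names single add]:
  assumes "\<And>e c. P (Poly_Mapping.single e c)" "\<And>F G. P F \<Longrightarrow> P G \<Longrightarrow> P (F + G)"
  shows "P (F :: 'k::comm_ring_1 poly3)"
proof -
  have "P (\<Sum>e\<in>A. Poly_Mapping.single e (coef F e))" if "finite A" for A
    using that
  proof induction
    case empty
    show ?case using assms(1)[of 0 0] by simp
  qed (simp add: assms)
  then show ?thesis
    by (metis finite_keys sum_single_eq)
qed

context comm_ring_hom
begin

lemma subst_superset:
  assumes "finite A" "Poly_Mapping.keys F \<subseteq> A"
  shows "subst hom s F = (\<Sum>e\<in>A. hom (coef F e) * (\<Prod>i\<in>UNIV. s i ^ expo e i))"
  unfolding subst_def using assms
  by (intro sum.mono_neutral_left) (auto simp: in_keys_iff)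

lemma subst_single: "subst hom s (Poly_Mapping.single e c) = hom c * (\<Prod>i\<in>UNIV. s i ^ expo e i)"
  by (subst subst_superset[of "{e}"]) auto

lemma subst_0 [simp]: "subst hom s 0 = 0"
  by (simp add: subst_def)

lemma subst_add: "subst hom s (F + G) = subst hom s F + subst hom s G"
proof -
  let ?A = "Poly_Mapping.keys F \<union> Poly_Mapping.keys G"
  show ?thesis
    by (simp add: subst_superset[of ?A F] subst_superset[of ?A G] subst_superset[of ?A "F + G"]
        keys_add lookup_add hom_add ring_distribs sum.distrib)
qed

lemma subst_mult: "subst hom s (F * G) = subst hom s F * subst hom s G"
proof (induction F rule: poly3_induct)
  case (single e c)
  show ?case
  proof (induction G rule: poly3_induct)
    case (single e' c')
    show ?case
      by (simp only: mult_single subst_single hom_mult lookup_add power_add prod.distrib ac_simps)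
  qed (simp add: subst_add algebra_simps)
qed (simp add: subst_add algebra_simps)

lemma subst_const [simp]: "subst hom s (const c) = hom c"
  by (simp add: subst_single)

lemma subst_1 [simp]: "subst hom s 1 = 1"
  using subst_const[of s 1] by (simp del: subst_const)

lemma subst_var [simp]: "subst hom s (var i) = s i"
  unfolding var_def
  by (simp add: subst_single lookup_single when_def power_0 if_distrib[of "(^) _"] cong: if_cong)

lemma subst_comm_ring_hom: "comm_ring_hom (subst hom s)"
  by unfold_locales (auto simp: subst_add subst_mult)

end

lemma hom_subst:
  assumes "comm_ring_hom h" "comm_ring_hom g"
  shows "g (subst h s F) = subst (\<lambda>c. g (h c)) (\<lambda>i. g (s i)) F"
proof -
  interpret h: comm_ring_hom h by fact
  interpret g: comm_ring_hom g by fact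
  show ?thesis
    unfolding subst_def by (simp add: g.hom_sum g.hom_mult g.hom_prod g.hom_power)
qed

interpretation const: comm_ring_hom "const :: 'k::comm_ring_1 \<Rightarrow> 'k poly3"
  by unfold_locales (auto simp: single_add mult_single)

lemma comm_ring_hom_id: "comm_ring_hom (\<lambda>x::'k::comm_ring_1. x)"
  by unfold_locales auto

lemma poly3_eval_eq_subst: "poly3_eval F v = subst (\<lambda>x. x) (\<lambda>i. v $ i) F"
  by (simp add: poly3_eval_def subst_def)

lemma single_eq_prod_var:
  "Poly_Mapping.single e c = const c * (\<Prod>i\<in>UNIV. var i ^ expo e i)"
proof -
  have p: "(var i ^ n :: 'a poly3) = Poly_Mapping.single (Poly_Mapping.single i n) 1" for i n
  proof (induction n)
    case (Suc n)
    have "Poly_Mapping.single i (1::nat) + Poly_Mapping.single i n = Poly_Mapping.single i (Suc n)"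
      by (simp only: single_add[symmetric] plus_1_eq_Suc)
    then show ?case using Suc by (simp only: power_Suc var_def mult_single mult_1_left)
  qed simp
  have q: "(\<Prod>i\<in>A. Poly_Mapping.single (f i) (1::'a)) = Poly_Mapping.single (\<Sum>i\<in>A. f i) 1"
    if "finite A" for A :: "3 set" and f :: "3 \<Rightarrow> mon3"
    using that by induction (auto simp: mult_single)
  have "(\<Sum>i\<in>UNIV. Poly_Mapping.single i (expo e i)) = e"
    by (rule poly_mapping_eqI) (simp add: lookup_sum lookup_single when_def)
  then show ?thesis
    by (simp add: p q mult_single)
qed

lemma subst_const_var [simp]: "subst const var F = F"
proof -
  have "subst const var F = (\<Sum>e\<in>Poly_Mapping.keys F. Poly_Mapping.single e (coef F e))"
    unfolding subst_def by (simp add: single_eq_prod_var[symmetric])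
  then show ?thesis by (simp add: sum_single_eq)
qed

lemma coef_const_mult: "coef (const c * F) e = c * coef F e"
proof (induction F rule: poly3_induct)
  case (single e' c')
  then show ?case by (simp add: mult_single lookup_single when_def)
qed (simp add: algebra_simps lookup_add)

subsection \<open>Forms\<close>

lemma is_form_0 [simp]: "is_form d 0"
  by (simp add: is_form_iff)

lemma is_form_add: "is_form d F \<Longrightarrow> is_form d G \<Longrightarrow> is_form d (F + G)"
  using keys_add[of F G] by (fastforce simp: is_form_iff)

lemma is_form_sum: "(\<And>a. a \<in> A \<Longrightarrow> is_form d (f a)) \<Longrightarrow> is_form d (sum f A)"
  by (induction A rule: infinite_finite_induct) (auto intro: is_form_add)

lemma is_form_mult: "is_form d F \<Longrightarrow> is_form d' G \<Longrightarrow> is_form (d + d') (F * G)"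
  using keys_mult[of F G] by (fastforce simp: is_form_iff)

lemma is_form_single: "mdeg e = d \<Longrightarrow> is_form d (Poly_Mapping.single e c)"
  by (simp add: is_form_iff)

lemma is_form_const [simp]: "is_form 0 (const c)"
  by (rule is_form_single) simp

lemma is_form_1 [simp]: "is_form 0 1"
  using is_form_const[of 1] by simp

lemma is_form_var [simp]: "is_form (Suc 0) (var i)"
  by (simp add: var_def is_form_single)

lemma is_form_power: "is_form d F \<Longrightarrow> is_form (n * d) (F ^ n)"
  by (induction n) (auto dest: is_form_mult)

lemma is_form_prod:
  "(\<And>a. a \<in> A \<Longrightarrow> is_form (d a) (f a)) \<Longrightarrow> is_form (\<Sum>a\<in>A. d a) (\<Prod>a\<in>A. f a)"
  by (induction A rule: infinite_finite_induct) (auto intro: is_form_mult)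

lemma is_form_const_mult: "is_form d F \<Longrightarrow> is_form d (const c * F)"
  using is_form_mult[OF is_form_const] by fastforce

lemma is_form_uminus: "is_form d F \<Longrightarrow> is_form d (- F)"
  by (simp add: is_form_iff in_keys_iff)

lemma is_form_diff: "is_form d F \<Longrightarrow> is_form d G \<Longrightarrow> is_form d (F - G)"
  by (metis diff_conv_add_uminus is_form_add is_form_uminus)

lemma is_form_unique: "is_form d F \<Longrightarrow> is_form d' F \<Longrightarrow> F \<noteq> 0 \<Longrightarrow> d = d'"
  by (metis is_form_iff all_not_in_conv keys_eq_empty)

lemma is_form_coef: "is_form d F \<Longrightarrow> coef F e \<noteq> 0 \<Longrightarrow> mdeg e = d"
  by (simp add: is_form_iff in_keys_iff)

lemma is_form_0_eq_const:
  assumes "is_form 0 F"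
  shows "F = const (coef F 0)"
proof (rule poly_mapping_eqI)
  fix e
  show "coef F e = coef (const (coef F 0)) e"
  proof (cases "e = 0")
    case False
    then have "coef F e = 0"
      using is_form_coef[OF assms, of e] by auto
    then show ?thesis using False by (simp add: lookup_single)
  qed simp
qed

lemma is_form_subst:
  assumes "is_form d F" "\<And>i. is_form (Suc 0) (s i)"
  shows "is_form d (subst const s F)"
  unfolding subst_def
proof (rule is_form_sum)
  fix e assume "e \<in> Poly_Mapping.keys F"
  then have "d = 0 + (\<Sum>i\<in>UNIV. expo e i * Suc 0)"
    using assms by (simp add: is_form_iff mdeg_def)
  moreover have "is_form (\<Sum>i\<in>UNIV. expo e i * Suc 0) (\<Prod>i\<in>UNIV. s i ^ expo e i)"
    by (rule is_form_prod) (rule is_form_power[OF assms(2)])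
  ultimately show "is_form d (const (coef F e) * (\<Prod>i\<in>UNIV. s i ^ expo e i))"
    by (simp add: is_form_const_mult)
qed

subsection \<open>Order of vanishing at the origin\<close>

definition ord_ge :: "nat \<Rightarrow> 'k::zero poly3 \<Rightarrow> bool" where
  "ord_ge m F \<longleftrightarrow> (\<forall>e\<in>Poly_Mapping.keys F. m \<le> mdeg e)"

lemma ord_ge_coef: "ord_ge m F \<longleftrightarrow> (\<forall>e. mdeg e < m \<longrightarrow> coef F e = 0)"
  by (auto simp: ord_ge_def in_keys_iff not_le[symmetric])

lemma ord_ge_0 [simp]: "ord_ge 0 F" "ord_ge m 0"
  by (auto simp: ord_ge_def)

lemma ord_ge_add: "ord_ge m F \<Longrightarrow> ord_ge m G \<Longrightarrow> ord_ge m (F + G)"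
  by (simp add: ord_ge_coef lookup_add)

lemma ord_ge_sum: "(\<And>a. a \<in> A \<Longrightarrow> ord_ge d (f a)) \<Longrightarrow> ord_ge d (sum f A)"
  by (induction A rule: infinite_finite_induct) (auto intro: ord_ge_add)

lemma ord_ge_mult: "ord_ge m F \<Longrightarrow> ord_ge n G \<Longrightarrow> ord_ge (m + n) (F * G)"
  using keys_mult[of F G] by (fastforce simp: ord_ge_def intro: add_mono)

lemma ord_ge_mono: "ord_ge m F \<Longrightarrow> n \<le> m \<Longrightarrow> ord_ge n F"
  by (auto simp: ord_ge_def)

lemma is_form_imp_ord_ge: "is_form d F \<Longrightarrow> ord_ge d F"
  by (auto simp: ord_ge_def is_form_iff)

lemma ord_ge_Suc_form:
  assumes "ord_ge m (F :: 'k::comm_ring_1 poly3)"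
  obtains A R where "F = A + R" "is_form m A" "ord_ge (Suc m) R"
proof
  let ?K = "{e \<in> Poly_Mapping.keys F. mdeg e = m}" and ?L = "{e \<in> Poly_Mapping.keys F. mdeg e \<noteq> m}"
  let ?A = "\<Sum>e\<in>?K. Poly_Mapping.single e (coef F e)" and ?R = "\<Sum>e\<in>?L. Poly_Mapping.single e (coef F e)"
  have "Poly_Mapping.keys F = ?K \<union> ?L" by auto
  then have "(\<Sum>e\<in>Poly_Mapping.keys F. Poly_Mapping.single e (coef F e)) = ?A + ?R"
    by (subst sum.union_disjoint[symmetric]) auto
  then show "F = ?A + ?R" by (simp add: sum_single_eq)
  show "is_form m ?A"
    by (intro is_form_sum) (auto intro: is_form_single)
  show "ord_ge (Suc m) ?R"
    using assms by (intro ord_ge_sum) (auto simp: ord_ge_def)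
qed

text \<open>A minimum over the empty set at the zero polynomial, so the value is informative only
  for nonzero polynomials; \<open>ord_ge\<close> covers the zero polynomial as well.\<close>

definition ord0 :: "'k::zero poly3 \<Rightarrow> nat" where
  "ord0 F = Min (mdeg ` Poly_Mapping.keys F)"

lemma ord_ge_iff_ord: "F \<noteq> 0 \<Longrightarrow> ord_ge m F \<longleftrightarrow> m \<le> ord0 F" for F :: "'k::comm_ring_1 poly3"
  unfolding ord0_def ord_ge_def by (subst Min_ge_iff) auto

lemma ord_eqI:
  assumes "F = A + R" "is_form m A" "A \<noteq> 0" "ord_ge (Suc m) R"
  shows "ord0 (F :: 'k::comm_ring_1 poly3) = m"
proof -
  obtain e where e: "e \<in> Poly_Mapping.keys A"
    using assms(3) by fastforce
  then have m: "mdeg e = m" using assms(2) by (simp add: is_form_iff)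
  then have "coef R e = 0" using assms(4) by (simp add: ord_ge_coef)
  then have eF: "e \<in> Poly_Mapping.keys F"
    using e by (simp add: assms(1) in_keys_iff lookup_add)
  then have F: "F \<noteq> 0" by auto
  have "ord_ge m F"
    unfolding assms(1) by (rule ord_ge_add[OF is_form_imp_ord_ge[OF assms(2)] ord_ge_mono[OF assms(4)]]) simp
  then have "m \<le> ord0 F" using F ord_ge_iff_ord by blast
  moreover have "ord0 F \<le> m"
    unfolding ord0_def using eF m by (auto intro: Min_le)
  ultimately show ?thesis by simp
qed

lemma ord_decomp:
  assumes "(F :: 'k::comm_ring_1 poly3) \<noteq> 0"
  obtains A R where "F = A + R" "is_form (ord0 F) A" "A \<noteq> 0" "ord_ge (Suc (ord0 F)) R"
proof -
  have "ord_ge (ord0 F) F" using ord_ge_iff_ord[OF assms] by blast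
  then obtain A R where AR: "F = A + R" "is_form (ord0 F) A" "ord_ge (Suc (ord0 F)) R"
    by (rule ord_ge_Suc_form)
  have "A \<noteq> 0"
  proof
    assume "A = 0"
    then have "ord_ge (Suc (ord0 F)) F" using AR by simp
    then show False using ord_ge_iff_ord[OF assms] by auto
  qed
  then show ?thesis using that AR by blast
qed

text \<open>The product of the two lowest homogeneous parts is the lowest part of the product, being
  nonzero in a domain.\<close>

lemma ord_mult:
  fixes F G :: "'k::idom poly3"
  assumes "F \<noteq> 0" "G \<noteq> 0"
  shows "ord0 (F * G) = ord0 F + ord0 G"
proof -
  obtain A R where A: "F = A + R" "is_form (ord0 F) A" "A \<noteq> 0" "ord_ge (Suc (ord0 F)) R"
    using ord_decomp[OF assms(1)] .
  obtain B S where B: "G = B + S" "is_form (ord0 G) B" "B \<noteq> 0" "ord_ge (Suc (ord0 G)) S"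
    using ord_decomp[OF assms(2)] .
  have a: "ord_ge (ord0 F) A" and b: "ord_ge (ord0 G) B"
    using A B by (auto intro: is_form_imp_ord_ge)
  have "ord_ge (Suc (ord0 F + ord0 G)) (A * S + R * B + R * S)"
    using ord_ge_mult[OF a B(4)] ord_ge_mult[OF A(4) b] ord_ge_mult[OF A(4) B(4)]
    by (intro ord_ge_add) (auto intro: ord_ge_mono)
  moreover have "F * G = A * B + (A * S + R * B + R * S)"
    by (simp add: A(1) B(1) algebra_simps)
  moreover have "is_form (ord0 F + ord0 G) (A * B)" "A * B \<noteq> 0"
    using is_form_mult[OF A(2) B(2)] A(3) B(3) by auto
  ultimately show ?thesis
    by (intro ord_eqI)
qed

lemma ord_form: "is_form d F \<Longrightarrow> F \<noteq> 0 \<Longrightarrow> ord0 F = d" for F :: "'k::comm_ring_1 poly3"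
  by (rule ord_eqI[of _ F 0]) auto

subsection \<open>Divisors of forms\<close>

definition topdeg :: "'k::zero poly3 \<Rightarrow> nat" where
  "topdeg F = Max (mdeg ` Poly_Mapping.keys F)"

lemma top_decomp:
  assumes "(F :: 'k::comm_ring_1 poly3) \<noteq> 0"
  obtains A R where "F = A + R" "is_form (topdeg F) A" "A \<noteq> 0" "\<forall>e\<in>Poly_Mapping.keys R. mdeg e < topdeg F"
proof
  let ?K = "{e \<in> Poly_Mapping.keys F. mdeg e = topdeg F}" and ?L = "{e \<in> Poly_Mapping.keys F. mdeg e \<noteq> topdeg F}"
  let ?A = "\<Sum>e\<in>?K. Poly_Mapping.single e (coef F e)" and ?R = "\<Sum>e\<in>?L. Poly_Mapping.single e (coef F e)"
  have "Poly_Mapping.keys F = ?K \<union> ?L" by auto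
  then have "(\<Sum>e\<in>Poly_Mapping.keys F. Poly_Mapping.single e (coef F e)) = ?A + ?R"
    by (subst sum.union_disjoint[symmetric]) auto
  then show F: "F = ?A + ?R" by (simp add: sum_single_eq)
  show "is_form (topdeg F) ?A"
    by (intro is_form_sum) (auto intro: is_form_single)
  have "Poly_Mapping.keys ?R \<subseteq> ?L"
    by (rule order_trans[OF keys_sum]) auto
  moreover have "mdeg e < topdeg F" if "e \<in> ?L" for e
    using that Max_ge[of "mdeg ` Poly_Mapping.keys F" "mdeg e"] by (auto simp: topdeg_def le_neq_implies_less)
  ultimately show R: "\<forall>e\<in>Poly_Mapping.keys ?R. mdeg e < topdeg F" by blast
  show "?A \<noteq> 0"
  proof
    assume A: "?A = 0"
    have "topdeg F \<in> mdeg ` Poly_Mapping.keys F"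
      unfolding topdeg_def using assms by (intro Max_in) auto
    then show False using R F A by auto
  qed
qed

text \<open>Lowest and highest degree are both additive over products. They agree for the product,
  and lowest never exceeds highest in a factor, so they agree in each factor.\<close>

lemma mult_form_imp_form:
  fixes F G :: "'k::idom poly3"
  assumes "is_form d (F * G)" "F * G \<noteq> 0"
  shows "is_form (ord0 F) F"
proof -
  have F: "F \<noteq> 0" and G: "G \<noteq> 0" using assms(2) by auto
  obtain A R where A: "F = A + R" "is_form (topdeg F) A" "A \<noteq> 0" "\<forall>e\<in>Poly_Mapping.keys R. mdeg e < topdeg F"
    using top_decomp[OF F] .
  obtain B S where B: "G = B + S" "is_form (topdeg G) B" "B \<noteq> 0" "\<forall>e\<in>Poly_Mapping.keys S. mdeg e < topdeg G"
    using top_decomp[OF G] .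
  have FG: "F * G = A * B + (A * S + R * B + R * S)"
    by (simp add: A(1) B(1) algebra_simps)
  have AB: "is_form (topdeg F + topdeg G) (A * B)" "A * B \<noteq> 0"
    using A B by (auto intro: is_form_mult)
  obtain e where e: "e \<in> Poly_Mapping.keys (A * B)" using AB(2) by fastforce
  have me: "mdeg e = topdeg F + topdeg G" using e AB(1) by (simp add: is_form_iff)
  have "mdeg e' < topdeg F + topdeg G" if "e' \<in> Poly_Mapping.keys (A * S + R * B + R * S)" for e'
  proof -
    have "e' \<in> Poly_Mapping.keys (A * S) \<union> Poly_Mapping.keys (R * B) \<union> Poly_Mapping.keys (R * S)"
      using that keys_add[of "A * S + R * B" "R * S"] keys_add[of "A * S" "R * B"] by blast
    then have "e' \<in> {a + b |a b. a \<in> Poly_Mapping.keys A \<and> b \<in> Poly_Mapping.keys S}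
       \<union> {a + b |a b. a \<in> Poly_Mapping.keys R \<and> b \<in> Poly_Mapping.keys B}
       \<union> {a + b |a b. a \<in> Poly_Mapping.keys R \<and> b \<in> Poly_Mapping.keys S}"
      using keys_mult[of A S] keys_mult[of R B] keys_mult[of R S] by blast
    then show ?thesis
      using A(2,4) B(2,4) by (fastforce simp: is_form_iff)
  qed
  then have "e \<notin> Poly_Mapping.keys (A * S + R * B + R * S)" using me by fastforce
  then have "e \<in> Poly_Mapping.keys (F * G)"
    using e by (simp add: FG in_keys_iff lookup_add)
  then have "d = topdeg F + topdeg G" using assms(1) me by (simp add: is_form_iff)
  moreover have "d = ord0 F + ord0 G"
    using ord_form[OF assms] ord_mult[OF F G] by simp
  moreover have "ord0 F \<le> topdeg F" "ord0 G \<le> topdeg G"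
    unfolding ord0_def topdeg_def using F G by (auto intro!: Min_le Max_in)
  ultimately have eq: "ord0 F = topdeg F" by linarith
  have "mdeg e = ord0 F" if "e \<in> Poly_Mapping.keys F" for e
  proof -
    have "ord0 F \<le> mdeg e" "mdeg e \<le> topdeg F"
      unfolding ord0_def topdeg_def using that by auto
    then show ?thesis using eq by simp
  qed
  then show ?thesis by (simp add: is_form_iff)
qed

lemma dvd_form_imp_form:
  fixes F G :: "'k::idom poly3"
  assumes "is_form d F" "F \<noteq> 0" "F = G * H"
  obtains a b where "is_form a G" "is_form b H" "a + b = d"
proof -
  have "is_form (ord0 G) G" "is_form (ord0 H) H"
    using mult_form_imp_form[of d G H] mult_form_imp_form[of d H G] assms by (simp_all add: mult.commute)
  moreover have "ord0 G + ord0 H = d"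
    using assms ord_mult[of G H] ord_form[of d F] by auto
  ultimately show ?thesis using that by blast
qed

subsection \<open>Counting monomials\<close>

definition monomials :: "nat \<Rightarrow> mon3 set" where
  "monomials d = {e. mdeg e = d}"

lemma mon3_eqI:
  assumes "a \<noteq> k" "mdeg e = mdeg e'" "expo e k = expo e' k" "expo e a = expo e' a"
  shows "e = e'"
proof -
  have "expo e 1 = expo e' 1 \<and> expo e 2 = expo e' 2 \<and> expo e 3 = expo e' 3"
    using assms exhaust_3[of a] exhaust_3[of k] by (auto simp: mdeg_eq)
  then show ?thesis
    by (intro poly_mapping_eqI) (metis exhaust_3)
qed

lemma sum_Suc_lessThan: "(\<Sum>s<\<mu>. Suc s) = \<mu> * (\<mu> + 1) div 2"
  by (induction \<mu>) auto

text \<open>These are the monomials of order below \<open>\<mu>\<close> at the \<open>k\<close>-th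
  coordinate point: setting the \<open>k\<close>-th variable to 1 leaves degree
  \<open>d - expo e k\<close>. Such a monomial is determined by that order s and one further
  exponent in 0, ..., s, whence the triangular number.\<close>

lemma finite_card_monomials_le:
  fixes k :: 3
  shows "finite {e \<in> monomials d. d < expo e k + \<mu>}"
    and "card {e \<in> monomials d. d < expo e k + \<mu>} \<le> \<mu> * (\<mu> + 1) div 2"
proof -
  obtain a :: 3 where a: "a \<noteq> k" by (metis zero_neq_one)
  let ?S = "{e \<in> monomials d. d < expo e k + \<mu>}" and ?T = "SIGMA s:{..<\<mu>}. {..s}"
  let ?f = "\<lambda>e. (d - expo e k, expo e a)"
  have le: "expo e k + expo e a \<le> mdeg e" for e
    using a exhaust_3[of a] exhaust_3[of k] by (auto simp: mdeg_eq)
  have inj: "inj_on ?f ?S"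
  proof (rule inj_onI)
    fix e e' assume *: "e \<in> ?S" "e' \<in> ?S" "?f e = ?f e'"
    then have "expo e k = expo e' k"
      using le[of e] le[of e'] by (auto simp: monomials_def)
    then show "e = e'" using * by (intro mon3_eqI[OF a]) (auto simp: monomials_def)
  qed
  have sub: "?f ` ?S \<subseteq> ?T"
  proof clarsimp
    fix e assume "e \<in> monomials d" "d < expo e k + \<mu>"
    then show "d - expo e k < \<mu> \<and> expo e a \<le> d - expo e k"
      using le[of e] by (auto simp: monomials_def)
  qed
  have fin: "finite ?T" by auto
  show "finite ?S" using finite_imageD[OF finite_subset[OF sub fin] inj] .
  have "card ?S \<le> card ?T" using inj sub fin by (rule card_inj_on_le)
  also have "card ?T = (\<Sum>s<\<mu>. Suc s)" by simp
  finally show "card ?S \<le> \<mu> * (\<mu> + 1) div 2" by (simp add: sum_Suc_lessThan)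
qed

lemma finite_monomials [simp]: "finite (monomials d)"
proof -
  have "monomials d = {e \<in> monomials d. d < expo e 1 + Suc d}" by auto
  then show ?thesis using finite_card_monomials_le(1) by metis
qed

lemma card_monomials: "card (monomials d) = (d + 1) * (d + 2) div 2"
proof (rule antisym)
  have "monomials d = {e \<in> monomials d. d < expo e 1 + Suc d}" by auto
  then have "card (monomials d) \<le> Suc d * (Suc d + 1) div 2"
    using finite_card_monomials_le(2)[of d 1 "Suc d"] by metis
  then show "card (monomials d) \<le> (d + 1) * (d + 2) div 2" by simp
  let ?T = "SIGMA s:{..<Suc d}. {..s}"
  let ?g = "\<lambda>(s, i). Poly_Mapping.single (1::3) i + Poly_Mapping.single 2 (s - i) + Poly_Mapping.single 3 (d - s)"
  have ne: "(1::3) \<noteq> 2" "(1::3) \<noteq> 3" "(2::3) \<noteq> 3" by auto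
  have "inj_on ?g ?T"
  proof (rule inj_onI)
    fix x y
    assume *: "x \<in> ?T" "y \<in> ?T" "?g x = ?g y"
    obtain s i s' i' where xy: "x = (s, i)" "y = (s', i')" by fastforce
    from arg_cong[OF *(3), of "\<lambda>e. expo e 1"] arg_cong[OF *(3), of "\<lambda>e. expo e 2"]
    have "i = i'" "s - i = s' - i'"
      using ne by (auto simp: xy lookup_add lookup_single when_def simp del: numeral_eq_one_iff)
    then show "x = y" using * by (auto simp: xy)
  qed
  moreover have "?g ` ?T \<subseteq> monomials d"
    by (auto simp: monomials_def)
  ultimately have "card ?T \<le> card (monomials d)"
    by (meson card_inj_on_le finite_monomials)
  then show "(d + 1) * (d + 2) div 2 \<le> card (monomials d)"
    using sum_Suc_lessThan[of "Suc d"] by simp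
qed

section \<open>Multiplicity at a point\<close>

definition shift :: "'k::comm_ring_1 ^ 3 \<Rightarrow> 'k poly3 \<Rightarrow> 'k poly3" where
  "shift v = subst const (\<lambda>i. var i + const (v $ i))"

text \<open>The order is taken in affine 3-space at the vector \<open>v\<close>. For a form and
  \<open>v\<close> nonzero it is the multiplicity of the plane curve at the point of
  \<open>v\<close>, because the cone over a curve is, near \<open>v\<close>, the curve times a
  line.\<close>

definition mult_ge :: "'k::comm_ring_1 ^ 3 \<Rightarrow> nat \<Rightarrow> 'k poly3 \<Rightarrow> bool" where
  "mult_ge v m F \<longleftrightarrow> ord_ge m (shift v F)"

definition mult_at :: "'k::comm_ring_1 ^ 3 \<Rightarrow> 'k poly3 \<Rightarrow> nat" where
  "mult_at v F = ord0 (shift v F)"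

interpretation shift: comm_ring_hom "shift v :: 'k::comm_ring_1 poly3 \<Rightarrow> _"
  unfolding shift_def by (rule const.subst_comm_ring_hom)

lemma shift_var [simp]: "shift v (var i) = var i + const (v $ i)"
  by (simp add: shift_def)

lemma shift_const [simp]: "shift v (const c) = const c"
  by (simp add: shift_def)

lemma subst_const_comp:
  "subst const t (subst const s F) = subst const (\<lambda>i. subst const t (s i)) F"
  using hom_subst[OF const.comm_ring_hom_axioms const.subst_comm_ring_hom[of t]] by simp

lemma shift_uminus_shift [simp]: "shift (- v) (shift v F) = F"
proof -
  have "(var i + const ((- v) $ i) + const (v $ i) :: 'a poly3) = var i" for i
    by (simp add: add.assoc single_add[symmetric] del: single_uminus)
  then have "(\<lambda>i. subst const (\<lambda>i. var i + const ((- v) $ i)) (var i + const (v $ i))) = var"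
    by (auto simp: const.subst_add)
  then show ?thesis
    unfolding shift_def subst_const_comp by simp
qed

lemma shift_eq_0_iff [simp]: "shift v F = 0 \<longleftrightarrow> F = 0"
  by (metis shift_uminus_shift shift.hom_zero)

lemma mult_ge_0 [simp]: "mult_ge v 0 F" "mult_ge v m 0"
  by (simp_all add: mult_ge_def)

lemma mult_ge_add: "mult_ge v m F \<Longrightarrow> mult_ge v m G \<Longrightarrow> mult_ge v m (F + G)"
  by (simp add: mult_ge_def ord_ge_add shift.hom_add)

lemma mult_ge_mult: "mult_ge v m F \<Longrightarrow> mult_ge v n G \<Longrightarrow> mult_ge v (m + n) (F * G)"
  by (simp add: mult_ge_def ord_ge_mult shift.hom_mult)

lemma mult_ge_mult_left: "mult_ge v m F \<Longrightarrow> mult_ge v m (G * F)"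
  using mult_ge_mult[of v 0 G m F] by simp

lemma mult_ge_mono: "mult_ge v m F \<Longrightarrow> n \<le> m \<Longrightarrow> mult_ge v n F"
  by (auto simp: mult_ge_def intro: ord_ge_mono)

lemma mult_ge_power: "mult_ge v m F \<Longrightarrow> mult_ge v (n * m) (F ^ n)"
  by (induction n) (auto dest: mult_ge_mult)

lemma mult_ge_iff_mult_at: "F \<noteq> 0 \<Longrightarrow> mult_ge v m F \<longleftrightarrow> m \<le> mult_at v F"
  by (simp add: mult_ge_def mult_at_def ord_ge_iff_ord)

lemma mult_ge_mult_at: "mult_ge v (mult_at v F) F"
  by (cases "F = 0") (auto simp: mult_ge_iff_mult_at)

lemma mult_at_mult:
  "F \<noteq> 0 \<Longrightarrow> G \<noteq> 0 \<Longrightarrow> mult_at v (F * G) = mult_at v F + mult_at v G" for F :: "'k::idom poly3"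
  by (simp add: mult_at_def shift.hom_mult ord_mult)

lemma mult_at_const [simp]: "c \<noteq> 0 \<Longrightarrow> mult_at v (const c) = 0"
proof -
  assume "c \<noteq> 0"
  then have "const c \<noteq> 0" by (metis lookup_single_eq lookup_zero)
  then show ?thesis by (simp add: mult_at_def ord_form)
qed

lemma mult_at_1 [simp]: "mult_at v 1 = 0"
  using mult_at_const[of 1] by simp

lemma mult_at_power: "F \<noteq> 0 \<Longrightarrow> mult_at v (F ^ n) = n * mult_at v F" for F :: "'k::idom poly3"
  by (induction n) (auto simp: mult_at_mult)

lemma mult_at_prod:
  fixes f :: "'a \<Rightarrow> 'k::idom poly3"
  assumes "\<And>a. a \<in> A \<Longrightarrow> f a \<noteq> 0"
  shows "mult_at v (prod f A) = (\<Sum>a\<in>A. mult_at v (f a))"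
  using assms by (induction A rule: infinite_finite_induct) (auto simp: mult_at_mult)

lemma coef_0_eq_subst: "coef F 0 = subst (\<lambda>x. x) (\<lambda>_. 0) F"
proof -
  note idh = comm_ring_hom_id[where 'k = 'a]
  show ?thesis
  proof (induction F rule: poly3_induct)
    case (single e c)
    have "(\<Prod>i\<in>UNIV. (0::'a) ^ expo e i) = (if e = 0 then 1 else 0)"
    proof (cases "e = 0")
      case False
      then obtain i where "expo e i \<noteq> 0" by (metis lookup_zero poly_mapping_eqI)
      then show ?thesis using False by (auto intro!: prod_zero exI[of _ i] simp: power_0_left)
    qed auto
    then show ?case by (simp add: comm_ring_hom.subst_single[OF idh] lookup_single when_def)
  qed (simp add: comm_ring_hom.subst_add[OF idh] lookup_add)
qed

lemma coef_shift_0: "coef (shift v F) 0 = poly3_eval F v"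
proof -
  note idh = comm_ring_hom_id[where 'k = 'a]
  have "coef (shift v F) 0 = subst (\<lambda>c. subst (\<lambda>x. x) (\<lambda>_. 0) (const c))
      (\<lambda>i. subst (\<lambda>x. x) (\<lambda>_. 0) (var i + const (v $ i))) F"
    unfolding coef_0_eq_subst shift_def
    by (rule hom_subst) (rule const.comm_ring_hom_axioms comm_ring_hom.subst_comm_ring_hom[OF idh])+
  then show ?thesis
    unfolding poly3_eval_eq_subst by (simp add: comm_ring_hom.subst_const[OF idh] comm_ring_hom.subst_add[OF idh] comm_ring_hom.subst_var[OF idh])
qed

lemma mult_ge_1_iff: "mult_ge v (Suc 0) F \<longleftrightarrow> poly3_eval F v = 0"
  by (auto simp: mult_ge_def ord_ge_coef coef_shift_0[symmetric])

lemma eval_hom: "comm_ring_hom (\<lambda>F. poly3_eval F v)"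
  unfolding poly3_eval_eq_subst
  by (rule comm_ring_hom.subst_comm_ring_hom[OF comm_ring_hom_id])

interpretation eval: comm_ring_hom "\<lambda>F. poly3_eval F v"
  by (rule eval_hom)

lemma eval_var [simp]: "poly3_eval (var i) v = v $ i"
  unfolding poly3_eval_eq_subst by (rule comm_ring_hom.subst_var[OF comm_ring_hom_id])

lemma eval_const [simp]: "poly3_eval (const c) v = c"
  unfolding poly3_eval_eq_subst by (rule comm_ring_hom.subst_const[OF comm_ring_hom_id])

lemma eval_form_scale:
  assumes "is_form d F"
  shows "poly3_eval F (c *s v) = c ^ d * poly3_eval F v"
proof -
  have "coef F e * (\<Prod>i\<in>UNIV. (c *s v) $ i ^ expo e i) = c ^ d * (coef F e * (\<Prod>i\<in>UNIV. v $ i ^ expo e i))"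
    if "e \<in> Poly_Mapping.keys F" for e
    using that assms
    by (simp add: is_form_def power_mult_distrib prod.distrib power_sum[symmetric])
  then show ?thesis
    by (simp add: poly3_eval_def sum_distrib_left)
qed

subsection \<open>Coordinates adapted to a point\<close>

text \<open>With \<open>v $ k \<noteq> 0\<close>, the forms \<open>lin k v i\<close> for \<open>i \<noteq> k\<close> generate the ideal of the point \<open>v\<close>;
  \<open>theta k v F\<close> is \<open>F\<close> written in the coordinates \<open>lin k v i\<close> and \<open>var k\<close>.\<close>

definition lin :: "3 \<Rightarrow> 'k::field ^ 3 \<Rightarrow> 3 \<Rightarrow> 'k poly3" where
  "lin k v i = (if i = k then var k else var i - const (v $ i / v $ k) * var k)"

definition theta :: "3 \<Rightarrow> 'k::field ^ 3 \<Rightarrow> 'k poly3 \<Rightarrow> 'k poly3" where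
  "theta k v = subst const (\<lambda>i. if i = k then var k else var i + const (v $ i / v $ k) * var k)"

interpretation theta: comm_ring_hom "theta k v :: 'k::field poly3 \<Rightarrow> _"
  unfolding theta_def by (rule const.subst_comm_ring_hom)

lemma is_form_lin [simp]: "is_form (Suc 0) (lin k v i)"
  by (simp add: lin_def is_form_diff is_form_const_mult)

lemma eval_lin: "v $ k \<noteq> 0 \<Longrightarrow> i \<noteq> k \<Longrightarrow> poly3_eval (lin k v i) v = 0"
  by (simp add: lin_def eval.hom_minus eval.hom_mult)

lemma is_form_theta: "is_form d F \<Longrightarrow> is_form d (theta k v F)"
  unfolding theta_def by (rule is_form_subst) (auto intro!: is_form_add is_form_const_mult)

lemma subst_lin_theta: "subst const (lin k v) (theta k v F) = F"
proof -
  have "(\<lambda>i. subst const (lin k v) (if i = k then var k else var i + const (v $ i / v $ k) * var k)) = var"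
    by (auto simp: const.subst_add const.subst_mult lin_def)
  then show ?thesis
    unfolding theta_def subst_const_comp by simp
qed

text \<open>Restriction to the affine plane where the \<open>k\<close>-th coordinate equals
  \<open>a\<close>, kept inside the ternary ring as a polynomial free of the \<open>k\<close>-th
  variable.\<close>

definition restr :: "3 \<Rightarrow> 'k::comm_ring_1 \<Rightarrow> 'k poly3 \<Rightarrow> 'k poly3" where
  "restr k a = subst const (\<lambda>i. if i = k then const a else var i)"

abbreviation dropk :: "3 \<Rightarrow> mon3 \<Rightarrow> mon3" where
  "dropk k e \<equiv> Poly_Mapping.update k 0 e"

lemma restr_eq: "restr k a F = (\<Sum>e\<in>Poly_Mapping.keys F. Poly_Mapping.single (dropk k e) (coef F e * a ^ expo e k))"
proof -
  have "(\<Prod>i\<in>UNIV. (if i = k then const a else var i) ^ expo e i) =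
     const (a ^ expo e k) * (\<Prod>i\<in>UNIV. var i ^ expo (dropk k e) i)" for e
  proof -
    have "(\<Prod>i\<in>UNIV. (if i = k then const a else var i) ^ expo e i) =
      const a ^ expo e k * (\<Prod>i\<in>UNIV - {k}. var i ^ expo e i)"
      by (subst prod.remove[of _ k]) (auto intro!: prod.cong)
    moreover have "(\<Prod>i\<in>UNIV. var i ^ expo (dropk k e) i) = (\<Prod>i\<in>UNIV - {k}. var i ^ expo e i :: 'a poly3)"
      by (subst prod.remove[of _ k]) (auto simp: lookup_update intro!: prod.cong)
    ultimately show ?thesis by (simp only: const.hom_power)
  qed
  then show ?thesis
    unfolding restr_def subst_def
    by (simp only: single_eq_prod_var[of "dropk k e" for e] const.hom_mult mult.assoc)
qed

lemma dropk_inj: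
  assumes "mdeg e = mdeg g" "dropk k e = dropk k g"
  shows "e = g"
proof -
  have *: "expo e i = expo g i" if "i \<noteq> k" for i
    using arg_cong[OF assms(2), of "\<lambda>f. expo f i"] that by (simp add: lookup_update)
  moreover have "mdeg f = expo f k + (\<Sum>i\<in>UNIV - {k}. expo f i)" for f
    unfolding mdeg_def by (rule sum.remove) auto
  moreover have "(\<Sum>i\<in>UNIV - {k}. expo e i) = (\<Sum>i\<in>UNIV - {k}. expo g i)"
    using * by (intro sum.cong) auto
  ultimately have "expo e k = expo g k"
    using assms(1) by auto
  then show ?thesis using * by (metis poly_mapping_eqI)
qed

lemma coef_restr_form:
  assumes "is_form d F" "e \<in> monomials d"
  shows "coef (restr k a F) (dropk k e) = coef F e * a ^ expo e k"
proof -
  have "coef (restr k a F) (dropk k e) =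
    (\<Sum>g\<in>Poly_Mapping.keys F. if g = e then coef F g * a ^ expo g k else 0)"
    unfolding restr_eq lookup_sum
  proof (rule sum.cong)
    fix g assume "g \<in> Poly_Mapping.keys F"
    then have "mdeg g = mdeg e" using assms by (simp add: is_form_iff monomials_def)
    then show "coef (Poly_Mapping.single (dropk k g) (coef F g * a ^ expo g k)) (dropk k e) =
       (if g = e then coef F g * a ^ expo g k else 0)"
      using dropk_inj by (auto simp: lookup_single when_def)
  qed simp
  then show ?thesis by (simp add: in_keys_iff)
qed

lemma coef_restr_0:
  assumes "expo e k = 0"
  shows "coef (restr k 0 F) e = coef F e"
proof -
  have "coef (restr k 0 F) e =
    (\<Sum>g\<in>Poly_Mapping.keys F. if g = e then coef F g else 0)"
    unfolding restr_eq lookup_sum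
  proof (rule sum.cong)
    fix g
    have "dropk k e = e" using assms by (intro poly_mapping_eqI) (auto simp: lookup_update)
    moreover have "dropk k g = g" if "expo g k = 0" using that by (intro poly_mapping_eqI) (auto simp: lookup_update)
    ultimately show "coef (Poly_Mapping.single (dropk k g) (coef F g * 0 ^ expo g k)) e =
       (if g = e then coef F g else 0)"
      using assms by (cases "expo g k = 0") (auto simp: lookup_single when_def power_0_left)
  qed simp
  then show ?thesis by (simp add: in_keys_iff)
qed

text \<open>Both sides are \<open>F\<close> on the plane through \<open>v\<close> with constant
  \<open>k\<close>-th coordinate, written in coordinates centred at \<open>v\<close>.\<close>

lemma restr_theta: "v $ k \<noteq> 0 \<Longrightarrow> restr k (v $ k) (theta k v F) = restr k 0 (shift v F)"
  unfolding restr_def theta_def shift_def subst_const_comp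
  by (rule arg_cong[where f = "\<lambda>s. subst const s F"])
     (auto simp: const.subst_add const.subst_mult mult_single)

text \<open>Restricting to a plane through \<open>v\<close> cannot lower the order, and there the
  monomial \<open>e\<close> has degree \<open>d - expo e k\<close>, which is below
  \<open>m\<close>.\<close>

lemma mult_ge_imp_coef_theta:
  assumes v: "v $ k \<noteq> 0" and F: "is_form d F" and m: "mult_ge v m F"
    and e: "e \<in> monomials d" "d < expo e k + m"
  shows "coef (theta k v F) e = 0"
proof -
  have "coef (theta k v F) e * v $ k ^ expo e k = coef (restr k 0 (shift v F)) (dropk k e)"
    using coef_restr_form[OF is_form_theta[OF F, of k v] e(1), of k "v $ k"] restr_theta[OF v] by simp
  also have "\<dots> = coef (shift v F) (dropk k e)"
    by (rule coef_restr_0) (simp add: lookup_update)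
  also have "\<dots> = 0"
  proof -
    have "mdeg f = expo f k + (\<Sum>i\<in>UNIV - {k}. expo f i)" for f
      unfolding mdeg_def by (rule sum.remove) auto
    from this[of e] this[of "dropk k e"] have "mdeg e = expo e k + mdeg (dropk k e)"
      by (simp add: lookup_update)
    then have "mdeg (dropk k e) < m" using e by (simp add: monomials_def)
    then show ?thesis using m by (simp add: mult_ge_def ord_ge_coef)
  qed
  finally show ?thesis using v by simp
qed

subsection \<open>Powers of the ideal of a point\<close>

lemma ideal_power_scale: "F \<in> ideal_power I m \<Longrightarrow> G * F \<in> ideal_power I m"
  by (cases m) (auto simp: ideal_mult_def intro: ring_ideal.span_scale)

lemma ideal_power_sum: "(\<And>a. a \<in> A \<Longrightarrow> f a \<in> ideal_power I m) \<Longrightarrow> sum f A \<in> ideal_power I m"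
  by (cases m) (auto simp: ideal_mult_def intro: ring_ideal.span_sum)

lemma ideal_power_Suc_mult: "F \<in> I \<Longrightarrow> G \<in> ideal_power I m \<Longrightarrow> F * G \<in> ideal_power I (Suc m)"
  by (auto simp: ideal_mult_def intro: ring_ideal.span_base)

lemma ideal_power_Suc_subset: "ideal_power I (Suc m) \<subseteq> ideal_power I m"
proof -
  have "ring_ideal.subspace (ideal_power I m)"
    by (cases m) (auto simp: ideal_mult_def)
  then show ?thesis
    unfolding ideal_power.simps ideal_mult_def
    by (intro ring_ideal.span_minimal) (auto intro: ideal_power_scale)
qed

lemma ideal_power_antimono: "m \<le> n \<Longrightarrow> ideal_power I n \<subseteq> ideal_power I m"
  by (rule lift_Suc_antimono_le[of "ideal_power I"]) (rule ideal_power_Suc_subset)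

lemma ideal_power_power_mult: "F \<in> I \<Longrightarrow> G \<in> ideal_power I m \<Longrightarrow> F ^ n * G \<in> ideal_power I (n + m)"
proof (induction n)
  case (Suc n)
  then show ?case
    using ideal_power_Suc_mult[of F I "F ^ n * G" "n + m"] by (simp add: mult.assoc)
qed simp

lemma ideal_power_prod_power:
  assumes "finite A" "\<And>i. i \<in> A \<Longrightarrow> f i \<in> I"
  shows "(\<Prod>i\<in>A. f i ^ n i) \<in> ideal_power I (\<Sum>i\<in>A. n i)"
  using assms
proof (induction A)
  case (insert i A)
  then show ?case
    using ideal_power_power_mult[of "f i" I "\<Prod>i\<in>A. f i ^ n i" "\<Sum>i\<in>A. n i" "n i"] by simp
qed simp

text \<open>Rewritten in the forms \<open>lin k v i\<close>, every surviving monomial of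
  \<open>F\<close> contains at least \<open>m\<close> factors with \<open>i\<close> different from
  \<open>k\<close>, all of which lie in \<open>I\<close>.\<close>

lemma coef_theta_imp_ideal_power:
  assumes F: "is_form d F" and I: "\<And>i. i \<noteq> k \<Longrightarrow> lin k v i \<in> I"
    and c: "\<And>e. e \<in> monomials d \<Longrightarrow> d < expo e k + m \<Longrightarrow> coef (theta k v F) e = 0"
  shows "F \<in> ideal_power I m"
proof -
  have "subst const (lin k v) (theta k v F) \<in> ideal_power I m"
    unfolding subst_def
  proof (rule ideal_power_sum, rule ideal_power_scale)
    fix e assume e: "e \<in> Poly_Mapping.keys (theta k v F)"
    then have ed: "e \<in> monomials d"
      using is_form_theta[OF F] by (simp add: is_form_iff monomials_def)
    with e c have le: "expo e k + m \<le> d" by (auto simp: in_keys_iff not_less[symmetric])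
    have "d = expo e k + (\<Sum>i\<in>UNIV - {k}. expo e i)"
      using ed unfolding monomials_def mdeg_def by (auto simp: sum.remove)
    then have "m \<le> (\<Sum>i\<in>UNIV - {k}. expo e i)" using le by linarith
    moreover have "(\<Prod>i\<in>UNIV - {k}. lin k v i ^ expo e i) \<in> ideal_power I (\<Sum>i\<in>UNIV - {k}. expo e i)"
      by (rule ideal_power_prod_power) (auto intro: I)
    ultimately have "(\<Prod>i\<in>UNIV - {k}. lin k v i ^ expo e i) \<in> ideal_power I m"
      using ideal_power_antimono by blast
    then have "lin k v k ^ expo e k * (\<Prod>i\<in>UNIV - {k}. lin k v i ^ expo e i) \<in> ideal_power I m"
      by (rule ideal_power_scale)
    then show "(\<Prod>i\<in>UNIV. lin k v i ^ expo e i) \<in> ideal_power I m"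
      by (subst prod.remove[of _ k]) auto
  qed
  then show ?thesis by (simp add: subst_lin_theta)
qed

section \<open>Projective points, their coordinate vectors and powers of their ideals\<close>

definition represents :: "'k::field ^ 3 \<Rightarrow> 'k proj_plane \<Rightarrow> bool" where
  "represents v P \<longleftrightarrow> v \<noteq> 0 \<and> abs_proj_plane v = P"

lemma proj_equiv_refl: "v \<noteq> 0 \<Longrightarrow> proj_equiv v v"
  by (auto simp: proj_equiv_def intro!: exI[of _ 1])

lemma vanishes_at_iff:
  assumes "represents v P" "is_form d F"
  shows "vanishes_at F P \<longleftrightarrow> poly3_eval F v = 0"
proof -
  have "vanishes_at F P \<longleftrightarrow> (\<forall>c. c \<noteq> 0 \<longrightarrow> poly3_eval F (c *s v) = 0)"
    using assms(1) vanishes_at.abs_eq[OF proj_equiv_refl] by (auto simp: represents_def)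
  then show ?thesis
    using assms(2) by (auto simp: eval_form_scale dest!: spec[of _ 1])
qed

lemma ideal_power_imp_mult_ge:
  assumes "\<And>F. F \<in> I \<Longrightarrow> mult_ge v (Suc 0) F" "F \<in> ideal_power I m"
  shows "mult_ge v m F"
  using assms(2)
proof (induction m arbitrary: F)
  case (Suc m)
  have "ring_ideal.subspace {F. mult_ge v (Suc m) F}"
    by (auto simp: ring_ideal.subspace_def intro: mult_ge_add mult_ge_mult_left)
  moreover have "{a * b |a b. a \<in> I \<and> b \<in> ideal_power I m} \<subseteq> {F. mult_ge v (Suc m) F}"
    using mult_ge_mult[of v "Suc 0" _ m] assms(1) Suc.IH by auto
  ultimately have "ring_ideal.span {a * b |a b. a \<in> I \<and> b \<in> ideal_power I m} \<subseteq> {F. mult_ge v (Suc m) F}"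
    by (rule ring_ideal.span_minimal[rotated])
  then show ?case
    using Suc.prems by (auto simp: ideal_mult_def)
qed simp

lemma point_ideal_vanishes:
  assumes "represents v P" "F \<in> point_ideal P"
  shows "mult_ge v (Suc 0) F"
proof -
  have "ring_ideal.subspace {F. mult_ge v (Suc 0) F}"
    by (auto simp: ring_ideal.subspace_def intro: mult_ge_add mult_ge_mult_left)
  then have "point_ideal P \<subseteq> {F. mult_ge v (Suc 0) F}"
    unfolding point_ideal_def using vanishes_at_iff[OF assms(1)]
    by (intro ring_ideal.span_minimal) (auto simp: mult_ge_1_iff)
  then show ?thesis using assms(2) by auto
qed

lemma nonzero_coordinate: "v \<noteq> 0 \<Longrightarrow> \<exists>k. v $ k \<noteq> 0" for v :: "'k::field ^ 3"
  by (auto simp: Finite_Cartesian_Product.vec_eq_iff)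

text \<open>The bridge from symbolic powers to multiplicities. The vanishing of low-order
  coefficients of \<open>theta k v F\<close> links the two conditions; everything geometric below
  speaks of \<open>mult_ge\<close> only.\<close>

lemma ideal_power_iff_mult_ge:
  assumes v: "represents v P" and F: "is_form d F"
  shows "F \<in> ideal_power (point_ideal P) m \<longleftrightarrow> mult_ge v m F"
proof
  show "F \<in> ideal_power (point_ideal P) m \<Longrightarrow> mult_ge v m F"
    using ideal_power_imp_mult_ge point_ideal_vanishes[OF v] by blast
  assume m: "mult_ge v m F"
  obtain k where k: "v $ k \<noteq> 0" using v nonzero_coordinate by (auto simp: represents_def)
  show "F \<in> ideal_power (point_ideal P) m"
  proof (rule coef_theta_imp_ideal_power[OF F])
    fix i assume "i \<noteq> k"
    then have "vanishes_at (lin k v i) P"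
      using vanishes_at_iff[OF v is_form_lin] eval_lin[OF k] by auto
    then show "lin k v i \<in> point_ideal P"
      unfolding point_ideal_def by (intro ring_ideal.span_base) (auto intro: exI[of _ "Suc 0"])
  qed (use mult_ge_imp_coef_theta[OF k F m] in auto)
qed

lemma mult_ge_iff_coef_theta:
  assumes k: "v $ k \<noteq> 0" and F: "is_form d F"
  shows "mult_ge v m F \<longleftrightarrow> (\<forall>e\<in>monomials d. d < expo e k + m \<longrightarrow> coef (theta k v F) e = 0)"
proof
  assume *: "\<forall>e\<in>monomials d. d < expo e k + m \<longrightarrow> coef (theta k v F) e = 0"
  \<comment> \<open>The set of all polynomials vanishing at the vector \<open>v\<close> serves as
    the ideal: its \<open>m\<close>-th power consists of polynomials of multiplicity at least
    \<open>m\<close>.\<close>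
  have "F \<in> ideal_power {F. mult_ge v (Suc 0) F} m"
    by (rule coef_theta_imp_ideal_power[OF F, of k v]) (use * eval_lin[OF k] in \<open>auto simp: mult_ge_1_iff\<close>)
  then show "mult_ge v m F"
    by (rule ideal_power_imp_mult_ge[rotated]) simp
qed (use mult_ge_imp_coef_theta[OF k F] in auto)

lemma mult_ge_le_degree:
  fixes v :: "'k::field ^ 3"
  assumes "v \<noteq> 0" "is_form d F" "F \<noteq> 0" "mult_ge v m F"
  shows "m \<le> d"
proof (rule ccontr)
  assume "\<not> m \<le> d"
  obtain k where k: "v $ k \<noteq> 0" using nonzero_coordinate[OF assms(1)] ..
  have "coef (theta k v F) e = 0" for e
  proof (cases "e \<in> monomials d")
    case True
    then show ?thesis using mult_ge_imp_coef_theta[OF k assms(2,4)] \<open>\<not> m \<le> d\<close> by auto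
  next
    case False
    then show ?thesis using is_form_coef[OF is_form_theta[OF assms(2)]] by (auto simp: monomials_def)
  qed
  then have "theta k v F = 0" by (intro poly_mapping_eqI) simp
  then show False using subst_lin_theta[of k v F] assms(3) by simp
qed

lemma mult_at_le_degree: "v \<noteq> 0 \<Longrightarrow> is_form d F \<Longrightarrow> F \<noteq> 0 \<Longrightarrow> mult_at v F \<le> d"
  for v :: "'k::field ^ 3"
  using mult_ge_le_degree mult_ge_mult_at by blast

subsection \<open>Partial derivatives\<close>

definition pd :: "3 \<Rightarrow> 'k::comm_ring_1 poly3 \<Rightarrow> 'k poly3" where
  "pd i F = (\<Sum>e\<in>Poly_Mapping.keys F.
     Poly_Mapping.single (e - Poly_Mapping.single i 1) (of_nat (expo e i) * coef F e))"

lemma pd_superset: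
  assumes "finite A" "Poly_Mapping.keys F \<subseteq> A"
  shows "pd i F = (\<Sum>e\<in>A. Poly_Mapping.single (e - Poly_Mapping.single i 1) (of_nat (expo e i) * coef F e))"
  unfolding pd_def using assms by (intro sum.mono_neutral_left) (auto simp: in_keys_iff)

lemma pd_single: "pd i (Poly_Mapping.single e c) = Poly_Mapping.single (e - Poly_Mapping.single i 1) (of_nat (expo e i) * c)"
  by (subst pd_superset[of "{e}"]) auto

lemma pd_add: "pd i (F + G) = pd i F + pd i G"
proof -
  let ?A = "Poly_Mapping.keys F \<union> Poly_Mapping.keys G"
  show ?thesis
    by (simp add: pd_superset[of ?A F] pd_superset[of ?A G] pd_superset[of ?A "F + G"]
        keys_add lookup_add ring_distribs sum.distrib single_add)
qed

lemma coef_pd: "coef (pd i F) e = of_nat (Suc (expo e i)) * coef F (e + Poly_Mapping.single i 1)"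
proof (induction F rule: poly3_induct)
  case (single g c)
  show ?case
  proof (cases "expo g i = 0")
    case True
    then have "g \<noteq> e + Poly_Mapping.single i 1"
      by (auto simp: lookup_add)
    then show ?thesis using True by (simp add: pd_single lookup_single when_def)
  next
    case False
    then have "g - Poly_Mapping.single i 1 = e \<longleftrightarrow> g = e + Poly_Mapping.single i 1"
      by (auto simp: poly_mapping_eq_iff fun_eq_iff lookup_add lookup_minus lookup_single when_def)
    then show ?thesis by (auto simp: pd_single lookup_single when_def lookup_add)
  qed
qed (simp add: pd_add lookup_add algebra_simps)

lemma is_form_pd: "is_form (Suc d) F \<Longrightarrow> is_form d (pd i F)"
  unfolding is_form_iff
proof
  fix e assume "\<forall>e\<in>Poly_Mapping.keys F. mdeg e = Suc d" "e \<in> Poly_Mapping.keys (pd i F)"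
  then have "mdeg (e + Poly_Mapping.single i 1) = Suc d"
    by (metis coef_pd in_keys_iff mult_zero_right)
  then show "mdeg e = d" by simp
qed

lemma pd_mult: "pd i (F * G) = pd i F * G + F * pd i G"
proof (induction F rule: poly3_induct)
  case (single e c)
  show ?case
  proof (induction G rule: poly3_induct)
    case (single g b)
    let ?u = "Poly_Mapping.single i (1::nat)"
    have 1: "Poly_Mapping.single (e - ?u + g) (of_nat (expo e i) * c * b) =
        Poly_Mapping.single (e + g - ?u) (of_nat (expo e i) * c * b)"
    proof (cases "expo e i = 0")
      case False
      then have "e - ?u + g = e + g - ?u"
        by (intro poly_mapping_eqI) (auto simp: lookup_add lookup_minus lookup_single when_def)
      then show ?thesis by simp
    qed simp
    have 2: "Poly_Mapping.single (e + (g - ?u)) (c * (of_nat (expo g i) * b)) =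
        Poly_Mapping.single (e + g - ?u) (c * (of_nat (expo g i) * b))"
    proof (cases "expo g i = 0")
      case False
      then have "e + (g - ?u) = e + g - ?u"
        by (intro poly_mapping_eqI) (auto simp: lookup_add lookup_minus lookup_single when_def)
      then show ?thesis by simp
    qed simp
    show ?case
      unfolding mult_single pd_single 1 2 single_add[symmetric]
      by (simp add: lookup_add algebra_simps)
  qed (simp add: pd_add algebra_simps)
qed (simp add: pd_add algebra_simps)

lemma pd_const [simp]: "pd i (const c) = 0"
  by (simp add: pd_single)

lemma pd_1 [simp]: "pd i 1 = 0"
  using pd_const[of i 1] unfolding single_one .

lemma pd_var: "pd i (var j) = (if i = j then 1 else 0)"
  by (simp add: var_def pd_single lookup_single when_def)

text \<open>Differentiation is translation invariant. The identity is stable under sums and, by the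
  Leibniz rule, under products, so constants and variables suffice.\<close>

lemma shift_pd: "shift v (pd i F) = pd i (shift v F)"
proof -
  let ?P = "\<lambda>F. shift v (pd i F) = pd i (shift v F)"
  have m: "?P (F * G)" if "?P F" "?P G" for F G
    using that by (simp add: pd_mult shift.hom_mult shift.hom_add)
  have var: "?P (var j)" for j
    by (simp add: pd_var pd_add)
  have one: "?P 1" by simp
  have pw: "?P (F ^ n)" if "?P F" for F n
    using that one by (induction n) (auto intro: m)
  have pr: "?P (\<Prod>j\<in>A. var j ^ n j)" for A n
    using one by (induction A rule: infinite_finite_induct) (auto intro: m pw var)
  have c: "?P (const b)" for b by simp
  show ?thesis
  proof (induction F rule: poly3_induct)
    case (single e c)
    have "?P (const c * (\<Prod>j\<in>UNIV. var j ^ expo e j))" by (intro m pr c)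
    then show ?case by (simp only: single_eq_prod_var[symmetric])
  qed (simp add: pd_add shift.hom_add)
qed

lemma mult_ge_pd: "mult_ge v (Suc m) F \<Longrightarrow> mult_ge v m (pd i F)"
  unfolding mult_ge_def shift_pd ord_ge_coef by (auto simp: coef_pd simp del: of_nat_Suc)

text \<open>In characteristic 0 an exponent brought down by differentiation stays nonzero in the
  field.\<close>

lemma exists_pd_nonzero:
  assumes "is_form (Suc d) (F :: 'k::field_char_0 poly3)" "F \<noteq> 0"
  shows "\<exists>i. pd i F \<noteq> 0"
proof -
  obtain e where e: "e \<in> Poly_Mapping.keys F" using assms(2) by fastforce
  then have "mdeg e = Suc d" using assms(1) by (simp add: is_form_iff)
  then obtain i where i: "expo e i \<noteq> 0" unfolding mdeg_def by (metis nat.distinct(1) sum.neutral)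
  let ?g = "e - Poly_Mapping.single i 1"
  have "?g + Poly_Mapping.single i 1 = e"
    using i by (intro poly_mapping_eqI) (auto simp: lookup_add lookup_minus lookup_single when_def)
  then have "coef (pd i F) ?g \<noteq> 0"
    using e by (simp add: coef_pd in_keys_iff del: of_nat_Suc)
  then show ?thesis by (metis lookup_zero)
qed

section \<open>Unique factorization\<close>

text \<open>The library knows that iterated univariate polynomial rings over a field are factorial; this is
  transported along the isomorphism \<open>k[x\<^sub>1,x\<^sub>2,x\<^sub>3] = k[x\<^sub>1][x\<^sub>2][x\<^sub>3]\<close>.\<close>

abbreviation cnst3 :: "'k::comm_ring_1 \<Rightarrow> 'k poly poly poly" where
  "cnst3 c \<equiv> [:[:[:c:]:]:]"

definition nvar :: "3 \<Rightarrow> 'k::comm_ring_1 poly poly poly" where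
  "nvar i = (if i = 1 then [:[:[:0, 1:]:]:] else if i = 2 then [:[:0, 1:]:] else [:0, 1:])"

definition nest :: "'k::comm_ring_1 poly3 \<Rightarrow> 'k poly poly poly" where
  "nest = subst cnst3 nvar"

lemma cnst3_hom: "comm_ring_hom cnst3"
  by unfold_locales (simp_all flip: one_pCons)

interpretation nest: comm_ring_hom "nest :: 'k::comm_ring_1 poly3 \<Rightarrow> _"
  unfolding nest_def by (rule comm_ring_hom.subst_comm_ring_hom[OF cnst3_hom])

lemma nest_single:
  "nest (Poly_Mapping.single e c) = monom (monom (monom c (expo e 1)) (expo e 2)) (expo e 3)"
proof -
  have 1: "(nvar 1 :: 'a poly poly poly) ^ n = [:[:monom 1 n:]:]" for n
    by (induction n) (simp_all add: nvar_def monom_Suc monom_0 flip: one_pCons)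
  have 2: "(nvar 2 :: 'a poly poly poly) ^ n = [:monom 1 n:]" for n
    by (induction n) (simp_all add: nvar_def monom_Suc monom_0 flip: one_pCons)
  have 3: "(nvar 3 :: 'a poly poly poly) ^ n = monom 1 n" for n
    by (induction n) (simp_all add: nvar_def monom_Suc monom_0 flip: one_pCons)
  have "(\<Prod>i\<in>UNIV. nvar i ^ expo e i) = nvar 1 ^ expo e 1 * nvar 2 ^ expo e 2 * (nvar 3 ^ expo e 3 :: 'a poly poly poly)"
    unfolding UNIV_3 by (simp add: mult.assoc)
  then show ?thesis
    unfolding nest_def comm_ring_hom.subst_single[OF cnst3_hom]
    by (simp add: 1 2 3 smult_monom)
qed

lemma coeff_nest: "poly.coeff (poly.coeff (poly.coeff (nest F) (expo e 3)) (expo e 2)) (expo e 1) = coef F e"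
proof (induction F rule: poly3_induct)
  case (single g c)
  have "g = e \<longleftrightarrow> expo g 1 = expo e 1 \<and> expo g 2 = expo e 2 \<and> expo g 3 = expo e 3"
    by (simp only: poly_mapping_eq_iff fun_eq_iff forall_3)
  then show ?case
    by (auto simp: nest_single lookup_single when_def)
qed (simp add: nest.hom_add lookup_add)

lemma inj_nest: "inj nest"
proof (rule injI)
  fix F G :: "'a poly3" assume "nest F = nest G"
  then show "F = G" by (intro poly_mapping_eqI) (metis coeff_nest)
qed

lemma surj_nest: "surj (nest :: 'k::comm_ring_1 poly3 \<Rightarrow> _)"
proof -
  let ?R = "range (nest :: 'k poly3 \<Rightarrow> _)"
  have add: "a + b \<in> ?R" if "a \<in> ?R" "b \<in> ?R" for a b
    using that by (metis (no_types, lifting) imageE nest.hom_add rangeI)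
  have mul: "a * b \<in> ?R" if "a \<in> ?R" "b \<in> ?R" for a b
    using that by (metis (no_types, lifting) imageE nest.hom_mult rangeI)
  have v: "nvar i \<in> ?R" for i
    by (rule range_eqI[of _ _ "var i"]) (simp add: nest_def comm_ring_hom.subst_var[OF cnst3_hom])
  have c: "cnst3 c \<in> ?R" for c
    by (rule range_eqI[of _ _ "const c"]) (simp add: nest_def comm_ring_hom.subst_const[OF cnst3_hom])
  have z: "0 \<in> ?R" by (metis nest.hom_zero rangeI)
  have 1: "[:[:p:]:] \<in> ?R" for p
  proof (induction p)
    case (pCons a p)
    have "[:[:pCons a p:]:] = cnst3 a + nvar 1 * [:[:p:]:]" by (simp add: nvar_def)
    then show ?case using add[OF c mul[OF v pCons(2)]] by metis
  qed (simp add: z)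
  have 2: "[:p:] \<in> ?R" for p
  proof (induction p)
    case (pCons a p)
    have "[:pCons a p:] = [:[:a:]:] + nvar 2 * [:p:]" by (simp add: nvar_def)
    then show ?case using add[OF 1 mul[OF v pCons(2)]] by metis
  qed (simp add: z)
  have "p \<in> ?R" for p
  proof (induction p)
    case (pCons a p)
    have "pCons a p = [:a:] + nvar 3 * p" by (simp add: nvar_def)
    then show ?case using add[OF 2 mul[OF v pCons(2)]] by metis
  qed (simp add: z)
  then show ?thesis by blast
qed

lemma nest_dvd_iff: "nest F dvd nest G \<longleftrightarrow> F dvd G"
proof
  assume "nest F dvd nest G"
  then obtain H where "nest G = nest F * nest H"
    by (metis dvdE surj_nest surjD)
  then have "nest G = nest (F * H)" by (simp add: nest.hom_mult)
  then show "F dvd G" using inj_nest by (auto dest: injD)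
qed (auto elim!: dvdE simp: nest.hom_mult)

lemma irreducible_imp_prime3:
  fixes C :: "'k::field poly3"
  assumes "irreducible C"
  shows "prime_elem C"
proof -
  have "irreducible (nest C)"
  proof (rule irreducibleI)
    show "nest C \<noteq> 0" using assms inj_nest by (metis injD irreducible_def nest.hom_zero)
    show "\<not> nest C dvd 1" using assms nest_dvd_iff[of C 1] by (simp add: irreducible_def)
    fix a b assume ab: "nest C = a * b"
    obtain A B where AB: "a = nest A" "b = nest B" by (metis surj_nest surjD)
    then have "C = A * B" using ab inj_nest by (metis injD nest.hom_mult)
    then have "A dvd 1 \<or> B dvd 1" using assms by (simp add: irreducible_def)
    then show "a dvd 1 \<or> b dvd 1"
      using AB nest_dvd_iff[of A 1] nest_dvd_iff[of B 1] by simp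
  qed
  then have "prime_elem (nest C)" by simp
  note * = prime_elem_dvd_multD[OF this]
  show ?thesis
  proof (rule prime_elemI)
    fix A B assume "C dvd A * B"
    then show "C dvd A \<or> C dvd B"
      using *[of "nest A" "nest B"] by (simp add: nest_dvd_iff nest.hom_mult[symmetric])
  qed (use assms in \<open>auto simp: irreducible_def\<close>)
qed

section \<open>Units, irreducible forms and factorization of forms\<close>

lemma unit_imp_const:
  assumes "(F :: 'k::idom poly3) dvd 1"
  obtains c where "F = const c" "c \<noteq> 0"
proof -
  obtain G where G: "1 = F * G" using assms by blast
  obtain a b where "is_form a F" "is_form b G" "a + b = 0"
    by (rule dvd_form_imp_form[of 0 "1 :: 'k poly3", OF _ _ G]) auto
  then have "F = const (coef F 0)" using is_form_0_eq_const by auto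
  moreover have "coef F 0 \<noteq> 0" using calculation G by (metis mult_zero_left single_zero zero_neq_one)
  ultimately show ?thesis using that by blast
qed

lemma const_unit: "c \<noteq> 0 \<Longrightarrow> const c dvd 1" for c :: "'k::field"
  by (rule dvdI[of _ _ "const (inverse c)"]) (simp flip: const.hom_mult)

lemma const_eq_0_iff [simp]: "const c = 0 \<longleftrightarrow> c = 0"
  by (metis lookup_single_eq lookup_zero single_zero)

lemma form_degree_0_unit:
  assumes "is_form 0 F" "F \<noteq> 0"
  shows "(F :: 'k::field poly3) dvd 1"
  using is_form_0_eq_const[OF assms(1)] assms(2) const_unit[of "coef F 0"] by (metis single_zero)

lemma irreducible_form_degree:
  assumes "irreducible C" "is_form a C"
  shows "(C :: 'k::field poly3) \<noteq> 0" "a > 0"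
  using assms form_degree_0_unit[of C] by (auto simp: irreducible_def intro: gr0I)

lemma irreducible_linear_form:
  assumes "is_form (Suc 0) L" "(L :: 'k::field poly3) \<noteq> 0"
  shows "irreducible L"
proof (rule irreducibleI)
  show "\<not> L dvd 1"
  proof
    assume "L dvd 1"
    then obtain c where "L = const c" by (rule unit_imp_const)
    then have "is_form 0 L" by simp
    then show False using is_form_unique[OF assms(1) _ assms(2)] by auto
  qed
  fix A B assume L: "L = A * B"
  obtain a b where ab: "is_form a A" "is_form b B" "a + b = Suc 0"
    using dvd_form_imp_form[OF assms L] .
  then have "a = 0 \<or> b = 0" by linarith
  then show "A dvd 1 \<or> B dvd 1" using ab L assms(2) form_degree_0_unit by auto
qed (use assms in auto)

lemma exists_irreducible_factor:
  assumes "is_form d F" "(F :: 'k::field poly3) \<noteq> 0" "d > 0"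
  shows "\<exists>C H. irreducible C \<and> F = C * H"
  using assms
proof (induction d arbitrary: F rule: less_induct)
  case (less d)
  show ?case
  proof (cases "irreducible F")
    case True
    then show ?thesis by (intro exI[of _ F] exI[of _ 1]) auto
  next
    case False
    have "\<not> F dvd 1"
    proof
      assume "F dvd 1"
      then obtain c where "F = const c" by (rule unit_imp_const)
      then have "is_form 0 F" by simp
      then show False using is_form_unique less.prems by blast
    qed
    then obtain A B where AB: "F = A * B" "\<not> A dvd 1" "\<not> B dvd 1"
      using False less.prems(2) by (auto simp: irreducible_def)
    obtain a b where ab: "is_form a A" "is_form b B" "a + b = d"
      using dvd_form_imp_form[OF less.prems(1,2) AB(1)] .
    have nz: "A \<noteq> 0" "B \<noteq> 0" using AB less.prems(2) by auto
    then have "a > 0" "b > 0" using AB ab form_degree_0_unit by (auto intro: gr0I)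
    then obtain C H where "irreducible C" "A = C * H"
      using less.IH[of a A] ab nz by auto
    then show ?thesis using AB(1) by (intro exI[of _ C] exI[of _ "H * B"]) (simp add: mult.assoc)
  qed
qed

lemma irreducible_dvd_irreducible:
  assumes "irreducible C" "irreducible (D :: 'k::field poly3)" "C dvd D"
  obtains u where "u \<noteq> 0" "C = const u * D"
proof -
  obtain w where w: "D = C * w" using assms(3) by blast
  then have "w dvd 1" using assms(1,2) by (auto simp: irreducible_def)
  then obtain c where c: "w = const c" "c \<noteq> 0" by (rule unit_imp_const)
  have "const (inverse c) * D = C * (const (inverse c) * const c)" using w c by (simp add: ac_simps)
  also have "\<dots> = C" using c(2) by (simp flip: const.hom_mult)
  finally show ?thesis using that[of "inverse c"] c(2) by simp
qed

text \<open>Associated factors are merged into one representative, with the units collected in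
  \<open>c\<close>. Distinct members of \<open>S\<close> therefore share no component, which is what
  Bezout between them requires.\<close>

theorem form_factorization:
  assumes "is_form d F" "(F :: 'k::field poly3) \<noteq> 0"
  shows "\<exists>S f c. finite S \<and> (\<forall>C\<in>S. irreducible C \<and> is_form (ord0 C) C) \<and>
    (\<forall>C\<in>S. \<forall>D\<in>S. C dvd D \<longrightarrow> C = D) \<and> c \<noteq> 0 \<and> F = const c * (\<Prod>C\<in>S. C ^ f C)"
  using assms
proof (induction d arbitrary: F rule: less_induct)
  case (less d)
  show ?case
  proof (cases "d = 0")
    case True
    then have "F = const (coef F 0)" using less.prems is_form_0_eq_const by simp
    moreover from this have "coef F 0 \<noteq> 0" using less.prems(2) by (metis single_zero)
    ultimately show ?thesis
      by (intro exI[of _ "{}"] exI[of _ "\<lambda>_. 0"] exI[of _ "coef F 0"]) simp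
  next
    case False
    then obtain C H where C: "irreducible C" and FCH: "F = C * H"
      using exists_irreducible_factor less.prems by blast
    obtain a b where ab: "is_form a C" "is_form b H" "a + b = d"
      using dvd_form_imp_form[OF less.prems FCH] .
    have a: "a > 0" "C \<noteq> 0" using irreducible_form_degree[OF C ab(1)] by auto
    have ordC: "ord0 C = a" using ord_form ab(1) a by blast
    have "H \<noteq> 0" using FCH less.prems(2) by auto
    then obtain S f c where S: "finite S" "\<forall>C\<in>S. irreducible C \<and> is_form (ord0 C) C"
      "\<forall>C\<in>S. \<forall>D\<in>S. C dvd D \<longrightarrow> C = D" "c \<noteq> 0" "H = const c * (\<Prod>C\<in>S. C ^ f C)"
      using less.IH[of b H] ab a by auto
    show ?thesis
    proof (cases "\<exists>D\<in>S. C dvd D")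
      case True
      then obtain D where D: "D \<in> S" "C dvd D" by blast
      then obtain u where u: "u \<noteq> 0" "C = const u * D"
        using irreducible_dvd_irreducible[OF C] S(2) by blast
      let ?f = "f(D := Suc (f D))"
      have "(\<Prod>C\<in>S. C ^ ?f C) = D ^ Suc (f D) * (\<Prod>C\<in>S - {D}. C ^ f C)"
        using S(1) D(1) by (subst prod.remove[of _ D]) (auto intro!: prod.cong)
      also have "\<dots> = D * (\<Prod>C\<in>S. C ^ f C)"
        using S(1) D(1) by (subst prod.remove[of S D]) (auto simp: mult.assoc)
      finally have "F = const (u * c) * (\<Prod>C\<in>S. C ^ ?f C)"
        unfolding FCH S(5) u(2) by (simp only: const.hom_mult ac_simps)
      then show ?thesis using S(1-4) u(1)
        by (intro exI[of _ S] exI[of _ ?f] exI[of _ "u * c"]) simp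
    next
      case False
      have nd: "\<not> D dvd C" if "D \<in> S" for D
      proof
        assume "D dvd C"
        then obtain u where u: "u \<noteq> 0" "D = const u * C"
          using irreducible_dvd_irreducible[of D C] C S(2) \<open>D \<in> S\<close> by blast
        then show False using False \<open>D \<in> S\<close> by (metis dvd_triv_right)
      qed
      have CS: "C \<notin> S" using False dvd_refl[of C] by metis
      let ?f = "f(C := 1)"
      have "(\<Prod>D\<in>S. D ^ ?f D) = (\<Prod>D\<in>S. D ^ f D)" using CS by (intro prod.cong) auto
      then have "(\<Prod>D\<in>insert C S. D ^ ?f D) = C * (\<Prod>D\<in>S. D ^ f D)"
        using S(1) CS by simp
      then have "F = const c * (\<Prod>D\<in>insert C S. D ^ ?f D)"
        unfolding FCH S(5) by (simp only: ac_simps)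
      moreover have "\<forall>E\<in>insert C S. \<forall>D\<in>insert C S. E dvd D \<longrightarrow> E = D"
        using S(3) False nd by blast
      ultimately show ?thesis using S(1,2,4) C ab(1) ordC
        by (intro exI[of _ "insert C S"] exI[of _ ?f] exI[of _ c]) simp
    qed
  qed
qed

lemma prime_power_dvd_mult:
  fixes C :: "'k::field poly3"
  assumes "irreducible C" "\<not> C dvd G" "C ^ x dvd G * H"
  shows "C ^ x dvd H"
  using assms(3)
proof (induction x arbitrary: H)
  case (Suc x)
  have C0: "C \<noteq> 0" using assms(1) by auto
  have "C dvd G * H" using Suc.prems unfolding power_Suc by (rule dvd_mult_left)
  then have "C dvd H"
    using prime_elem_dvd_multD[OF irreducible_imp_prime3[OF assms(1)]] assms(2) by metis
  then obtain H' where H: "H = C * H'" by blast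
  have "G * (C * H') = C * (G * H')" by (rule mult.left_commute)
  then have "C * C ^ x dvd C * (G * H')" using Suc.prems unfolding H power_Suc by simp
  then have "C ^ x dvd G * H'" using C0 by (simp only: dvd_mult_cancel_left simp_thms)
  then have "C ^ x dvd H'" by (rule Suc.IH)
  then show ?case unfolding H power_Suc by (rule mult_dvd_mono[OF dvd_refl])
qed simp

lemma prime_dvd_mult_cancel:
  fixes C :: "'k::field poly3"
  assumes "irreducible C" "\<not> C dvd G" "C dvd G * H"
  shows "C dvd H"
  using prime_power_dvd_mult[OF assms(1,2), of 1 H] assms(3) by simp

lemma prime_not_dvd_power:
  fixes C :: "'k::field poly3"
  assumes "irreducible C" "\<not> C dvd G"
  shows "\<not> C dvd G ^ n"
  using assms irreducible_imp_prime3[OF assms(1)] by (metis prime_elem_dvd_power)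

lemma max_power_factor:
  assumes "irreducible C" "is_form d F" "(F :: 'k::field poly3) \<noteq> 0"
  obtains x G where "F = C ^ x * G" "\<not> C dvd G"
  using assms(2,3)
proof (induction d arbitrary: F thesis rule: less_induct)
  case (less d)
  show ?case
  proof (cases "C dvd F")
    case False
    then show ?thesis using less.prems(1)[of 0 F] by simp
  next
    case True
    then obtain H where H: "F = C * H" by blast
    obtain a b where ab: "is_form a C" "is_form b H" "a + b = d"
      using dvd_form_imp_form[OF less.prems(2,3) H] .
    have "a > 0" using irreducible_form_degree[OF assms(1) ab(1)] by simp
    moreover have "H \<noteq> 0" using H less.prems(3) by auto
    ultimately obtain x G where "H = C ^ x * G" "\<not> C dvd G"
      using less.IH[of b H] ab by auto
    then show ?thesis using less.prems(1)[of "Suc x" G] H by (simp add: mult.assoc)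
  qed
qed

section \<open>Dimension counts\<close>

text \<open>Gaussian elimination: an equation with a nonzero coefficient at \<open>p\<close> is used
  to eliminate the unknown \<open>p\<close> from the remaining ones, and that unknown is recovered
  at the end.\<close>

lemma homogeneous_system:
  fixes M :: "'e \<Rightarrow> 'i \<Rightarrow> 'k::field"
  assumes "finite E" "finite I" "card E < card I"
  shows "\<exists>w. (\<exists>i\<in>I. w i \<noteq> 0) \<and> (\<forall>e\<in>E. (\<Sum>i\<in>I. M e i * w i) = 0)"
  using assms
proof (induction E arbitrary: I M)
  case empty
  then have "I \<noteq> {}" by auto
  then show ?case by (intro exI[of _ "\<lambda>_. 1"]) auto
next
  case (insert e E)
  show ?case
  proof (cases "\<forall>i\<in>I. M e i = 0")
    case True
    obtain w where w: "\<exists>i\<in>I. w i \<noteq> 0" "\<forall>e\<in>E. (\<Sum>i\<in>I. M e i * w i) = 0"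
      using insert.IH[of I M] insert.prems insert.hyps by auto
    then show ?thesis using True by (intro exI[of _ w]) auto
  next
    case False
    then obtain p where p: "p \<in> I" "M e p \<noteq> 0" by blast
    let ?J = "I - {p}"
    define M' where "M' e' i = M e' i - M e' p * M e i / M e p" for e' i
    have "card E < card ?J" using insert p by simp
    then obtain w where w: "\<exists>i\<in>?J. w i \<noteq> 0" "\<forall>e\<in>E. (\<Sum>i\<in>?J. M' e i * w i) = 0"
      using insert.IH[of ?J M'] insert.prems by auto
    define w' where "w' = w(p := - (\<Sum>i\<in>?J. M e i * w i) / M e p)"
    have split: "(\<Sum>i\<in>I. M e' i * w' i) = M e' p * w' p + (\<Sum>i\<in>?J. M e' i * w i)" for e'
      using insert.prems p(1) by (subst sum.remove[of _ p]) (auto simp: w'_def intro!: sum.cong)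
    have "(\<Sum>i\<in>I. M e' i * w' i) = 0" if "e' \<in> E" for e'
    proof -
      have "0 = (\<Sum>i\<in>?J. M' e' i * w i)" using w(2) that by simp
      also have "\<dots> = (\<Sum>i\<in>?J. M e' i * w i) - M e' p / M e p * (\<Sum>i\<in>?J. M e i * w i)"
        by (simp add: M'_def algebra_simps sum_subtractf sum_distrib_left sum_divide_distrib)
      finally show ?thesis unfolding split by (simp add: w'_def)
    qed
    moreover have "(\<Sum>i\<in>I. M e i * w' i) = 0"
      unfolding split using p by (simp add: w'_def)
    moreover have "\<exists>i\<in>I. w' i \<noteq> 0" using w(1) by (auto simp: w'_def)
    ultimately show ?thesis by (intro exI[of _ w']) auto
  qed
qed

section \<open>Linear conditions on the coefficients of forms\<close>

definition linear_functional :: "('k::comm_ring_1 poly3 \<Rightarrow> 'k) \<Rightarrow> bool" where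
  "linear_functional f \<longleftrightarrow> (\<forall>F G. f (F + G) = f F + f G) \<and> (\<forall>c F. f (const c * F) = c * f F)"

lemma linear_functional_sum:
  assumes "linear_functional f"
  shows "f (\<Sum>i\<in>I. const (x i) * b i) = (\<Sum>i\<in>I. f (b i) * x i)"
proof -
  have z: "f 0 = 0" using assms unfolding linear_functional_def by (metis mult_zero_left single_zero)
  show ?thesis
    using assms z unfolding linear_functional_def
    by (induction I rule: infinite_finite_induct) (simp_all add: mult.commute)
qed

lemma linear_functional_coef_mult: "linear_functional (\<lambda>F. coef (F * G) e)"
  by (simp add: linear_functional_def distrib_right lookup_add mult.assoc coef_const_mult)

lemma linear_functional_coef: "linear_functional (\<lambda>F. coef F e)"
  using linear_functional_coef_mult[of 1 e] by simp

lemma linear_functional_theta: "linear_functional (\<lambda>F. coef (theta k v F) e)"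
proof -
  have "theta k v (const c) = const c" for c by (simp add: theta_def)
  then show ?thesis
    by (simp add: linear_functional_def lookup_add theta.hom_add theta.hom_mult coef_const_mult)
qed

lemma linear_functional_zero: "linear_functional (\<lambda>F. 0)"
  by (simp add: linear_functional_def)

text \<open>Prepared for Bezout, where the coefficients of three forms are unknown simultaneously
  and each equation is a sum of one linear functional per form.\<close>

lemma linear_system_three:
  fixes fA fB fW :: "'e \<Rightarrow> 'k::field poly3 \<Rightarrow> 'k"
  assumes fin: "finite E" "finite IA" "finite IB" "finite IW"
    and card: "card E < card IA + card IB + card IW"
    and lin: "\<And>e. linear_functional (fA e)" "\<And>e. linear_functional (fB e)" "\<And>e. linear_functional (fW e)"
  shows "\<exists>xA xB xW. ((\<exists>i\<in>IA. xA i \<noteq> 0) \<or> (\<exists>i\<in>IB. xB i \<noteq> 0) \<or> (\<exists>i\<in>IW. xW i \<noteq> 0)) \<and>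
    (\<forall>e\<in>E. fA e (\<Sum>i\<in>IA. const (xA i) * bA i) + fB e (\<Sum>i\<in>IB. const (xB i) * bB i)
        + fW e (\<Sum>i\<in>IW. const (xW i) * bW i) = 0)"
proof -
  let ?I = "(IA <+> IB) <+> IW"
  let ?M = "\<lambda>e. case_sum (case_sum (\<lambda>i. fA e (bA i)) (\<lambda>i. fB e (bB i))) (\<lambda>i. fW e (bW i))"
  have "card E < card ?I" using fin card by (simp add: card_Plus)
  then obtain w where w: "\<exists>i\<in>?I. w i \<noteq> 0" "\<forall>e\<in>E. (\<Sum>i\<in>?I. ?M e i * w i) = 0"
    using homogeneous_system[of E ?I ?M] fin by auto
  have "(\<Sum>i\<in>?I. ?M e i * w i) = (\<Sum>i\<in>IA. fA e (bA i) * w (Inl (Inl i))) +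
     (\<Sum>i\<in>IB. fB e (bB i) * w (Inl (Inr i))) + (\<Sum>i\<in>IW. fW e (bW i) * w (Inr i))" for e
    using fin by (simp add: sum.Plus comp_def)
  with w(2) have "\<forall>e\<in>E. fA e (\<Sum>i\<in>IA. const (w (Inl (Inl i))) * bA i) +
     fB e (\<Sum>i\<in>IB. const (w (Inl (Inr i))) * bB i) + fW e (\<Sum>i\<in>IW. const (w (Inr i)) * bW i) = 0"
    by (simp add: linear_functional_sum[OF lin(1)] linear_functional_sum[OF lin(2)] linear_functional_sum[OF lin(3)])
  moreover have "(\<exists>i\<in>IA. w (Inl (Inl i)) \<noteq> 0) \<or> (\<exists>i\<in>IB. w (Inl (Inr i)) \<noteq> 0) \<or> (\<exists>i\<in>IW. w (Inr i) \<noteq> 0)"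
    using w(1) by auto
  ultimately show ?thesis by (intro exI conjI)
qed

abbreviation mono :: "mon3 \<Rightarrow> 'k::comm_ring_1 poly3" where
  "mono e \<equiv> Poly_Mapping.single e 1"

lemma coef_sum_mono:
  assumes "finite I"
  shows "coef (\<Sum>i\<in>I. const (x i) * mono i) e = (if e \<in> I then x e else 0)"
  using assms by (simp add: lookup_sum coef_const_mult lookup_single when_def if_distrib cong: if_cong)

lemma is_form_sum_mono: "is_form d (\<Sum>i\<in>monomials d. const (x i) * mono i)"
  by (intro is_form_sum is_form_const_mult is_form_single) (simp add: monomials_def)

lemma is_form_eq_0I: "is_form d F \<Longrightarrow> (\<And>e. e \<in> monomials d \<Longrightarrow> coef F e = 0) \<Longrightarrow> F = 0"
  using is_form_coef[of d F] by (intro poly_mapping_eqI) (auto simp: monomials_def)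

definition coord :: "'k::field ^ 3 \<Rightarrow> 3" where
  "coord v = (SOME k. v $ k \<noteq> 0)"

lemma coord: "v \<noteq> 0 \<Longrightarrow> v $ coord v \<noteq> 0"
  unfolding coord_def using nonzero_coordinate by (rule someI_ex)

text \<open>An index set for the linear equations that express multiplicity \<open>\<mu> v\<close>
  at every \<open>v\<close> on forms of degree \<open>d\<close>.\<close>

abbreviation conditions :: "('k::field ^ 3 \<Rightarrow> nat) \<Rightarrow> nat \<Rightarrow> ('k ^ 3) set \<Rightarrow> (('k ^ 3) \<times> mon3) set" where
  "conditions \<mu> d V \<equiv> SIGMA v:V. {e \<in> monomials d. d < expo e (coord v) + \<mu> v}"

lemma finite_conditions: "finite V \<Longrightarrow> finite (conditions \<mu> d V)"
  by (intro finite_SigmaI finite_card_monomials_le(1))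

lemma card_conditions: "finite V \<Longrightarrow> card (conditions \<mu> d V) \<le> (\<Sum>v\<in>V. \<mu> v * (\<mu> v + 1) div 2)"
  by (subst card_SigmaI) (assumption, rule ballI, rule finite_card_monomials_le(1), rule sum_mono, rule finite_card_monomials_le(2))

lemma mult_ge_conditions:
  assumes "v \<noteq> 0" "is_form d F" "v \<in> V"
    and "\<And>v e. (v, e) \<in> conditions \<mu> d V \<Longrightarrow> coef (theta (coord v) v F) e = 0"
  shows "mult_ge v (\<mu> v) F"
  unfolding mult_ge_iff_coef_theta[OF coord[OF assms(1)] assms(2)] using assms(3,4) by auto

text \<open>Multiplicity \<open>\<mu> v\<close> costs at most \<mu>(\<mu>+1)/2 equations, and forms
  of degree \<open>d\<close> have (d+1)(d+2)/2 coefficients; the hypothesis compares the doubled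
  numbers.\<close>

theorem exists_form_mult_ge:
  assumes V: "finite V" "\<And>v. v \<in> V \<Longrightarrow> v \<noteq> 0"
    and lt: "(\<Sum>v\<in>V. \<mu> v * (\<mu> v + 1)) < (d + 1) * (d + 2)"
  shows "\<exists>F :: 'k::field poly3. F \<noteq> 0 \<and> is_form d F \<and> (\<forall>v\<in>V. mult_ge v (\<mu> v) F)"
proof -
  have "2 * (\<Sum>v\<in>V. \<mu> v * (\<mu> v + 1) div 2) = (\<Sum>v\<in>V. \<mu> v * (\<mu> v + 1))"
    unfolding sum_distrib_left by (intro sum.cong) auto
  moreover have "2 * ((d + 1) * (d + 2) div 2) = (d + 1) * (d + 2)"
    by (rule dvd_mult_div_cancel) simp
  ultimately have less: "card (conditions \<mu> d V) < card (monomials d)"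
    using lt card_conditions[OF V(1), where \<mu> = \<mu> and d = d] unfolding card_monomials by linarith
  obtain w where w: "\<exists>i\<in>monomials d. w i \<noteq> 0"
    "\<forall>c\<in>conditions \<mu> d V. (\<Sum>i\<in>monomials d. coef (theta (coord (fst c)) (fst c) (mono i)) (snd c) * w i) = 0"
    using homogeneous_system[OF finite_conditions[OF V(1)] finite_monomials less,
        of "\<lambda>c i. coef (theta (coord (fst c)) (fst c) (mono i)) (snd c)"]
    by (elim exE conjE) (rule that)
  let ?F = "\<Sum>i\<in>monomials d. const (w i) * mono i"
  have zero: "coef (theta (coord v) v ?F) e = 0" if "(v, e) \<in> conditions \<mu> d V" for v e
    using bspec[OF w(2) that] unfolding linear_functional_sum[OF linear_functional_theta] fst_conv snd_conv .
  have "mult_ge v (\<mu> v) ?F" if "v \<in> V" for v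
    by (rule mult_ge_conditions[OF V(2)[OF that] is_form_sum_mono that zero])
  moreover have "?F \<noteq> 0"
  proof
    assume "?F = 0"
    then have "coef ?F i = 0" for i by simp
    then have *: "(if i \<in> monomials d then w i else 0) = 0" for i
      unfolding coef_sum_mono[OF finite_monomials] .
    have "w i = 0" if "i \<in> monomials d" for i using *[of i] that by simp
    then show False using w(1) by simp
  qed
  ultimately show ?thesis using is_form_sum_mono by blast
qed

subsection \<open>Forms with independent leading terms at finitely many points\<close>

definition distinct_points :: "('k::field ^ 3) set \<Rightarrow> bool" where
  "distinct_points V \<longleftrightarrow> finite V \<and> (\<forall>v\<in>V. v \<noteq> 0) \<and> (\<forall>v\<in>V. \<forall>w\<in>V. v \<noteq> w \<longrightarrow> (\<forall>c. v \<noteq> c *s w))"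

lemma distinct_points_subset: "distinct_points V \<Longrightarrow> W \<subseteq> V \<Longrightarrow> distinct_points W"
  unfolding distinct_points_def by (meson finite_subset subsetD)

lemma separating_line:
  assumes "w \<noteq> 0" "\<forall>c. v \<noteq> c *s w"
  shows "\<exists>L. is_form (Suc 0) L \<and> poly3_eval L w = 0 \<and> poly3_eval L v \<noteq> (0 :: 'k::field)"
proof (rule ccontr)
  assume *: "\<not> ?thesis"
  let ?k = "coord w"
  have k: "w $ ?k \<noteq> 0" using coord assms(1) by blast
  have "v $ i = (v $ ?k / w $ ?k) * w $ i" for i
  proof (cases "i = ?k")
    case False
    have "poly3_eval (lin ?k w i) v = 0"
      using * eval_lin[OF k False] is_form_lin by blast
    then show ?thesis using False by (simp add: lin_def eval.hom_minus eval.hom_mult)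
  qed (use k in simp)
  then have "v = (v $ ?k / w $ ?k) *s w"
    unfolding Finite_Cartesian_Product.vec_eq_iff vector_smult_component by (rule allI)
  then show False using assms(2) by metis
qed

lemma exists_separating_form:
  assumes V: "distinct_points V" and v: "v \<in> V" and d: "(\<Sum>w\<in>V - {v}. \<kappa> w) \<le> d"
  shows "\<exists>U. is_form d U \<and> poly3_eval U v \<noteq> (0 :: 'k::field) \<and> (\<forall>w\<in>V - {v}. mult_ge w (\<kappa> w) U)"
proof -
  have "\<forall>w\<in>V - {v}. \<exists>L. is_form (Suc 0) L \<and> poly3_eval L w = 0 \<and> poly3_eval L v \<noteq> (0 :: 'k)"
  proof
    fix w assume "w \<in> V - {v}"
    then have "w \<in> V" "v \<noteq> w" by auto
    then have "w \<noteq> 0" "\<forall>c. v \<noteq> c *s w"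
      using V[unfolded distinct_points_def] v by (simp, metis (full_types))
    then show "\<exists>L. is_form (Suc 0) L \<and> poly3_eval L w = 0 \<and> poly3_eval L v \<noteq> (0 :: 'k)"
      by (rule separating_line)
  qed
  then obtain L where L: "\<And>w. w \<in> V - {v} \<Longrightarrow> is_form (Suc 0) (L w)"
    "\<And>w. w \<in> V - {v} \<Longrightarrow> poly3_eval (L w) w = 0" "\<And>w. w \<in> V - {v} \<Longrightarrow> poly3_eval (L w) v \<noteq> 0"
    by metis
  let ?P = "\<Prod>w\<in>V - {v}. L w ^ \<kappa> w"
  \<comment> \<open>A power of a coordinate that does not vanish at \<open>v\<close> fills up the
    degree.\<close>
  let ?r = "d - (\<Sum>w\<in>V - {v}. \<kappa> w)"
  let ?U = "var (coord v) ^ ?r * ?P"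
  have fin: "finite (V - {v})" using V by (auto simp: distinct_points_def)
  have "is_form (\<Sum>w\<in>V - {v}. \<kappa> w * Suc 0) ?P"
    using L(1) by (intro is_form_prod is_form_power)
  then have "is_form (?r * Suc 0 + (\<Sum>w\<in>V - {v}. \<kappa> w * Suc 0)) ?U"
    by (intro is_form_mult is_form_power is_form_var)
  then have "is_form d ?U" using d by simp
  moreover have "poly3_eval ?U v \<noteq> 0"
    using L(3) fin V v coord by (auto simp: distinct_points_def eval.hom_mult eval.hom_prod eval.hom_power)
  moreover have "mult_ge w (\<kappa> w) ?U" if "w \<in> V - {v}" for w
  proof -
    have "mult_ge w (\<kappa> w * Suc 0) (L w ^ \<kappa> w)"
      using L(2) that by (intro mult_ge_power) (simp add: mult_ge_1_iff)
    moreover have "?P = (\<Prod>w\<in>V - {v} - {w}. L w ^ \<kappa> w) * L w ^ \<kappa> w"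
      using fin that by (subst prod.remove[of _ w]) (auto simp: mult.commute)
    ultimately show ?thesis
      using mult_ge_mult_left by (simp add: mult.assoc[symmetric])
  qed
  ultimately show ?thesis by blast
qed

lemma coef_mono_mult:
  "coef (mono u * H) e = (if \<forall>i. expo u i \<le> expo e i then coef H (e - u) else 0)"
proof (induction H rule: poly3_induct)
  case (single g c)
  show ?case
  proof (cases "\<forall>i. expo u i \<le> expo e i")
    case True
    then have "u + g = e \<longleftrightarrow> g = e - u"
      by (auto simp: poly_mapping_eq_iff fun_eq_iff lookup_add lookup_minus) (metis diff_add_inverse le_add_diff_inverse)+
    then show ?thesis using True by (simp add: mult_single lookup_single when_def)
  next
    case False
    then have "u + g \<noteq> e" by (auto simp: lookup_add)
    then show ?thesis using False by (auto simp: mult_single lookup_single when_def)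
  qed
qed (simp add: algebra_simps lookup_add)

text \<open>Not vanishing at \<open>v\<close> means order 0 there, and the pure power of the
  \<open>k\<close>-th variable is the only monomial of local order 0.\<close>

lemma coef_theta_pure:
  assumes "v $ k \<noteq> 0" "is_form r U" "poly3_eval U v \<noteq> (0 :: 'k::field)"
  shows "coef (theta k v U) (Poly_Mapping.single k r) \<noteq> 0"
proof -
  have "\<not> mult_ge v (Suc 0) U" using assms(3) by (simp add: mult_ge_1_iff)
  then obtain e where e: "e \<in> monomials r" "r < expo e k + Suc 0" "coef (theta k v U) e \<noteq> 0"
    unfolding mult_ge_iff_coef_theta[OF assms(1,2)] by blast
  have "mdeg (Poly_Mapping.single k r) = mdeg e" using e(1) by (simp add: monomials_def)
  moreover have "expo e k = r" using e expo_le_mdeg[of e k] by (simp add: monomials_def)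
  ultimately have "e = Poly_Mapping.single k r"
  proof -
    assume "expo e k = r"
    have "expo e i = 0" if "i \<noteq> k" for i
    proof -
      have "mdeg e = expo e k + (\<Sum>i\<in>UNIV - {k}. expo e i)"
        unfolding mdeg_def by (rule sum.remove) auto
      then show ?thesis using that e(1) \<open>expo e k = r\<close> by (auto simp: monomials_def)
    qed
    then show ?thesis using \<open>expo e k = r\<close>
      by (intro poly_mapping_eqI) (auto simp: lookup_single when_def)
  qed
  then show ?thesis using e(3) by simp
qed

lemma card_triangle: "card {(i, j). i + j < (\<kappa>::nat)} = \<kappa> * (\<kappa> + 1) div 2" "finite {(i, j). i + j < (\<kappa>::nat)}"
proof -
  have eq: "{(i, j). i + j < \<kappa>} = (\<lambda>(s, i). (i, s - i)) ` (SIGMA s:{..<\<kappa>}. {..s})"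
  proof (intro equalityI subsetI)
    fix x assume "x \<in> {(i, j). i + j < \<kappa>}"
    then show "x \<in> (\<lambda>(s, i). (i, s - i)) ` (SIGMA s:{..<\<kappa>}. {..s})"
      by (intro image_eqI[of _ _ "(fst x + snd x, fst x)"]) auto
  qed auto
  have "inj_on (\<lambda>(s, i). (i, s - i)) (SIGMA s:{..<\<kappa>}. {..s})"
    by (rule inj_onI) auto
  then show "card {(i, j). i + j < \<kappa>} = \<kappa> * (\<kappa> + 1) div 2"
    unfolding eq by (subst card_image) (auto simp: sum_Suc_lessThan)
  show "finite {(i, j). i + j < \<kappa>}" unfolding eq by auto
qed

lemma other_coords: "\<exists>p q :: 3. p \<noteq> k \<and> q \<noteq> k \<and> p \<noteq> q \<and> (\<forall>i. i = k \<or> i = p \<or> i = q)"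
proof -
  have ne: "(1::3) \<noteq> 2" "(1::3) \<noteq> 3" "(2::3) \<noteq> 3" by auto
  show ?thesis
    using exhaust_3[of k] ne exhaust_3 by metis
qed

text \<open>Fat points impose independent conditions in high degree. The form
  \<open>b (v, i, j)\<close> starts at \<open>v\<close> with the local monomial of exponents i and j
  and has multiplicity \<open>\<kappa> w\<close> at every other point w. A combination with all
  multiplicities \<open>\<kappa> v\<close> therefore has no leading term anywhere and is
  trivial.\<close>

lemma independent_forms:
  assumes V: "distinct_points (V :: ('k::field ^ 3) set)" and t: "(\<Sum>v\<in>V. \<kappa> v) \<le> t"
  shows "\<exists>b. (\<forall>x\<in>(SIGMA v:V. {(i, j). i + j < \<kappa> v}). is_form t (b x)) \<and>
    (\<forall>w. (\<forall>v\<in>V. mult_ge v (\<kappa> v) (\<Sum>x\<in>(SIGMA v:V. {(i, j). i + j < \<kappa> v}). const (w x) * b x)) \<longrightarrow>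
       (\<forall>x\<in>(SIGMA v:V. {(i, j). i + j < \<kappa> v}). w x = 0))"
proof -
  let ?I = "SIGMA v:V. {(i, j). i + j < \<kappa> v}"
  have finV: "finite V" and V0: "\<And>v. v \<in> V \<Longrightarrow> v \<noteq> 0" using V by (auto simp: distinct_points_def)
  have finI: "finite ?I" using finV card_triangle(2) by (intro finite_SigmaI)
  have exU: "\<exists>U. is_form (t - s) U \<and> poly3_eval U v \<noteq> 0 \<and> (\<forall>w\<in>V - {v}. mult_ge w (\<kappa> w) U)"
    if "v \<in> V" "s < \<kappa> v" for v s
  proof (rule exists_separating_form[OF V that(1)])
    have "(\<Sum>v\<in>V. \<kappa> v) = \<kappa> v + (\<Sum>w\<in>V - {v}. \<kappa> w)" using finV that(1) by (rule sum.remove)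
    then show "(\<Sum>w\<in>V - {v}. \<kappa> w) \<le> t - s" using t that(2) by linarith
  qed
  define U where "U v s = (SOME U. is_form (t - s) U \<and> poly3_eval U v \<noteq> 0 \<and>
    (\<forall>w\<in>V - {v}. mult_ge w (\<kappa> w) U))" for v s
  have U: "is_form (t - s) (U v s)" "poly3_eval (U v s) v \<noteq> 0"
    "w \<in> V - {v} \<Longrightarrow> mult_ge w (\<kappa> w) (U v s)" if "v \<in> V" "s < \<kappa> v" for v s w
    using someI_ex[OF exU[OF that]] unfolding U_def by auto
  have "\<forall>k. \<exists>pq. fst pq \<noteq> k \<and> snd pq \<noteq> k \<and> fst pq \<noteq> (snd pq :: 3)"
    using other_coords by (metis fst_conv snd_conv)
  then obtain pq where pq': "\<forall>k. fst (pq k) \<noteq> k \<and> snd (pq k) \<noteq> k \<and> fst (pq k) \<noteq> (snd (pq k) :: 3)"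
    by (rule choice[THEN exE])
  define p q where "p v = fst (pq (coord v))" and "q v = snd (pq (coord v))" for v :: "'k ^ 3"
  have pq: "p v \<noteq> coord v" "q v \<noteq> coord v" "p v \<noteq> q v" for v
    using pq' unfolding p_def q_def by auto
  define b where "b = (\<lambda>(v, i, j). lin (coord v) v (p v) ^ i * lin (coord v) v (q v) ^ j * U v (i + j))"
  have form: "is_form t (b x)" if x: "x \<in> ?I" for x
  proof -
    obtain v i j where vij: "x = (v, i, j)" "v \<in> V" "i + j < \<kappa> v" using x by auto
    have "i + j < t" using vij t member_le_sum[of v V \<kappa>] finV by auto
    moreover have "is_form (i * Suc 0 + j * Suc 0 + (t - (i + j))) (b x)"
      unfolding b_def vij(1) prod.case
      by (intro is_form_mult is_form_power is_form_lin U(1)[OF vij(2,3)])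
    ultimately show ?thesis by simp
  qed
  have indep: "w x = 0" if m: "\<And>v. v \<in> V \<Longrightarrow> mult_ge v (\<kappa> v) (\<Sum>x\<in>?I. const (w x) * b x)" and x: "x \<in> ?I" for w x
  proof (rule ccontr)
    assume wx: "w x \<noteq> 0"
    obtain v i' j' where vij: "x = (v, i', j')" "v \<in> V" "i' + j' < \<kappa> v" using x by auto
    let ?k = "coord v"
    have k: "v $ ?k \<noteq> 0" using coord V0 vij(2) by blast
    \<comment> \<open>The lowest local order at \<open>v\<close> with a nonzero coefficient. The
      monomial \<open>?e\<close> built from it below arises from the term \<open>(v, i0, j0)\<close>
      alone: terms at other points have order at least \<open>\<kappa> v\<close> here, terms of
      lower order have coefficient 0, and the remaining ones have leading monomials that do not
      divide \<open>?e\<close>.\<close>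
    define s where "s = (LEAST s. \<exists>i j. i + j = s \<and> s < \<kappa> v \<and> w (v, i, j) \<noteq> 0)"
    have ex: "\<exists>i j. i + j = s \<and> s < \<kappa> v \<and> w (v, i, j) \<noteq> 0"
      unfolding s_def by (rule LeastI_ex) (use wx vij in blast)
    then obtain i0 j0 where ij: "i0 + j0 = s" "s < \<kappa> v" "w (v, i0, j0) \<noteq> 0" by blast
    have least: "w (v, i, j) = 0" if "i + j < s" for i j
      using not_less_Least[of "i + j" "\<lambda>s. \<exists>i j. i + j = s \<and> s < \<kappa> v \<and> w (v, i, j) \<noteq> 0"] that ij(2)
      unfolding s_def[symmetric] by auto
    have st: "s < t" using ij(2) vij t member_le_sum[of v V \<kappa>] finV by auto
    let ?e = "Poly_Mapping.single (p v) i0 + Poly_Mapping.single (q v) j0 + Poly_Mapping.single ?k (t - s)"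
    have e: "?e \<in> monomials t" using ij st by (simp add: monomials_def)
    have ek: "expo ?e ?k = t - s" "expo ?e (p v) = i0" "expo ?e (q v) = j0"
      using pq(1-3)[of v] by (auto simp: lookup_add lookup_single when_def)
    have cond: "t < expo ?e ?k + \<kappa> v" using ek st ij(2) by simp
    let ?f = "\<lambda>F. coef (theta ?k v F) ?e"
    have val: "?f (b y) * w y = (if y = (v, i0, j0) then coef (theta ?k v (U v s)) (Poly_Mapping.single ?k (t - s)) * w y else 0)"
      if y: "y \<in> ?I" for y
    proof -
      obtain v' i j where y': "y = (v', i, j)" "v' \<in> V" "i + j < \<kappa> v'" using y by auto
      show ?thesis
      proof (cases "v' = v")
        case False
        then have "mult_ge v (\<kappa> v) (b y)"
          using U(3)[OF y'(2,3), of v] vij(2) unfolding b_def y'(1)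
          by (auto intro: mult_ge_mult_left)
        then have "?f (b y) = 0"
          using mult_ge_imp_coef_theta[OF k form[OF y] _ e cond] by blast
        then show ?thesis using False y'(1) by auto
      next
        case True
        let ?u = "Poly_Mapping.single (p v) i + Poly_Mapping.single (q v) j"
        have l: "theta ?k v (lin ?k v r) = var r" if "r \<noteq> ?k" for r
          using that k by (simp add: lin_def theta.hom_minus theta.hom_mult) (simp add: theta_def)
        have pw: "var r ^ n = (mono (Poly_Mapping.single r n) :: 'k poly3)" for r n
        proof (induction n)
          case (Suc n)
          have "Poly_Mapping.single r (1::nat) + Poly_Mapping.single r n = Poly_Mapping.single r (Suc n)"
            by (simp only: single_add[symmetric] plus_1_eq_Suc)
          then show ?case using Suc by (simp only: power_Suc var_def mult_single mult_1_left)
        qed simp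
        have "theta ?k v (b y) = mono ?u * theta ?k v (U v (i + j))"
          unfolding b_def y'(1) using True pq(1,2)[of v]
          by (simp add: theta.hom_mult theta.hom_power l pw mult_single)
        then have fb: "?f (b y) = (if \<forall>r. expo ?u r \<le> expo ?e r then coef (theta ?k v (U v (i + j))) (?e - ?u) else 0)"
          by (simp only: coef_mono_mult)
        have u: "expo ?u (p v) = i" "expo ?u (q v) = j"
          using pq(1-3)[of v] by (auto simp: lookup_add lookup_single when_def)
        show ?thesis
        proof (cases "(i, j) = (i0, j0)")
          case True
          have "?e - ?u = Poly_Mapping.single ?k (t - s)" using True by simp
          moreover have "\<forall>r. expo ?u r \<le> expo ?e r" using True by (simp add: lookup_add)
          ultimately show ?thesis using fb True \<open>v' = v\<close> y'(1) ij(1) by auto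
        next
          case neq: False
          show ?thesis
          proof (cases "i + j < s")
            case True
            then show ?thesis using least neq y'(1) \<open>v' = v\<close> by auto
          next
            case False
            then have "\<not> (i \<le> i0 \<and> j \<le> j0)" using neq ij(1) by auto
            then have "\<not> (\<forall>r. expo ?u r \<le> expo ?e r)" using u ek by metis
            then show ?thesis using fb neq y'(1) by auto
          qed
        qed
      qed
    qed
    have "0 = ?f (\<Sum>x\<in>?I. const (w x) * b x)"
    proof (rule sym, rule mult_ge_imp_coef_theta[OF k _ m[OF vij(2)] e cond])
      show "is_form t (\<Sum>x\<in>?I. const (w x) * b x)"
        using form by (intro is_form_sum is_form_const_mult)
    qed
    also have "\<dots> = (\<Sum>y\<in>?I. ?f (b y) * w y)"
      by (rule linear_functional_sum[OF linear_functional_theta])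
    also have "\<dots> = (\<Sum>y\<in>?I. if y = (v, i0, j0) then coef (theta ?k v (U v s)) (Poly_Mapping.single ?k (t - s)) * w y else 0)"
      by (rule sum.cong[OF refl val])
    also have "\<dots> = coef (theta ?k v (U v s)) (Poly_Mapping.single ?k (t - s)) * w (v, i0, j0)"
      using finI ij vij(2) by simp
    finally show False
      using coef_theta_pure[OF k U(1)[OF vij(2) ij(2)] U(2)[OF vij(2) ij(2)]] ij(3) by simp
  qed
  show ?thesis by (intro exI[of _ b] conjI ballI allI impI form indep) auto
qed

subsection \<open>Bezout's inequality\<close>

text \<open>The order on exponents is compatible with addition, so leading monomials multiply
  without cancellation.\<close>

lemma coef_mult_Max:
  fixes F G :: "'k::idom poly3"
  assumes "F \<noteq> 0" "G \<noteq> 0"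
  shows "coef (F * G) (Max (Poly_Mapping.keys F) + Max (Poly_Mapping.keys G)) \<noteq> 0"
proof -
  define f g where "f = Max (Poly_Mapping.keys F)" and "g = Max (Poly_Mapping.keys G)"
  have f: "f \<in> Poly_Mapping.keys F" and g: "g \<in> Poly_Mapping.keys G"
    unfolding f_def g_def using assms by (auto intro!: Max_in)
  have fm: "e \<le> f" if "e \<in> Poly_Mapping.keys F" for e unfolding f_def using that by simp
  have gm: "e \<le> g" if "e \<in> Poly_Mapping.keys G" for e unfolding g_def using that by simp
  define F' where "F' = (\<Sum>e\<in>Poly_Mapping.keys F - {f}. Poly_Mapping.single e (coef F e))"
  have F: "F = Poly_Mapping.single f (coef F f) + F'"
    unfolding F'_def using f by (subst sum.remove[symmetric]) (simp_all add: sum_single_eq)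
  have kF': "Poly_Mapping.keys F' \<subseteq> Poly_Mapping.keys F - {f}"
    unfolding F'_def by (rule order_trans[OF keys_sum]) auto
  have "f + g \<notin> Poly_Mapping.keys (F' * G)"
  proof
    assume "f + g \<in> Poly_Mapping.keys (F' * G)"
    then obtain a b where ab: "f + g = a + b" "a \<in> Poly_Mapping.keys F'" "b \<in> Poly_Mapping.keys G"
      using keys_mult[of F' G] by auto
    then have "a < f" using kF' fm[of a] by auto
    then have "a + b < f + g" using gm[OF ab(3)] by (rule add_less_le_mono)
    then show False using ab(1) by simp
  qed
  moreover have "coef (Poly_Mapping.single f (coef F f) * G) (f + g) = coef F f * coef G g"
  proof -
    have "Poly_Mapping.single f (coef F f) = const (coef F f) * mono f" by (simp add: mult_single)
    then show ?thesis by (simp only: mult.assoc coef_const_mult coef_mono_mult) (simp add: lookup_add)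
  qed
  ultimately have "coef (F * G) (f + g) = coef F f * coef G g"
    by (subst F) (simp add: distrib_right lookup_add in_keys_iff)
  then show ?thesis using f g by (simp add: f_def g_def in_keys_iff)
qed

lemma triangle_arith:
  "2 * (n * (n + 1) div 2) = n * (n + 1)" "2 * ((n + 1) * (n + 2) div 2) = (n + 1) * (n + 2)" for n :: nat
  by (rule dvd_mult_div_cancel, simp)+

text \<open>A dimension count. If the inequality failed, A C + B G + W = 0 would have a nontrivial
  solution in which A has the multiplicities of \<open>G\<close>, B those of \<open>C\<close>, and W
  lies in the span given by \<open>independent_forms\<close>. Then W has multiplicity
  \<open>\<kappa> v\<close> everywhere and vanishes, so \<open>C\<close> divides B, and a
  normalisation of B makes all three zero.\<close>

theorem bezout_inequality:
  fixes C G :: "'k::field poly3"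
  assumes C: "irreducible C" "is_form a C" and G: "is_form g G" "\<not> C dvd G" and V: "distinct_points V"
  shows "(\<Sum>v\<in>V. mult_at v C * mult_at v G) \<le> a * g"
proof (rule ccontr)
  assume "\<not> ?thesis"
  then have lt: "a * g < (\<Sum>v\<in>V. mult_at v C * mult_at v G)" by simp
  define c \<mu> \<kappa> where "c v = mult_at v C" and "\<mu> v = mult_at v G" and "\<kappa> v = c v + \<mu> v" for v
  have finV: "finite V" and V0: "\<And>v. v \<in> V \<Longrightarrow> v \<noteq> 0" using V by (auto simp: distinct_points_def)
  have C0: "C \<noteq> 0" and G0: "G \<noteq> 0" using C G by auto
  define r where "r = (\<Sum>v\<in>V. \<kappa> v)"
  define t where "t = r + a + g"
  let ?I = "SIGMA v:V. {(i, j). i + j < \<kappa> v}"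
  have finI: "finite ?I" using finV card_triangle(2) by (intro finite_SigmaI)
  have le: "(\<Sum>v\<in>V. \<kappa> v) \<le> t" by (simp add: t_def r_def)
  obtain b where b': "\<forall>x\<in>?I. is_form t (b x)"
    "\<forall>w. (\<forall>v\<in>V. mult_ge v (\<kappa> v) (\<Sum>x\<in>?I. const (w x) * b x)) \<longrightarrow> (\<forall>x\<in>?I. w x = 0)"
    using independent_forms[OF V le] by (elim exE conjE) (rule that)
  have b: "is_form t (b x)" if "x \<in> ?I" for x using b'(1) that by blast
  \<comment> \<open>The trivial solutions A = - G X, B = C X with X of degree \<open>r\<close> must
    be excluded. This is done by forbidding in B all monomials that are multiples of the leading
    monomial of \<open>C\<close>, which costs exactly as many equations as X has
    coefficients.\<close>
  let ?lm = "Max (Poly_Mapping.keys C)"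
  let ?E = "(monomials t <+> conditions \<mu> (r + g) V) <+> (conditions c (r + a) V <+> monomials r)"
  let ?fA = "case_sum (case_sum (\<lambda>e A. coef (A * C) e) (\<lambda>(v, e) A. coef (theta (coord v) v A) e)) (case_sum (\<lambda>(v, e) A. 0) (\<lambda>e A. 0))"
  let ?fB = "case_sum (case_sum (\<lambda>e B. coef (B * G) e) (\<lambda>(v, e) B. 0)) (case_sum (\<lambda>(v, e) B. coef (theta (coord v) v B) e) (\<lambda>e B. coef B (?lm + e)))"
  let ?fW = "case_sum (case_sum (\<lambda>e W. coef W e) (\<lambda>(v, e) W. 0)) (case_sum (\<lambda>(v, e) W. 0) (\<lambda>e W. 0))"
  have finE: "finite ?E"
    using finite_conditions[OF finV] by (intro finite_Plus finite_monomials)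
  have card: "card ?E < card (monomials (r + g)) + card (monomials (r + a)) + card ?I"
  proof -
    have cE: "card ?E = card (monomials t) + card (conditions \<mu> (r + g) V) + (card (conditions c (r + a) V) + card (monomials r))"
      using finite_conditions[OF finV] by (simp add: card_Plus del: card_SigmaI)
    have cI: "card ?I = (\<Sum>v\<in>V. \<kappa> v * (\<kappa> v + 1) div 2)"
      using finV card_triangle by (subst card_SigmaI) auto
    have s2: "2 * (\<Sum>v\<in>V. f v * (f v + 1) div 2) = (\<Sum>v\<in>V. f v * (f v + 1))" for f :: "'k ^ 3 \<Rightarrow> nat"
      unfolding sum_distrib_left by (intro sum.cong refl triangle_arith)
    \<comment> \<open>Triangular numbers satisfy T(c + \<mu>) = T(c) + T(\<mu>) + c \<mu>, and the
      dimensions in degrees \<open>t\<close>, \<open>r\<close>, \<open>r + g\<close>,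
      \<open>r + a\<close> differ by \<open>a * g\<close>. Unknowns thus exceed equations by at
      least the violation of the inequality.\<close>
    have "(\<Sum>v\<in>V. \<kappa> v * (\<kappa> v + 1)) = (\<Sum>v\<in>V. \<mu> v * (\<mu> v + 1)) + (\<Sum>v\<in>V. c v * (c v + 1)) + 2 * (\<Sum>v\<in>V. c v * \<mu> v)"
      unfolding sum_distrib_left sum.distrib[symmetric] by (intro sum.cong) (auto simp: \<kappa>_def algebra_simps)
    moreover have "(t + 1) * (t + 2) + (r + 1) * (r + 2) = (r + g + 1) * (r + g + 2) + (r + a + 1) * (r + a + 2) + 2 * (a * g)"
      by (simp add: t_def algebra_simps)
    moreover have "a * g < (\<Sum>v\<in>V. c v * \<mu> v)" using lt by (simp add: c_def \<mu>_def)
    ultimately show ?thesis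
      using card_conditions[OF finV, where \<mu> = \<mu> and d = "r + g"] card_conditions[OF finV, where \<mu> = c and d = "r + a"]
        s2[of \<mu>] s2[of c] s2[of \<kappa>] triangle_arith(2)[of t] triangle_arith(2)[of r]
        triangle_arith(2)[of "r + g"] triangle_arith(2)[of "r + a"]
      unfolding cE cI card_monomials by linarith
  qed
  have linA: "linear_functional (?fA e)" and linB: "linear_functional (?fB e)" and linW: "linear_functional (?fW e)" for e
    by (auto split: sum.split prod.split
        simp: linear_functional_coef_mult linear_functional_theta linear_functional_zero linear_functional_coef)
  obtain xA xB xW where x: "(\<exists>i\<in>monomials (r + g). xA i \<noteq> 0) \<or> (\<exists>i\<in>monomials (r + a). xB i \<noteq> 0) \<or> (\<exists>i\<in>?I. xW i \<noteq> 0)"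
    "\<forall>e\<in>?E. ?fA e (\<Sum>i\<in>monomials (r + g). const (xA i) * mono i) + ?fB e (\<Sum>i\<in>monomials (r + a). const (xB i) * mono i)
        + ?fW e (\<Sum>i\<in>?I. const (xW i) * b i) = 0"
    using linear_system_three[where E = ?E and fA = ?fA and fB = ?fB and fW = ?fW and bA = mono and bB = mono and bW = b,
          OF finE finite_monomials finite_monomials finI card linA linB linW]
    by (elim exE conjE) (rule that)
  define A where "A = (\<Sum>i\<in>monomials (r + g). const (xA i) * mono i)"
  define B where "B = (\<Sum>i\<in>monomials (r + a). const (xB i) * mono i)"
  define W where "W = (\<Sum>i\<in>?I. const (xW i) * b i)"
  note x2 = x(2)[folded A_def B_def W_def]
  have formA: "is_form (r + g) A" and formB: "is_form (r + a) B" unfolding A_def B_def by (rule is_form_sum_mono)+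
  have formW: "is_form t W" unfolding W_def using b by (intro is_form_sum is_form_const_mult)
  have e1: "coef (A * C) e + coef (B * G) e + coef W e = 0" if "e \<in> monomials t" for e
    using bspec[OF x2, OF InlI, OF InlI, OF that] by simp
  have e2: "coef (theta (coord v) v A) e = 0" if "(v, e) \<in> conditions \<mu> (r + g) V" for v e
    using bspec[OF x2, OF InlI, OF InrI, OF that] by simp
  have e3: "coef (theta (coord v) v B) e = 0" if "(v, e) \<in> conditions c (r + a) V" for v e
    using bspec[OF x2, OF InrI, OF InlI, OF that] by simp
  have e4: "coef B (?lm + e) = 0" if "e \<in> monomials r" for e
    using bspec[OF x2, OF InrI, OF InrI, OF that] by simp
  have "is_form t (A * C)" "is_form t (B * G)"
    using is_form_mult[OF formA C(2)] is_form_mult[OF formB G(1)] by (simp_all add: t_def ac_simps)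
  then have "is_form t (A * C + B * G + W)" using formW by (intro is_form_add)
  then have sum0: "A * C + B * G + W = 0"
    by (rule is_form_eq_0I) (simp add: lookup_add e1)
  have mW: "mult_ge v (\<kappa> v) W" if v: "v \<in> V" for v
  proof -
    have "mult_ge v (\<mu> v + c v) (A * C)"
      using mult_ge_conditions[OF V0[OF v] formA v e2] mult_ge_mult_at[of v C] unfolding c_def by (rule mult_ge_mult)
    moreover have "mult_ge v (c v + \<mu> v) (B * G)"
      using mult_ge_conditions[OF V0[OF v] formB v e3] mult_ge_mult_at[of v G] unfolding \<mu>_def by (rule mult_ge_mult)
    ultimately have "mult_ge v (\<kappa> v) (const (- 1) * (A * C + B * G))"
      unfolding \<kappa>_def by (intro mult_ge_mult_left[OF mult_ge_add]) (simp_all add: add.commute)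
    moreover have "W = const (- 1) * (A * C + B * G)"
    proof -
      have "W = - (A * C + B * G)" using sum0 by (metis add.commute eq_neg_iff_add_eq_0)
      then show ?thesis by (simp only: single_uminus single_one mult_minus_left mult_1_left)
    qed
    ultimately show ?thesis by simp
  qed
  have xW: "xW i = 0" if "i \<in> ?I" for i
    using b'(2)[rule_format, OF _ that] mW[unfolded W_def] by simp
  then have "W = 0" unfolding W_def by (intro sum.neutral) auto
  then have AB: "A * C + B * G = 0" using sum0 by simp
  then have "C dvd G * B" by (metis add_eq_0_iff dvd_minus_iff dvd_triv_right mult.commute)
  then have "C dvd B" by (rule prime_dvd_mult_cancel[OF C(1) G(2)])
  then obtain X where X: "B = C * X" by blast
  have "X = 0"
  proof (rule ccontr)
    assume X0: "X \<noteq> 0"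
    let ?m = "Max (Poly_Mapping.keys X)"
    have "B \<noteq> 0" using X X0 C0 by simp
    then obtain u w where uw: "is_form u C" "is_form w X" "u + w = r + a"
      using dvd_form_imp_form[OF formB _ X] by blast
    then have "w = r" using is_form_unique[OF C(2) _ C0] by force
    then have "?m \<in> monomials r" using uw(2) X0 by (auto simp: is_form_iff monomials_def intro!: Max_in)
    then show False using e4 coef_mult_Max[OF C0 X0] X by metis
  qed
  then have "B = 0" using X by simp
  moreover from this have "A = 0" using AB C0 by simp
  ultimately have z: "coef A i = 0" "coef B i = 0" for i by simp_all
  have "xA i = 0" if "i \<in> monomials (r + g)" for i
    using z(1)[of i] that unfolding A_def coef_sum_mono[OF finite_monomials] by simp
  moreover have "xB i = 0" if "i \<in> monomials (r + a)" for i
    using z(2)[of i] that unfolding B_def coef_sum_mono[OF finite_monomials] by simp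
  ultimately show False using x(1) xW by (elim disjE bexE) simp_all
qed

lemma bezout_dvd:
  fixes C G :: "'k::field poly3"
  assumes "irreducible C" "is_form a C" "is_form g G" "distinct_points V"
    and "a * g < (\<Sum>v\<in>V. mult_at v C * mult_at v G)"
  shows "C dvd G"
  using bezout_inequality[OF assms(1-3) _ assms(4)] assms(5) by linarith

text \<open>Bezout between \<open>C\<close> and a nonzero partial derivative: its degree is too
  small for \<open>C\<close> to divide it, and its multiplicities drop by at most one.\<close>

lemma bezout_derivative:
  fixes C :: "'k::field_char_0 poly3"
  assumes C: "irreducible C" "is_form a C" and V: "distinct_points V"
  shows "(\<Sum>v\<in>V. mult_at v C * (mult_at v C - 1)) \<le> a * (a - 1)"
proof -
  have C0: "C \<noteq> 0" "a > 0" using irreducible_form_degree[OF C] by auto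
  then obtain d where d: "a = Suc d" by (cases a) auto
  obtain i where i: "pd i C \<noteq> 0" using exists_pd_nonzero C C0(1) d by blast
  have f: "is_form d (pd i C)" using C d is_form_pd by blast
  have "\<not> C dvd pd i C"
  proof
    assume "C dvd pd i C"
    then obtain H where H: "pd i C = C * H" by blast
    obtain u w where "is_form u C" "is_form w H" "u + w = d" using dvd_form_imp_form[OF f i H] .
    then show False using is_form_unique[OF C(2) _ C0(1)] d by force
  qed
  then have le: "(\<Sum>v\<in>V. mult_at v C * mult_at v (pd i C)) \<le> a * d"
    by (rule bezout_inequality[OF C f _ V])
  have "mult_at v C - 1 \<le> mult_at v (pd i C)" for v
  proof (cases "mult_at v C")
    case (Suc m)
    then have "mult_ge v m (pd i C)" using mult_ge_mult_at[of v C] by (intro mult_ge_pd) simp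
    then show ?thesis using i Suc by (simp add: mult_ge_iff_mult_at)
  qed simp
  then have "(\<Sum>v\<in>V. mult_at v C * (mult_at v C - 1)) \<le> (\<Sum>v\<in>V. mult_at v C * mult_at v (pd i C))"
    by (intro sum_mono mult_left_mono) auto
  then show ?thesis using le d by simp
qed

section \<open>A lower bound for the growth of initial degrees\<close>

text \<open>The solution is the coordinatewise supremum of all feasible vectors. Off-diagonal
  entries are nonnegative, so raising the other coordinates only helps inequality \<open>i\<close>
  and the supremum stays feasible; a coordinate below its bound \<open>e i\<close> with slack could
  be raised further. In the application \<open>B\<close> is an intersection matrix, \<open>x\<close>
  belongs to the nef part, and \<open>e - x\<close> is the negative part.\<close>

lemma zariski_decomposition:
  fixes B :: "'i \<Rightarrow> 'i \<Rightarrow> real" and r e :: "'i \<Rightarrow> real"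
  assumes I: "finite I" and off: "\<And>i j. i \<in> I \<Longrightarrow> j \<in> I \<Longrightarrow> i \<noteq> j \<Longrightarrow> 0 \<le> B j i"
    and r: "\<And>i. i \<in> I \<Longrightarrow> 0 \<le> r i" and e: "\<And>i. i \<in> I \<Longrightarrow> 0 \<le> e i"
  shows "\<exists>x. \<forall>i\<in>I. 0 \<le> x i \<and> x i \<le> e i \<and> 0 \<le> r i + (\<Sum>j\<in>I. x j * B j i) \<and>
     (x i < e i \<longrightarrow> r i + (\<Sum>j\<in>I. x j * B j i) = 0)"
proof -
  define P where "P x i = r i + (\<Sum>j\<in>I. x j * B j i)" for x :: "'i \<Rightarrow> real" and i
  define K where "K = {x. \<forall>i\<in>I. 0 \<le> x i \<and> x i \<le> e i \<and> 0 \<le> P x i}"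
  define y where "y i = Sup ((\<lambda>x. x i) ` K)" for i
  have K0: "(\<lambda>_. 0) \<in> K" using r e by (auto simp: K_def P_def)
  have bdd: "bdd_above ((\<lambda>x. x i) ` K)" if "i \<in> I" for i
    using that by (intro bdd_aboveI[of _ "e i"]) (auto simp: K_def)
  have le_y: "x i \<le> y i" if "x \<in> K" "i \<in> I" for x i
    unfolding y_def using that bdd by (intro cSup_upper) auto
  have y_le: "y i \<le> u" if "\<And>x. x \<in> K \<Longrightarrow> x i \<le> u" for i u
    unfolding y_def using K0 that by (intro cSup_least) auto
  have y0: "0 \<le> y i" if "i \<in> I" for i using le_y[OF K0 that] by simp
  have split: "P x i = x i * B i i + (r i + (\<Sum>j\<in>I - {i}. x j * B j i))" if "i \<in> I" for x i
    unfolding P_def using I that by (subst sum.remove[of _ i]) auto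
  have Py: "0 \<le> P y i" if i: "i \<in> I" for i
  proof -
    let ?c = "r i + (\<Sum>j\<in>I - {i}. y j * B j i)"
    have *: "0 \<le> x i * B i i + ?c" if x: "x \<in> K" for x
    proof -
      have "(\<Sum>j\<in>I - {i}. x j * B j i) \<le> (\<Sum>j\<in>I - {i}. y j * B j i)"
        using off i le_y[OF x] by (intro sum_mono mult_right_mono) auto
      moreover have "0 \<le> P x i" using x i by (auto simp: K_def)
      ultimately show ?thesis unfolding split[OF i] by linarith
    qed
    show ?thesis
    proof (cases "B i i \<ge> 0")
      case True
      then have "0 \<le> y i * B i i" using y0[OF i] by simp
      then show ?thesis unfolding split[OF i] using *[OF K0] by linarith
    next
      case False
      \<comment> \<open>With a negative diagonal entry, inequality \<open>i\<close> is an upper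
        bound for \<open>x i\<close> that grows with the other coordinates, so it passes to the
        supremum.\<close>
      have "y i \<le> ?c / (- B i i)"
      proof (rule y_le)
        fix x assume "x \<in> K"
        then show "x i \<le> ?c / (- B i i)" using *[of x] False by (subst pos_le_divide_eq) (auto simp: algebra_simps)
      qed
      then have "y i * (- B i i) \<le> ?c" using False by (subst (asm) pos_le_divide_eq) auto
      then show ?thesis unfolding split[OF i] by linarith
    qed
  qed
  have yK: "y \<in> K"
    using y0 Py y_le by (auto simp: K_def)
  have "P y i = 0" if i: "i \<in> I" and lt: "y i < e i" for i
  proof (rule ccontr)
    assume "P y i \<noteq> 0"
    then have pos: "0 < P y i" using Py[OF i] by linarith
    \<comment> \<open>Raising coordinate \<open>i\<close> by \<open>\<epsilon>\<close> lowers its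
      own inequality by at most \<open>\<epsilon> * \<bar>B i i\<bar>\<close> and lowers no other;
      the added 1 keeps the divisor positive.\<close>
    define \<epsilon> where "\<epsilon> = min (e i - y i) (P y i / (\<bar>B i i\<bar> + 1))"
    have \<epsilon>: "0 < \<epsilon>" "\<epsilon> \<le> e i - y i" using lt pos by (auto simp: \<epsilon>_def)
    have \<epsilon>2: "\<epsilon> * (\<bar>B i i\<bar> + 1) \<le> P y i"
    proof -
      have "\<epsilon> \<le> P y i / (\<bar>B i i\<bar> + 1)" by (simp add: \<epsilon>_def)
      then show ?thesis by (simp add: pos_le_divide_eq)
    qed
    let ?z = "y(i := y i + \<epsilon>)"
    have Pz: "P ?z j = P y j + \<epsilon> * B i j" if "j \<in> I" for j
      unfolding P_def using I i by (simp add: sum.remove[of I i] algebra_simps)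
    have "0 \<le> P ?z j" if j: "j \<in> I" for j
    proof (cases "j = i")
      case True
      have "- (\<epsilon> * B i i) \<le> \<epsilon> * (\<bar>B i i\<bar> + 1)" using \<epsilon>(1)
        by (metis abs_ge_minus_self add.commute add_increasing less_eq_real_def mult_left_mono mult_minus_right zero_le_one)
      then show ?thesis using Pz[OF j] \<epsilon>2 True by simp
    next
      case False
      then have "0 \<le> \<epsilon> * B i j" using off[OF j i] \<epsilon>(1) by simp
      then show ?thesis using Pz[OF j] Py[OF j] by linarith
    qed
    then have "?z \<in> K" using yK \<epsilon> by (auto simp: K_def)
    then have "?z i \<le> y i" using le_y i by blast
    then show False using \<epsilon>(1) by simp
  qed
  then show ?thesis using yK unfolding K_def P_def by blast
qed

text \<open>The intersection form of the plane blown up at \<open>V\<close>, on the classes of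
  degree \<open>d\<close> with multiplicity \<open>u v\<close> along the exceptional curve over
  \<open>v\<close>.\<close>

definition dot :: "'v set \<Rightarrow> real \<Rightarrow> ('v \<Rightarrow> real) \<Rightarrow> real \<Rightarrow> ('v \<Rightarrow> real) \<Rightarrow> real" where
  "dot V d u d' u' = d * d' - (\<Sum>v\<in>V. u v * u' v)"

lemma dot_sum:
  "dot V (\<Sum>i\<in>I. x i * d i) (\<lambda>v. \<Sum>i\<in>I. x i * u i v) d' u' = (\<Sum>i\<in>I. x i * dot V (d i) (u i) d' u')"
proof -
  have "(\<Sum>v\<in>V. (\<Sum>i\<in>I. x i * u i v) * u' v) = (\<Sum>i\<in>I. \<Sum>v\<in>V. x i * (u i v * u' v))"
    by (subst sum.swap) (simp add: sum_distrib_right mult.assoc)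
  then show ?thesis
    by (simp add: dot_def right_diff_distrib sum_subtractf sum_distrib_left sum_distrib_right mult.assoc)
qed

lemma dot_commute: "dot V d u d' u' = dot V d' u' d u"
  by (simp add: dot_def mult.commute)

lemma dot_add: "dot V (d1 + d2) (\<lambda>v. u1 v + u2 v) d' u' = dot V d1 u1 d' u' + dot V d2 u2 d' u'"
  by (simp add: dot_def algebra_simps sum.distrib)

text \<open>By orthogonality and Cauchy-Schwarz, (p d)^2 = (q u)^2 <= q^2 u^2 with q^2 < p^2, where
  products of multiplicity vectors are summed over \<open>V\<close>. Strictness needs u^2 > 0, which
  a nonzero \<open>d\<close> forces.\<close>

lemma hodge_index:
  assumes V: "finite V" and pos: "0 < dot V p q p q" "0 < p" and orth: "dot V p q d u = 0"
  shows "dot V d u d u \<le> 0" and "d \<noteq> 0 \<Longrightarrow> dot V d u d u < 0"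
proof -
  let ?U = "\<Sum>v\<in>V. u v * u v" and ?Q = "\<Sum>v\<in>V. q v * q v"
  have cs: "(p * d)^2 \<le> ?Q * ?U"
    using orth Cauchy_Schwarz_ineq_sum[of q u V] by (simp add: dot_def power2_eq_square)
  have Q: "?Q < p * p" using pos by (simp add: dot_def)
  have U0: "0 \<le> ?U" by (intro sum_nonneg) auto
  have "(p * d)^2 \<le> p * p * ?U"
    using cs mult_right_mono[OF less_imp_le[OF Q] U0] by linarith
  then have "p * p * (d * d) \<le> p * p * ?U" by (simp add: power2_eq_square ac_simps)
  then show "dot V d u d u \<le> 0" using pos by (simp add: dot_def)
  assume d: "d \<noteq> 0"
  have U: "0 < ?U"
  proof (rule ccontr)
    assume "\<not> 0 < ?U"
    then have "?U = 0" using U0 by linarith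
    then have "(p * d)^2 \<le> 0" using cs by simp
    then show False using d pos by simp
  qed
  then have "(p * d)^2 < p * p * ?U"
    using cs mult_strict_right_mono[OF Q U] by linarith
  then have "p * p * (d * d) < p * p * ?U" by (simp add: power2_eq_square ac_simps)
  then show "dot V d u d u < 0" using pos by (simp add: dot_def)
qed

lemma mult_at_factorization:
  fixes F :: "'k::field poly3"
  assumes S: "finite S" "\<And>C. C \<in> S \<Longrightarrow> irreducible C" and c: "c \<noteq> 0" and F: "F = const c * (\<Prod>C\<in>S. C ^ f C)"
  shows "mult_at v F = (\<Sum>C\<in>S. f C * mult_at v C)"
proof -
  have nz: "C ^ f C \<noteq> 0" "C \<noteq> 0" if "C \<in> S" for C using S(2)[OF that] by auto
  have "(\<Prod>C\<in>S. C ^ f C) \<noteq> 0" using S(1) nz by simp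
  then have "mult_at v F = mult_at v (\<Prod>C\<in>S. C ^ f C)"
    unfolding F using c by (subst mult_at_mult) auto
  also have "\<dots> = (\<Sum>C\<in>S. mult_at v (C ^ f C))" using nz by (intro mult_at_prod) auto
  also have "\<dots> = (\<Sum>C\<in>S. f C * mult_at v C)" using nz by (intro sum.cong) (auto simp: mult_at_power)
  finally show ?thesis .
qed

text \<open>The product k (k + 1) is nonnegative at every integer, so truncating a negative
  prescribed multiplicity to 0 never raises the number of conditions above the formula.\<close>

lemma triangle_le_real:
  assumes "real z = u \<or> z = 0 \<and> (\<exists>k::int. u = of_int k)"
  shows "real z * (real z + 1) \<le> u * (u + 1)"
  using assms
proof
  assume "z = 0 \<and> (\<exists>k::int. u = of_int k)"
  then obtain k :: int where k: "z = 0" "u = of_int k" by blast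
  have "0 \<le> k * (k + 1)" by (cases "0 \<le> k") (auto intro: mult_nonpos_nonpos)
  then have "0 \<le> real_of_int (k * (k + 1))" by (simp only: of_int_0_le_iff)
  then show ?thesis using k by simp
qed simp

text \<open>The reduced curve \<open>\<Sum>x\<^sub>C C\<close> with \<open>0 \<le> x\<^sub>C \<le> 1\<close>, supported on curves of nonpositive
  self-intersection, behaves like a curve meeting its own polar: \<open>\<phi>\<^sup>2 \<ge> deg \<phi> - \<Sum>\<phi>\<^sub>v\<close>.\<close>

lemma fractional_polar_bound:
  fixes a :: "'c \<Rightarrow> real" and u :: "'c \<Rightarrow> 'v \<Rightarrow> real"
  assumes S: "finite S" and x: "\<And>C. C \<in> S \<Longrightarrow> 0 \<le> x C \<and> x C \<le> 1"
    and off: "\<And>C D. C \<in> S \<Longrightarrow> D \<in> S \<Longrightarrow> C \<noteq> D \<Longrightarrow> 0 \<le> dot V (a C) (u C) (a D) (u D)"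
    and polar: "\<And>C. C \<in> S \<Longrightarrow> a C - (\<Sum>v\<in>V. u C v) \<le> dot V (a C) (u C) (a C) (u C)"
    and neg: "\<And>C. C \<in> S \<Longrightarrow> x C \<noteq> 0 \<Longrightarrow> dot V (a C) (u C) (a C) (u C) \<le> 0"
  defines "d \<equiv> \<Sum>C\<in>S. x C * a C" and "\<phi> \<equiv> \<lambda>v. \<Sum>C\<in>S. x C * u C v"
  shows "d - (\<Sum>v\<in>V. \<phi> v) \<le> dot V d \<phi> d \<phi>"
proof -
  let ?b = "\<lambda>C D. dot V (a C) (u C) (a D) (u D)"
  have "dot V d \<phi> d \<phi> = (\<Sum>C\<in>S. x C * dot V (a C) (u C) d \<phi>)"
    unfolding d_def \<phi>_def by (rule dot_sum)
  also have "\<dots> = (\<Sum>C\<in>S. x C * (\<Sum>D\<in>S. x D * ?b D C))"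
    unfolding d_def \<phi>_def by (subst dot_commute, subst dot_sum) (rule refl)
  also have "\<dots> \<ge> (\<Sum>C\<in>S. x C * (a C - (\<Sum>v\<in>V. u C v)))"
  proof (rule sum_mono)
    fix C assume C: "C \<in> S"
    have "x C * (a C - (\<Sum>v\<in>V. u C v)) \<le> x C * (x C * ?b C C)"
    proof (cases "x C = 0")
      case False
      then have "?b C C \<le> x C * ?b C C" using neg[OF C] x[OF C]
        by (metis mult_le_cancel_right1 not_less)
      then show ?thesis using polar[OF C] x[OF C] by (intro mult_left_mono) linarith+
    qed simp
    also have "x C * (x C * ?b C C) \<le> x C * (\<Sum>D\<in>S. x D * ?b D C)"
    proof (rule mult_left_mono)
      show "x C * ?b C C \<le> (\<Sum>D\<in>S. x D * ?b D C)"
      proof -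
        have "0 \<le> (\<Sum>D\<in>S - {C}. x D * ?b D C)"
        proof (rule sum_nonneg)
          fix D assume "D \<in> S - {C}"
          then show "0 \<le> x D * ?b D C" using x[of D] off[of D C] C by simp
        qed
        then show ?thesis using S C by (simp add: sum.remove[of S C])
      qed
    qed (use x[OF C] in auto)
    finally show "x C * (a C - (\<Sum>v\<in>V. u C v)) \<le> x C * (\<Sum>D\<in>S. x D * ?b D C)" .
  qed
  also have "(\<Sum>C\<in>S. x C * (a C - (\<Sum>v\<in>V. u C v))) = d - (\<Sum>v\<in>V. \<phi> v)"
    unfolding d_def \<phi>_def
    by (subst sum.swap) (simp add: right_diff_distrib sum_subtractf sum_distrib_left)
  finally show ?thesis .
qed

text \<open>This is the inequality \<open>(\<alpha>\<^sub>m + 1) / (m + 1) \<le> \<alpha>\<^sub>n / n\<close> of Esnault and Viehweg. In the notation of the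
  proof, \<open>(\<alpha>; m, \<dots>, m)\<close> is decomposed as \<open>P + \<Sum>\<nu>\<^sub>i v\<^sub>i\<close> with \<open>P\<close> nef and orthogonal to the \<open>v\<^sub>i\<close> with
  \<open>\<nu>\<^sub>i > 0\<close>, where the \<open>v\<^sub>i\<close> are the components of \<open>F\<close> (index \<open>Inl\<close>) and the exceptional curves (index \<open>Inr\<close>).
  Rounding \<open>\<nu>\<close> up gives a class without sections in degree one less, and the resulting dimension count
  bounds \<open>P\<^sup>2\<close>.\<close>

theorem initial_degree_growth:
  fixes F :: "'k::field_char_0 poly3"
  assumes V: "distinct_points V"
    and F: "is_form t F" "F \<noteq> 0" "\<And>v. v \<in> V \<Longrightarrow> mult_ge v n F"
    and Fm: "is_form \<alpha> Fm" "Fm \<noteq> 0" "\<And>v. v \<in> V \<Longrightarrow> mult_ge v m Fm"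
    and least: "\<And>d G. is_form d G \<Longrightarrow> G \<noteq> 0 \<Longrightarrow> (\<And>v. v \<in> V \<Longrightarrow> mult_ge v m G) \<Longrightarrow> \<alpha> \<le> d"
    and n: "0 < n" and less: "t * m < \<alpha> * n"
  shows "(\<alpha> + 1) * n \<le> (m + 1) * t"
proof -
  have finV: "finite V" and V0: "\<And>v. v \<in> V \<Longrightarrow> v \<noteq> 0" using V by (auto simp: distinct_points_def)
  obtain S f c where S: "finite S" "\<forall>C\<in>S. irreducible C \<and> is_form (ord0 C) C"
    "\<forall>C\<in>S. \<forall>D\<in>S. C dvd D \<longrightarrow> C = D" "c \<noteq> 0" "F = const c * (\<Prod>C\<in>S. C ^ f C)"
    using form_factorization[OF F(1,2)] by (elim exE conjE) (rule that)
  have irr: "irreducible C" "is_form (ord0 C) C" "C \<noteq> 0" if "C \<in> S" for C using S(2) that by auto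
  define a where "a C = real (ord0 C)" for C :: "'k poly3"
  define u where "u C v = real (mult_at v C)" for C :: "'k poly3" and v
  define M where "M v = real (mult_at v F)" for v
  have a_pos: "0 < a C" if "C \<in> S" for C
    using irreducible_form_degree[OF irr(1,2)[OF that]] by (simp add: a_def)
  have u0: "0 \<le> u C v" for C v by (simp add: u_def)
  have Mn: "n \<le> M v" if "v \<in> V" for v
    using F(3)[OF that] F(2) by (simp add: M_def mult_ge_iff_mult_at)
  have MF: "M v = (\<Sum>C\<in>S. f C * u C v)" for v
    unfolding M_def u_def using mult_at_factorization[OF S(1) irr(1) S(4,5)] by simp
  have tF: "t = (\<Sum>C\<in>S. f C * a C)"
  proof -
    have "is_form (0 + (\<Sum>C\<in>S. f C * ord0 C)) F"
      unfolding S(5) by (intro is_form_mult is_form_const is_form_prod is_form_power irr)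
    then show ?thesis using is_form_unique[OF F(1) _ F(2)] by (force simp: a_def)
  qed
  have bez: "0 \<le> dot W (a C) (u C) (a D) (u D)" if "C \<in> S" "D \<in> S" "C \<noteq> D" "W \<subseteq> V" for C D W
  proof -
    have "\<not> C dvd D" using S(3) that by blast
    then have "(\<Sum>v\<in>W. mult_at v C * mult_at v D) \<le> ord0 C * ord0 D"
      by (rule bezout_inequality[OF irr(1,2)[OF that(1)] irr(2)[OF that(2)] _ distinct_points_subset[OF V that(4)]])
    then have "real (\<Sum>v\<in>W. mult_at v C * mult_at v D) \<le> real (ord0 C * ord0 D)" by (rule of_nat_mono)
    then show ?thesis by (simp add: dot_def a_def u_def)
  qed
  have polar: "a C - (\<Sum>v\<in>W. u C v) \<le> dot W (a C) (u C) (a C) (u C)" if "C \<in> S" "W \<subseteq> V" for C W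
  proof -
    have "(\<Sum>v\<in>W. mult_at v C * (mult_at v C - 1)) \<le> ord0 C * (ord0 C - 1)"
      by (rule bezout_derivative[OF irr(1,2)[OF that(1)] distinct_points_subset[OF V that(2)]])
    then have "real (\<Sum>v\<in>W. mult_at v C * (mult_at v C - 1)) \<le> real (ord0 C * (ord0 C - 1))" by (rule of_nat_mono)
    moreover have "real (k * (k - 1)) = real k * real k - real k" for k
      by (cases k) (auto simp: algebra_simps)
    ultimately show ?thesis by (simp add: dot_def a_def u_def sum_subtractf)
  qed
  \<comment> \<open>The exceptional curve over w gets degree 0 and multiplicity -1 at w, so that
    pairing with it reads off the multiplicity at w.\<close>
  define vd where "vd = case_sum a (\<lambda>_::'k ^ 3. 0)"
  define vm where "vm = case_sum u (\<lambda>w v. if v = w then - 1 else 0)"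
  define B where "B i j = dot V (vd i) (vm i) (vd j) (vm j)" for i j
  let ?I = "S <+> V"
  have finI: "finite ?I" using S(1) finV by simp
  \<comment> \<open>The divisor of \<open>F\<close> scaled by m / n, its surplus
    \<open>M w - n\<close> being assigned to the exceptional curves. The class of degree
    \<open>\<alpha>\<close> and multiplicities \<open>m\<close> is then \<open>s\<close> times a
    line plus this divisor, with \<open>s\<close> as defined next.\<close>
  define e where "e = case_sum (\<lambda>C. m / n * f C) (\<lambda>w. m / n * (M w - n))"
  define s where "s = \<alpha> - m * t / n"
  have s: "0 < s"
  proof -
    have "real (t * m) < real (\<alpha> * n)" using less by (simp only: of_nat_less_iff)
    then show ?thesis using n by (simp add: s_def field_simps)
  qed
  have dotE: "dot V d q 0 (\<lambda>v. if v = w then - 1 else 0) = q w" if "w \<in> V" for d q w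
    using finV that by (simp add: dot_def if_distrib cong: if_cong)
  have B_off: "0 \<le> B j i" if "i \<in> ?I" "j \<in> ?I" "i \<noteq> j" for i j
  proof (cases i; cases j)
    fix w D assume "i = Inr w" "j = Inl D"
    then show ?thesis using that u0 by (auto simp: B_def vd_def vm_def dotE)
  next
    fix C w assume "i = Inl C" "j = Inr w"
    then show ?thesis using that u0 by (subst (1) B_def, subst dot_commute) (auto simp: vd_def vm_def dotE)
  next
    fix w w' assume "i = Inr w" "j = Inr w'"
    then show ?thesis using that by (auto simp: B_def vd_def vm_def dotE)
  next
    fix C D assume "i = Inl C" "j = Inl D"
    then show ?thesis using that bez[of D C V] by (auto simp: B_def vd_def vm_def)
  qed
  have e0: "0 \<le> e i" if "i \<in> ?I" for i
    using that Mn by (auto simp: e_def)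
  have r0: "0 \<le> s * vd i" if "i \<in> ?I" for i
    using that s by (auto simp: vd_def a_def)
  have "\<exists>x. \<forall>i\<in>?I. 0 \<le> x i \<and> x i \<le> e i \<and> 0 \<le> s * vd i + (\<Sum>j\<in>?I. x j * B j i) \<and>
     (x i < e i \<longrightarrow> s * vd i + (\<Sum>j\<in>?I. x j * B j i) = 0)"
    by (rule zariski_decomposition[OF finI]) (fact B_off r0 e0)+
  then obtain x where x: "\<forall>i\<in>?I. 0 \<le> x i \<and> x i \<le> e i \<and> 0 \<le> s * vd i + (\<Sum>j\<in>?I. x j * B j i) \<and>
     (x i < e i \<longrightarrow> s * vd i + (\<Sum>j\<in>?I. x j * B j i) = 0)"
    by (elim exE) (rule that)
  define p where "p = s + (\<Sum>i\<in>?I. x i * vd i)"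
  define q where "q v = (\<Sum>i\<in>?I. x i * vm i v)" for v
  define \<nu> where "\<nu> i = e i - x i" for i
  have PB: "dot V p q (vd i) (vm i) = s * vd i + (\<Sum>j\<in>?I. x j * B j i)" for i
  proof -
    have "dot V p q (vd i) (vm i) = s * vd i + dot V (\<Sum>j\<in>?I. x j * vd j) q (vd i) (vm i)"
      by (simp add: dot_def p_def algebra_simps)
    then show ?thesis unfolding q_def dot_sum B_def .
  qed
  have nef: "0 \<le> dot V p q (vd i) (vm i)" if "i \<in> ?I" for i
    unfolding PB using x that by blast
  have \<nu>0: "0 \<le> \<nu> i" if "i \<in> ?I" for i
    using x that by (simp add: \<nu>_def)
  have orth: "dot V p q (vd i) (vm i) = 0" if "i \<in> ?I" "\<nu> i \<noteq> 0" for i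
  proof -
    have "x i < e i" using x that by (force simp: \<nu>_def)
    then show ?thesis unfolding PB using x that(1) by blast
  qed
  have q0: "0 \<le> q w" if "w \<in> V" for w
    using nef[OF InrI[OF that]] that by (simp add: vd_def vm_def dotE)
  have qE: "q w = 0" if "w \<in> V" "\<nu> (Inr w) \<noteq> 0" for w
    using orth[OF InrI[OF that(1)] that(2)] that by (simp add: vd_def vm_def dotE)
  have vd0: "0 \<le> vd i" for i by (cases i) (auto simp: vd_def a_def)
  have p_pos: "s \<le> p"
  proof -
    have "0 \<le> (\<Sum>i\<in>?I. x i * vd i)" using x vd0 by (intro sum_nonneg mult_nonneg_nonneg) blast+
    then show ?thesis unfolding p_def by linarith
  qed
  \<comment> \<open>The positive multiple \<open>s\<close> of a line makes the nef part big: its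
    square is at least \<open>s * p\<close>.\<close>
  have PP: "0 < dot V p q p q"
  proof -
    have pq: "dot V p q p q = s * p + dot V (\<Sum>i\<in>?I. x i * vd i) (\<lambda>v. \<Sum>i\<in>?I. x i * vm i v) p q"
      by (simp add: dot_def p_def q_def algebra_simps)
    have "0 \<le> (\<Sum>i\<in>?I. x i * dot V p q (vd i) (vm i))"
      using nef x by (intro sum_nonneg mult_nonneg_nonneg) blast+
    also have "\<dots> = dot V (\<Sum>i\<in>?I. x i * vd i) (\<lambda>v. \<Sum>i\<in>?I. x i * vm i v) p q"
      unfolding dot_sum by (subst dot_commute) (rule refl)
    finally show ?thesis unfolding pq using s p_pos by (simp add: add_pos_nonneg)
  qed
  have p0: "0 < p" using s p_pos by linarith
  have sumI: "(\<Sum>i\<in>?I. g i) = (\<Sum>C\<in>S. g (Inl C)) + (\<Sum>w\<in>V. g (Inr w))" for g :: "_ \<Rightarrow> real"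
    using S(1) finV by (simp add: sum.Plus)
  have vmI: "vm (Inl C) = u C" for C by (simp add: vm_def)
  have sumE: "(\<Sum>w\<in>V. y w * vm (Inr w) v) = - y v" if "v \<in> V" for y :: "_ \<Rightarrow> real" and v
    using finV that by (simp add: vm_def if_distrib cong: if_cong)
  have N\<alpha>: "\<alpha> = p + (\<Sum>i\<in>?I. \<nu> i * vd i)"
  proof -
    have "(\<Sum>i\<in>?I. e i * vd i) = m / n * t"
      unfolding sumI tF by (simp add: e_def vd_def sum_distrib_left mult.assoc)
    then show ?thesis unfolding p_def \<nu>_def s_def by (simp add: left_diff_distrib sum_subtractf)
  qed
  have Nm: "m = q v + (\<Sum>i\<in>?I. \<nu> i * vm i v)" if "v \<in> V" for v
  proof -
    have "(\<Sum>i\<in>?I. e i * vm i v) = m / n * M v - m / n * (M v - n)"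
      unfolding sumI sumE[OF that] MF by (simp add: e_def vmI MF sum_distrib_left mult.assoc)
    also have "\<dots> = m" using n by (simp add: field_simps)
    finally show ?thesis unfolding q_def \<nu>_def by (simp add: left_diff_distrib sum_subtractf)
  qed
  define cl where "cl C = nat \<lceil>\<nu> (Inl C)\<rceil>" for C
  \<comment> \<open>The coefficient of each exceptional curve when \<open>Fm\<close> is read as a
    section of the class with multiplicities exactly \<open>m\<close>.\<close>
  define gE where "gE v = real (mult_at v Fm) - m" for v
  have gE0: "0 \<le> gE v" if "v \<in> V" for v
    using Fm(3)[OF that] Fm(2) by (simp add: gE_def mult_ge_iff_mult_at)
  \<comment> \<open>The negative part, rounded up, is contained in every section.\<close>
  define Pg where "Pg g \<longleftrightarrow> (\<forall>C. g C \<le> (if C \<in> S then cl C else 0)) \<and> (\<Prod>C\<in>S. C ^ g C) dvd Fm" for g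
  have "Pg (\<lambda>_. 0)" by (simp add: Pg_def)
  moreover have "(\<Sum>C\<in>S. g C) \<le> (\<Sum>C\<in>S. cl C)" if "Pg g" for g
  proof (rule sum_mono)
    fix C assume "C \<in> S"
    then show "g C \<le> cl C" using that unfolding Pg_def by (elim conjE) (erule allE[of _ C], simp)
  qed
  ultimately have "\<exists>g. Pg g \<and> (\<forall>h. Pg h \<longrightarrow> (\<Sum>C\<in>S. h C) \<le> (\<Sum>C\<in>S. g C))"
    by (intro ex_has_greatest_nat[of Pg "\<lambda>_. 0" "\<lambda>g. \<Sum>C\<in>S. g C" "Suc (\<Sum>C\<in>S. cl C)"]) (auto simp: less_Suc_eq_le)
  then obtain g where g: "Pg g" and gmax: "\<And>h. Pg h \<Longrightarrow> (\<Sum>C\<in>S. h C) \<le> (\<Sum>C\<in>S. g C)"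
    by (elim exE conjE) (rule that, assumption, erule allE, erule mp)
  obtain G where G: "Fm = (\<Prod>C\<in>S. C ^ g C) * G" using g by (auto simp: Pg_def)
  have prodnz: "(\<Prod>C\<in>S. C ^ h C) \<noteq> 0" for h using S(1) irr(3) by simp
  have G0: "G \<noteq> 0" using G Fm(2) by auto
  have formprod: "is_form (\<Sum>C\<in>S. h C * ord0 C) (\<Prod>C\<in>S. C ^ h C)" for h
    by (intro is_form_prod is_form_power irr)
  obtain p0' where formG: "is_form p0' G" and p0': "(\<Sum>C\<in>S. g C * ord0 C) + p0' = \<alpha>"
  proof -
    obtain b b' where "is_form b (\<Prod>C\<in>S. C ^ g C)" "is_form b' G" "b + b' = \<alpha>"
      using dvd_form_imp_form[OF Fm(1,2) G] .
    then show ?thesis using that is_form_unique[OF formprod _ prodnz] by blast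
  qed
  have multprod: "mult_at v (\<Prod>C\<in>S. C ^ h C) = (\<Sum>C\<in>S. h C * mult_at v C)" for h v
    using mult_at_factorization[OF S(1) irr(1) one_neq_zero, of _ h v] by simp
  have multG: "real (mult_at v G) = m + gE v - (\<Sum>C\<in>S. g C * u C v)" for v
    using mult_at_mult[OF prodnz G0, of v g] unfolding G[symmetric] multprod by (simp add: gE_def u_def)
  \<comment> \<open>If a maximal \<open>g\<close> stopped short at C, let w be the positive part of
    \<open>\<nu> - g'\<close>, where \<open>g'\<close> is what has been taken out of
    \<open>Fm\<close>. It is orthogonal to P and has nonzero degree, so w^2 < 0 and w is negative on
    some curve of its own support. There P vanishes and the subtracted part contributes nothing
    positive, so the class of \<open>G\<close> is negative on that curve. An exceptional curve is
    impossible, since multiplicities are nonnegative; a component D divides \<open>G\<close> by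
    Bezout and could be added to \<open>g\<close>.\<close>
  have ceil: "g C = cl C" if C: "C \<in> S" for C
  proof (rule ccontr)
    assume ne: "g C \<noteq> cl C"
    moreover have "g C \<le> cl C" using g C unfolding Pg_def by (elim conjE) (erule allE[of _ C], simp)
    ultimately have "g C < cl C" by simp
    then have gC: "g C < \<nu> (Inl C)" unfolding cl_def by linarith
    define g' where "g' = case_sum (\<lambda>C. real (g C)) gE"
    have g'0: "0 \<le> g' i" if "i \<in> ?I" for i using that gE0 by (auto simp: g'_def)
    define y where "y i = max 0 (\<nu> i - g' i)" for i
    define z where "z i = max 0 (g' i - \<nu> i)" for i
    have yz: "\<nu> i - g' i = y i - z i" for i by (auto simp: y_def z_def)
    define wd where "wd = (\<Sum>i\<in>?I. y i * vd i)"
    define wm where "wm v = (\<Sum>i\<in>?I. y i * vm i v)" for v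
    have y0: "0 \<le> y i" for i by (simp add: y_def)
    have dot_w: "dot V wd wm d' u' = (\<Sum>i\<in>?I. y i * dot V (vd i) (vm i) d' u')" for d' u'
      unfolding wd_def wm_def by (rule dot_sum)
    have "dot V wd wm p q = (\<Sum>i\<in>?I. y i * dot V (vd i) (vm i) p q)" by (rule dot_w)
    also have "\<dots> = 0"
    proof (rule sum.neutral, rule ballI)
      fix i assume i: "i \<in> ?I"
      show "y i * dot V (vd i) (vm i) p q = 0"
      proof (cases "y i = 0")
        case False
        then have "\<nu> i \<noteq> 0" using g'0[OF i] by (auto simp: y_def)
        then show ?thesis using orth[OF i] by (subst dot_commute) simp
      qed simp
    qed
    finally have "dot V p q wd wm = 0" by (subst dot_commute)
    moreover have "wd \<noteq> 0"
    proof -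
      have "0 < y (Inl C) * vd (Inl C)" using gC a_pos[OF C] by (simp add: y_def g'_def vd_def)
      also have "\<dots> \<le> wd" unfolding wd_def
        using finI C y0 by (intro member_le_sum) (auto simp: vd_def a_def)
      finally show ?thesis by simp
    qed
    ultimately have "dot V wd wm wd wm < 0" using hodge_index(2)[OF finV PP p0] by blast
    moreover have "dot V wd wm wd wm = (\<Sum>i\<in>?I. y i * dot V (vd i) (vm i) wd wm)"
      by (rule dot_w)
    ultimately have "\<not> 0 \<le> (\<Sum>i\<in>?I. y i * dot V (vd i) (vm i) wd wm)" by linarith
    then have "\<exists>i. i \<in> ?I \<and> y i * dot V (vd i) (vm i) wd wm < 0"
      using sum_nonneg[of ?I "\<lambda>i. y i * dot V (vd i) (vm i) wd wm"] by (meson not_le)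
    then obtain i where i: "i \<in> ?I" "y i * dot V (vd i) (vm i) wd wm < 0"
      by (elim exE conjE) (rule that)
    then have yi: "0 < y i" "dot V wd wm (vd i) (vm i) < 0"
      using y0[of i] unfolding dot_commute[of V wd] by (simp_all add: mult_less_0_iff)
    define Gm where "Gm v = real (mult_at v G)" for v
    have "dot V p0' Gm (vd i) (vm i) < 0"
    proof -
      have pd: "p0' = p + wd + (\<Sum>j\<in>?I. - z j * vd j)"
      proof -
        have "real p0' = \<alpha> - (\<Sum>C\<in>S. g C * a C)" using p0' by (simp add: a_def flip: p0')
        also have "(\<Sum>C\<in>S. g C * a C) = (\<Sum>j\<in>?I. g' j * vd j)" unfolding sumI by (simp add: g'_def vd_def)
        also have "\<alpha> - \<dots> = p + (\<Sum>j\<in>?I. (\<nu> j - g' j) * vd j)"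
          unfolding N\<alpha> by (simp add: left_diff_distrib sum_subtractf)
        finally show ?thesis unfolding yz wd_def by (simp add: left_diff_distrib sum_subtractf sum_negf)
      qed
      have pm: "Gm v = q v + wm v + (\<Sum>j\<in>?I. - z j * vm j v)" if v: "v \<in> V" for v
      proof -
        have "Gm v = m - ((\<Sum>C\<in>S. g C * u C v) - gE v)" unfolding Gm_def multG by simp
        also have "(\<Sum>C\<in>S. g C * u C v) - gE v = (\<Sum>j\<in>?I. g' j * vm j v)"
          unfolding sumI using sumE[OF v, of gE] by (simp add: g'_def vmI)
        also have "m - \<dots> = q v + (\<Sum>j\<in>?I. (\<nu> j - g' j) * vm j v)"
          unfolding Nm[OF v] by (simp add: left_diff_distrib sum_subtractf)
        finally show ?thesis unfolding yz wm_def by (simp add: left_diff_distrib sum_subtractf sum_negf)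
      qed
      have "dot V p0' Gm (vd i) (vm i) = dot V (p + wd + (\<Sum>j\<in>?I. - z j * vd j))
          (\<lambda>v. q v + wm v + (\<Sum>j\<in>?I. - z j * vm j v)) (vd i) (vm i)"
        unfolding pd dot_def using pm by simp
      also have "\<dots> = dot V p q (vd i) (vm i) + dot V wd wm (vd i) (vm i) + (\<Sum>j\<in>?I. - z j * B j i)"
        unfolding dot_add dot_sum B_def ..
      also have "dot V p q (vd i) (vm i) = 0"
        using yi(1) g'0[OF i(1)] by (intro orth[OF i(1)]) (auto simp: y_def)
      also have "(\<Sum>j\<in>?I. - z j * B j i) \<le> 0"
      proof (rule sum_nonpos)
        fix j assume j: "j \<in> ?I"
        show "- z j * B j i \<le> 0"
        proof (cases "j = i")
          case True
          then have "z j = 0" using yi(1) by (auto simp: y_def z_def)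
          then show ?thesis by simp
        next
          case False
          then have "0 \<le> z j * B j i" using B_off[OF i(1) j] by (simp add: z_def)
          then show ?thesis by simp
        qed
      qed
      finally show ?thesis using yi(2) by linarith
    qed
    then have neg: "dot V p0' Gm (vd i) (vm i) < 0" .
    show False
    proof (cases i)
      case (Inr w)
      then show False using neg i(1) by (auto simp: vd_def vm_def dotE Gm_def)
    next
      case (Inl D)
      then have D: "D \<in> S" using i(1) by auto
      have "real (ord0 D * p0') < real (\<Sum>v\<in>V. mult_at v D * mult_at v G)"
        using neg Inl by (simp add: vd_def vm_def dot_def Gm_def a_def u_def mult.commute)
      then have "D dvd G"
        unfolding of_nat_less_iff by (rule bezout_dvd[OF irr(1,2)[OF D] formG V])
      then obtain G' where G': "G = D * G'" by blast
      let ?h = "g(D := Suc (g D))"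
      have "(\<Prod>C\<in>S. C ^ ?h C) = D * (\<Prod>C\<in>S. C ^ g C)"
        using S(1) D by (simp add: prod.remove[of S D] mult.assoc)
      then have "Fm = (\<Prod>C\<in>S. C ^ ?h C) * G'" unfolding G G' by (simp add: ac_simps)
      then have dvd: "(\<Prod>C\<in>S. C ^ ?h C) dvd Fm" by (rule dvdI)
      have "real (g D) < \<nu> (Inl D)" using yi(1) Inl by (simp add: y_def g'_def)
      then have less: "Suc (g D) \<le> cl D" unfolding cl_def by linarith
      have "Pg ?h" unfolding Pg_def
      proof (intro conjI allI dvd)
        fix C
        have "g C \<le> (if C \<in> S then cl C else 0)" using g unfolding Pg_def by (elim conjE allE)
        then show "?h C \<le> (if C \<in> S then cl C else 0)" using less D by (cases "C = D") simp_all
      qed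
      then have "(\<Sum>C\<in>S. ?h C) \<le> (\<Sum>C\<in>S. g C)" by (rule gmax)
      moreover have "(\<Sum>C\<in>S. ?h C) = Suc (\<Sum>C\<in>S. g C)"
        using S(1) D by (simp add: sum.remove[of S D])
      ultimately show False by simp
    qed
  qed
  \<comment> \<open>The fractional excess created by rounding up; it is supported on curves
    orthogonal to P.\<close>
  define \<phi> where "\<phi> C = g C - \<nu> (Inl C)" for C
  have \<phi>: "0 \<le> \<phi> C \<and> \<phi> C \<le> 1" if "C \<in> S" for C
  proof -
    have "0 \<le> \<nu> (Inl C)" using \<nu>0[OF InlI, OF that] .
    then have "real (cl C) = of_int \<lceil>\<nu> (Inl C)\<rceil>" by (simp add: cl_def)
    then show ?thesis using ceil[OF that] unfolding \<phi>_def by linarith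
  qed
  have \<phi>\<nu>: "\<nu> (Inl C) \<noteq> 0" if "C \<in> S" "\<phi> C \<noteq> 0" for C
    using that ceil[OF that(1)] by (auto simp: \<phi>_def cl_def)
  define d where "d = (\<Sum>C\<in>S. \<phi> C * a C)"
  define \<phi>v where "\<phi>v v = (\<Sum>C\<in>S. \<phi> C * u C v)" for v
  \<comment> \<open>Where \<open>q v\<close> is 0, the removed components already have multiplicity
    at least \<open>m\<close>, so only these points enter the count.\<close>
  define Z1 where "Z1 = {v \<in> V. q v \<noteq> 0}"
  have Z1: "Z1 \<subseteq> V" "finite Z1" using finV by (auto simp: Z1_def)
  have dotZ1: "dot Z1 p q d' u' = dot V p q d' u'" for d' u'
    unfolding dot_def Z1_def using finV by (subst sum.mono_neutral_left[of V "{v \<in> V. q v \<noteq> 0}"]) auto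
  have p0d: "real p0' = p - d"
  proof -
    have "real p0' = \<alpha> - (\<Sum>C\<in>S. g C * a C)" by (simp add: a_def flip: p0')
    also have "\<alpha> = p + (\<Sum>C\<in>S. \<nu> (Inl C) * a C)" unfolding N\<alpha> sumI by (simp add: vd_def)
    finally show ?thesis by (simp add: d_def \<phi>_def left_diff_distrib sum_subtractf)
  qed
  \<comment> \<open>Truncated subtraction is intended: where the removed part already has
    multiplicity at least \<open>m\<close>, nothing is left to impose.\<close>
  define \<mu> where "\<mu> v = m - (\<Sum>C\<in>S. g C * mult_at v C)" for v
  have mg: "real m - (\<Sum>C\<in>S. g C * u C v) = q v - \<nu> (Inr v) - \<phi>v v" if "v \<in> V" for v
    unfolding Nm[OF that] sumI using sumE[OF that, of "\<lambda>w. \<nu> (Inr w)"]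
    by (simp add: vmI \<phi>v_def \<phi>_def left_diff_distrib sum_subtractf)
  have \<mu>le: "real (\<mu> v) * (real (\<mu> v) + 1) \<le> (if v \<in> Z1 then (q v - \<phi>v v) * (q v - \<phi>v v + 1) else 0)" if v: "v \<in> V" for v
  proof (cases "v \<in> Z1")
    case True
    then have "\<nu> (Inr v) = 0" using qE[OF v] by (auto simp: Z1_def)
    then have eq: "q v - \<phi>v v = real m - real (\<Sum>C\<in>S. g C * mult_at v C)"
      using mg[OF v] by (simp add: u_def)
    have "real (\<mu> v) = q v - \<phi>v v \<or> \<mu> v = 0 \<and> (\<exists>k::int. q v - \<phi>v v = of_int k)"
    proof (cases "(\<Sum>C\<in>S. g C * mult_at v C) \<le> m")
      case False
      then show ?thesis unfolding eq \<mu>_def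
        by (intro disjI2 conjI exI[of _ "int m - int (\<Sum>C\<in>S. g C * mult_at v C)"]) auto
    qed (simp add: eq \<mu>_def of_nat_diff)
    then show ?thesis using True by (simp add: triangle_le_real)
  next
    case False
    then have "q v = 0" using v by (simp add: Z1_def)
    moreover have "0 \<le> \<phi>v v" unfolding \<phi>v_def using \<phi> u0 by (intro sum_nonneg mult_nonneg_nonneg) auto
    moreover have "0 \<le> \<nu> (Inr v)" using \<nu>0[OF InrI, OF v] .
    ultimately have "real m \<le> real (\<Sum>C\<in>S. g C * mult_at v C)" using mg[OF v] by (simp add: u_def)
    then have "m \<le> (\<Sum>C\<in>S. g C * mult_at v C)" by (simp only: of_nat_le_iff)
    then have "\<mu> v = 0" by (simp add: \<mu>_def)
    then show ?thesis using False by simp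
  qed
  \<comment> \<open>Otherwise a form of degree \<open>p0' - 1\<close> with multiplicities
    \<open>\<mu> v\<close> would exist, and multiplied by the removed components it would have
    multiplicity \<open>m\<close> in degree \<open>\<alpha> - 1\<close>.\<close>
  have count: "p0' * (p0' + 1) \<le> (\<Sum>v\<in>V. \<mu> v * (\<mu> v + 1))"
  proof (cases p0')
    case (Suc k)
    show ?thesis
    proof (rule ccontr)
      assume "\<not> ?thesis"
      then have "(\<Sum>v\<in>V. \<mu> v * (\<mu> v + 1)) < (k + 1) * (k + 2)" using Suc by simp
      then have "\<exists>H :: 'k poly3. H \<noteq> 0 \<and> is_form k H \<and> (\<forall>v\<in>V. mult_ge v (\<mu> v) H)"
        by (intro exists_form_mult_ge[OF finV, of \<mu> k] V0)
      then obtain H :: "'k poly3" where H: "H \<noteq> 0" "is_form k H" "\<forall>v\<in>V. mult_ge v (\<mu> v) H"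
        by (elim exE conjE) (rule that)
      let ?K = "(\<Prod>C\<in>S. C ^ g C) * H"
      have "is_form ((\<Sum>C\<in>S. g C * ord0 C) + k) ?K" by (rule is_form_mult[OF formprod H(2)])
      moreover have "?K \<noteq> 0" using prodnz H(1) by simp
      moreover have "mult_ge v m ?K" if "v \<in> V" for v
      proof -
        have "mult_ge v ((\<Sum>C\<in>S. g C * mult_at v C) + \<mu> v) ?K"
          using mult_ge_mult[OF mult_ge_mult_at H(3)[rule_format, OF that], of "\<Prod>C\<in>S. C ^ g C"] unfolding multprod .
        then show ?thesis by (rule mult_ge_mono) (simp add: \<mu>_def)
      qed
      ultimately have "\<alpha> \<le> (\<Sum>C\<in>S. g C * ord0 C) + k" by (rule least)
      then show False using p0' Suc by simp
    qed
  qed simp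
  have count': "(p - d) * (p - d + 1) \<le> (\<Sum>v\<in>Z1. (q v - \<phi>v v) * (q v - \<phi>v v + 1))"
  proof -
    have "real (p0' * (p0' + 1)) \<le> real (\<Sum>v\<in>V. \<mu> v * (\<mu> v + 1))" using count by (rule of_nat_mono)
    also have "\<dots> = (\<Sum>v\<in>V. real (\<mu> v) * (real (\<mu> v) + 1))" by (simp add: algebra_simps)
    also have "\<dots> \<le> (\<Sum>v\<in>V. if v \<in> Z1 then (q v - \<phi>v v) * (q v - \<phi>v v + 1) else 0)"
      by (rule sum_mono) (rule \<mu>le)
    also have "\<dots> = (\<Sum>v\<in>Z1. (q v - \<phi>v v) * (q v - \<phi>v v + 1))"
      using finV Z1(1) by (simp add: sum.If_cases Int_absorb1)
    finally have "real p0' * (real p0' + 1) \<le> (\<Sum>v\<in>Z1. (q v - \<phi>v v) * (q v - \<phi>v v + 1))"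
      by (simp add: algebra_simps)
    then show ?thesis unfolding p0d .
  qed
  have orth\<phi>: "dot Z1 p q d \<phi>v = 0"
  proof -
    have "dot V d \<phi>v p q = (\<Sum>C\<in>S. \<phi> C * dot V (a C) (u C) p q)"
      unfolding d_def \<phi>v_def by (rule dot_sum)
    also have "\<dots> = 0"
    proof (rule sum.neutral, rule ballI)
      fix C assume "C \<in> S"
      then show "\<phi> C * dot V (a C) (u C) p q = 0"
        using \<phi>\<nu>[of C] orth[OF InlI, of C] by (cases "\<phi> C = 0") (auto simp: vd_def vm_def dot_commute)
    qed
    finally show ?thesis unfolding dotZ1 by (subst dot_commute)
  qed
  have \<phi>\<phi>: "d - (\<Sum>v\<in>Z1. \<phi>v v) \<le> dot Z1 d \<phi>v d \<phi>v"
    unfolding d_def \<phi>v_def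
  proof (rule fractional_polar_bound[OF S(1) \<phi>])
    fix C assume C: "C \<in> S" "\<phi> C \<noteq> 0"
    have "dot Z1 p q (a C) (u C) = 0"
      using orth[OF InlI, OF C(1) \<phi>\<nu>[OF C]] unfolding dotZ1 by (simp add: vd_def vm_def)
    then show "dot Z1 (a C) (u C) (a C) (u C) \<le> 0"
      using hodge_index(1)[OF Z1(2), of p q] PP p0 unfolding dotZ1 by blast
  qed (use bez polar Z1 in auto)
  \<comment> \<open>Expanded, the count says P^2 + (p - sum q) - 2 P.\<phi> + (\<phi>^2 - (d - sum
    \<phi>)) <= 0. The term P.\<phi> is zero by orthogonality and the last bracket is nonnegative by
    the polar bound.\<close>
  have key: "p * p + p \<le> (\<Sum>v\<in>Z1. q v * q v + q v)"
  proof -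
    have "(\<Sum>v\<in>Z1. (q v - \<phi>v v) * (q v - \<phi>v v + 1)) = (\<Sum>v\<in>Z1. q v * q v + q v) - 2 * (\<Sum>v\<in>Z1. q v * \<phi>v v)
        + (\<Sum>v\<in>Z1. \<phi>v v * \<phi>v v) - (\<Sum>v\<in>Z1. \<phi>v v)"
      by (simp add: algebra_simps sum.distrib sum_subtractf sum_distrib_left)
    moreover have "(p - d) * (p - d + 1) = p * p + p - 2 * (p * d) + d * d - d" by (simp add: algebra_simps)
    ultimately show ?thesis using count' \<phi>\<phi> orth\<phi> unfolding dot_def by linarith
  qed
  have key': "p * p + p \<le> (\<Sum>v\<in>V. q v * q v) + (\<Sum>v\<in>V. q v)"
  proof -
    have "(\<Sum>v\<in>Z1. q v * q v + q v) = (\<Sum>v\<in>V. q v * q v + q v)"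
      unfolding Z1_def using finV by (intro sum.mono_neutral_left) auto
    then show ?thesis using key by (simp add: sum.distrib)
  qed
  have PN: "p * \<alpha> - m * (\<Sum>v\<in>V. q v) = p * p - (\<Sum>v\<in>V. q v * q v)"
  proof -
    have "p * \<alpha> - m * (\<Sum>v\<in>V. q v) = dot V \<alpha> (\<lambda>v. m) p q"
      by (simp add: dot_def mult.commute sum_distrib_left)
    also have "\<dots> = dot V (p + (\<Sum>i\<in>?I. \<nu> i * vd i)) (\<lambda>v. q v + (\<Sum>i\<in>?I. \<nu> i * vm i v)) p q"
      unfolding dot_def N\<alpha>[symmetric] using Nm by simp
    also have "\<dots> = dot V p q p q + (\<Sum>i\<in>?I. \<nu> i * dot V (vd i) (vm i) p q)"
      unfolding dot_add dot_sum ..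
    also have "(\<Sum>i\<in>?I. \<nu> i * dot V (vd i) (vm i) p q) = 0"
    proof (rule sum.neutral, rule ballI)
      fix i assume "i \<in> ?I"
      then show "\<nu> i * dot V (vd i) (vm i) p q = 0"
        using orth[of i] by (cases "\<nu> i = 0") (auto simp: dot_commute)
    qed
    finally show ?thesis by (simp add: dot_def)
  qed
  have PF: "n * (\<Sum>v\<in>V. q v) \<le> p * t"
  proof -
    have "0 \<le> (\<Sum>C\<in>S. f C * dot V (a C) (u C) p q)"
    proof (rule sum_nonneg)
      fix C assume "C \<in> S"
      then show "0 \<le> f C * dot V (a C) (u C) p q"
        using nef[OF InlI, of C] by (simp add: vd_def vm_def dot_commute)
    qed
    also have "\<dots> = dot V t M p q"
      unfolding tF MF[abs_def] by (rule dot_sum[symmetric])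
    finally have "(\<Sum>v\<in>V. M v * q v) \<le> p * t" by (simp add: dot_def mult.commute)
    moreover have "(\<Sum>v\<in>V. n * q v) \<le> (\<Sum>v\<in>V. M v * q v)"
      using Mn q0 by (intro sum_mono mult_right_mono) auto
    ultimately show ?thesis by (simp add: sum_distrib_left)
  qed
  \<comment> \<open>The nef part pairs with the whole class as with itself, so P^2 may be replaced
    by \<open>p * \<alpha> - m * (\<Sum>v\<in>V. q v)\<close>. Pairing P with \<open>F\<close> then
    bounds the sum of the \<open>q v\<close> through \<open>PF\<close>.\<close>
  have "p * (\<alpha> + 1) \<le> (m + 1) * (\<Sum>v\<in>V. q v)" using key' PN by (simp add: algebra_simps)
  then have "p * (\<alpha> + 1) * n \<le> (m + 1) * (\<Sum>v\<in>V. q v) * n" by (rule mult_right_mono) simp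
  also have "\<dots> = (m + 1) * (n * (\<Sum>v\<in>V. q v))" by (simp add: ac_simps)
  also have "\<dots> \<le> (m + 1) * (p * t)" by (rule mult_left_mono[OF PF]) simp
  finally have "p * (real (\<alpha> + 1) * real n) \<le> p * (real (m + 1) * real t)" by (simp only: ac_simps)
  then have "real (\<alpha> + 1) * real n \<le> real (m + 1) * real t" using p0 by (rule mult_left_le_imp_le)
  then have "real ((\<alpha> + 1) * n) \<le> real ((m + 1) * t)" by (simp only: of_nat_mult)
  then show ?thesis by (simp only: of_nat_le_iff)
qed

subsection \<open>Initial degrees in terms of coordinate vectors\<close>

definition has_form :: "('k::field ^ 3) set \<Rightarrow> nat \<Rightarrow> nat \<Rightarrow> bool" where
  "has_form V m d \<longleftrightarrow> (\<exists>F. F \<noteq> 0 \<and> is_form d F \<and> (\<forall>v\<in>V. mult_ge v m F))"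

definition alpha :: "('k::field ^ 3) set \<Rightarrow> nat \<Rightarrow> nat" where
  "alpha V m = (LEAST d. has_form V m d)"

lemma represents_abs: "v \<noteq> 0 \<Longrightarrow> represents v (abs_proj_plane v)"
  by (simp add: represents_def)

lemma initial_degree_symbolic_power:
  assumes "\<And>v. v \<in> V \<Longrightarrow> v \<noteq> 0"
  shows "initial_degree (symbolic_power (abs_proj_plane ` V) m) = alpha V m"
proof -
  have "F \<in> symbolic_power (abs_proj_plane ` V) m \<longleftrightarrow> (\<forall>v\<in>V. mult_ge v m F)" if "is_form d F" for F d
    using ideal_power_iff_mult_ge[OF represents_abs[OF assms] that] by (simp add: symbolic_power_def)
  then have "(\<exists>F\<in>symbolic_power (abs_proj_plane ` V) m. F \<noteq> 0 \<and> is_form d F) \<longleftrightarrow> has_form V m d" for d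
    unfolding has_form_def Bex_def by (intro ex_cong1) (simp cong: conj_cong, metis)
  then show ?thesis unfolding initial_degree_def alpha_def by simp
qed

text \<open>Kept apart from the symbolic power with exponent 1, because \<open>radical_ideal\<close>
  intersects the point ideals themselves and not their products with the unit ideal.\<close>

lemma initial_degree_radical_ideal:
  assumes "\<And>v. v \<in> V \<Longrightarrow> v \<noteq> 0"
  shows "initial_degree (radical_ideal (abs_proj_plane ` V)) = alpha V (Suc 0)"
proof -
  have pt: "F \<in> point_ideal (abs_proj_plane v) \<longleftrightarrow> mult_ge v (Suc 0) F" if "is_form d F" "v \<in> V" for F d v
  proof
    show "F \<in> point_ideal (abs_proj_plane v) \<Longrightarrow> mult_ge v (Suc 0) F"
      by (rule point_ideal_vanishes[OF represents_abs[OF assms[OF that(2)]]])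
    assume "mult_ge v (Suc 0) F"
    then have "vanishes_at F (abs_proj_plane v)"
      using vanishes_at_iff[OF represents_abs[OF assms[OF that(2)]] that(1)] by (simp add: mult_ge_1_iff)
    then show "F \<in> point_ideal (abs_proj_plane v)"
      unfolding point_ideal_def using that(1) by (intro ring_ideal.span_base) auto
  qed
  then have "F \<in> radical_ideal (abs_proj_plane ` V) \<longleftrightarrow> (\<forall>v\<in>V. mult_ge v (Suc 0) F)" if "is_form d F" for F d
    using that by (simp add: radical_ideal_def)
  then have "(\<exists>F\<in>radical_ideal (abs_proj_plane ` V). F \<noteq> 0 \<and> is_form d F) \<longleftrightarrow> has_form V (Suc 0) d" for d
    unfolding has_form_def Bex_def by (intro ex_cong1) (simp cong: conj_cong, metis)
  then show ?thesis unfolding initial_degree_def alpha_def by simp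
qed

lemma has_form_imp_plane_curve:
  assumes "\<And>v. v \<in> V \<Longrightarrow> v \<noteq> 0" "has_form V (Suc 0) d"
  shows "\<exists>C. plane_curve d C \<and> abs_proj_plane ` V \<subseteq> C"
proof -
  obtain F where F: "F \<noteq> 0" "is_form d F" "\<forall>v\<in>V. mult_ge v (Suc 0) F"
    using assms(2) unfolding has_form_def by (elim exE conjE) (rule that)
  have "vanishes_at F (abs_proj_plane v)" if "v \<in> V" for v
    using vanishes_at_iff[OF represents_abs[OF assms(1)[OF that]] F(2)] F(3) that by (simp add: mult_ge_1_iff)
  then show ?thesis using F by (intro exI[of _ "{P. vanishes_at F P}"]) (auto simp: plane_curve_def)
qed

lemma coordinate_vectors:
  assumes "finite Z"
  shows "\<exists>V. distinct_points V \<and> abs_proj_plane ` V = Z"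
proof (intro exI conjI)
  let ?V = "rep_proj_plane ` Z"
  have rep: "abs_proj_plane (rep_proj_plane P) = P" "proj_equiv (rep_proj_plane P) (rep_proj_plane P)" for P :: "'a proj_plane"
    using Quotient3_abs_rep[OF Quotient3_proj_plane] Quotient3_rep_reflp[OF Quotient3_proj_plane] by auto
  then show "abs_proj_plane ` ?V = Z" by (simp add: image_image)
  have nz: "rep_proj_plane P \<noteq> 0" for P :: "'a proj_plane" using rep(2)[of P] by (simp add: proj_equiv_def)
  have False if "rep_proj_plane P \<noteq> rep_proj_plane Q" "rep_proj_plane P = c *s rep_proj_plane Q" for P Q :: "'a proj_plane" and c
  proof -
    have "c \<noteq> 0" using that(2) nz[of P] by auto
    then have "proj_equiv (rep_proj_plane Q) (rep_proj_plane P)"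
      unfolding proj_equiv_def using nz that(2) by (intro conjI exI[of _ c])
    then have "abs_proj_plane (rep_proj_plane Q) = abs_proj_plane (rep_proj_plane P)"
      by (rule Quotient3_rel_abs[OF Quotient3_proj_plane])
    then show False using rep(1) that(1) by simp
  qed
  then show "distinct_points ?V"
    unfolding distinct_points_def using assms nz by auto
qed

lemma has_form_alpha:
  assumes "distinct_points V"
  shows "has_form V m (alpha V m)"
proof -
  have fin: "finite V" and nz: "\<And>v. v \<in> V \<Longrightarrow> v \<noteq> 0" using assms by (auto simp: distinct_points_def)
  \<comment> \<open>A crude degree suffices: D < (D + 1)(D + 2) for every D.\<close>
  let ?d = "\<Sum>v\<in>V. m * (m + 1)"
  have "has_form V m ?d"
    unfolding has_form_def by (intro exists_form_mult_ge[OF fin, of "\<lambda>_. m"] nz) auto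
  then show ?thesis unfolding alpha_def by (rule LeastI)
qed

lemma alpha_le: "has_form V m d \<Longrightarrow> alpha V m \<le> d"
  unfolding alpha_def by (rule Least_le)

lemma alpha_empty: "alpha {} m = 0"
  using alpha_le[of "{}" m 0] unfolding has_form_def by (metis empty_iff is_form_1 le_zero_eq zero_neq_one)

lemma has_form_le_degree: "has_form V m d \<Longrightarrow> v \<in> V \<Longrightarrow> v \<noteq> 0 \<Longrightarrow> m \<le> d"
  unfolding has_form_def using mult_ge_le_degree by blast

lemma has_form_few_points:
  assumes "distinct_points V" "2 * card V < (d + 1) * (d + 2)"
  shows "has_form V (Suc 0) d"
  using assms exists_form_mult_ge[of V "\<lambda>_. Suc 0" d] unfolding has_form_def distinct_points_def
  by (simp add: mult.commute)

lemma initial_degree_growth_alpha: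
  fixes V :: "('k::field_char_0 ^ 3) set"
  assumes V: "distinct_points V" and n: "0 < n" and less: "alpha V n * m < alpha V m * n"
  shows "(alpha V m + 1) * n \<le> (m + 1) * alpha V n"
proof -
  obtain F where F: "F \<noteq> 0" "is_form (alpha V n) F" "\<forall>v\<in>V. mult_ge v n F"
    using has_form_alpha[OF V, of n] unfolding has_form_def by (elim exE conjE) (rule that)
  obtain G where G: "G \<noteq> 0" "is_form (alpha V m) G" "\<forall>v\<in>V. mult_ge v m G"
    using has_form_alpha[OF V, of m] unfolding has_form_def by (elim exE conjE) (rule that)
  show ?thesis
  proof (rule initial_degree_growth[OF V F(2,1) _ G(2,1) _ _ n less])
    show "alpha V m \<le> d" if "is_form d H" "H \<noteq> 0" "\<And>v. v \<in> V \<Longrightarrow> mult_ge v m H" for d H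
      using that by (intro alpha_le) (auto simp: has_form_def)
  qed (use F(3) G(3) in auto)
qed

subsection \<open>Lines and conics\<close>

definition is_line :: "'k::field poly3 \<Rightarrow> bool" where
  "is_line L \<longleftrightarrow> L \<noteq> 0 \<and> is_form (Suc 0) L"

lemma irreducible_line: "is_line L \<Longrightarrow> irreducible L"
  unfolding is_line_def using irreducible_linear_form by blast

lemma one_le_mult_at_iff: "F \<noteq> 0 \<Longrightarrow> Suc 0 \<le> mult_at v F \<longleftrightarrow> poly3_eval F v = 0"
  using mult_ge_iff_mult_at[of F v "Suc 0"] by (simp add: mult_ge_1_iff)

lemma mult_at_line:
  assumes "is_line L" "v \<noteq> 0"
  shows "mult_at v L = (if poly3_eval L v = 0 then 1 else 0)"
  using assms one_le_mult_at_iff[of L v] mult_at_le_degree[of v "Suc 0" L]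
  by (auto simp: is_line_def not_less_eq_eq)

lemma distinct_points_pair: "distinct_points V \<Longrightarrow> u \<in> V \<Longrightarrow> v \<in> V \<Longrightarrow> distinct_points {u, v}"
  by (erule distinct_points_subset) auto

lemma exists_line:
  assumes "distinct_points V" "u \<in> V" "v \<in> V"
  shows "\<exists>L. is_line L \<and> poly3_eval L u = 0 \<and> poly3_eval L v = 0"
proof -
  have "card {u, v} \<le> 2" by (rule card_insert_le_m1) auto
  then have "has_form {u, v} (Suc 0) (Suc 0)"
    by (intro has_form_few_points distinct_points_pair[OF assms]) simp
  then show ?thesis by (auto simp: has_form_def is_line_def mult_ge_1_iff)
qed

text \<open>Bezout with a line, whose multiplicity at each of its points is 1; \<open>k\<close>
  prescribes lower bounds for the multiplicities of \<open>G\<close>.\<close>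

lemma line_dvd:
  assumes "distinct_points V" "W \<subseteq> V" "is_line L" "is_form d G"
    and "\<And>v. v \<in> W \<Longrightarrow> poly3_eval L v = 0 \<and> mult_ge v (k v) G" "d < (\<Sum>v\<in>W. k v)"
  shows "L dvd G"
proof (cases "G = 0")
  case False
  have W: "distinct_points W" by (rule distinct_points_subset[OF assms(1,2)])
  have "(\<Sum>v\<in>W. k v) \<le> (\<Sum>v\<in>W. mult_at v L * mult_at v G)"
  proof (rule sum_mono)
    fix v assume v: "v \<in> W"
    then have "v \<noteq> 0" using W by (auto simp: distinct_points_def)
    then show "k v \<le> mult_at v L * mult_at v G"
      using assms(5)[OF v] False mult_at_line[OF assms(3)] by (simp add: mult_ge_iff_mult_at)
  qed
  then have "Suc 0 * d < (\<Sum>v\<in>W. mult_at v L * mult_at v G)" using assms(6) by simp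
  then show ?thesis
    using assms(3) bezout_dvd[OF irreducible_line[OF assms(3)] _ assms(4) W] by (auto simp: is_line_def)
qed simp

lemma line_unique:
  assumes "distinct_points V" "u \<in> V" "v \<in> V" "u \<noteq> v" "is_line L" "is_line M"
    and "poly3_eval L u = 0" "poly3_eval L v = 0" "poly3_eval M u = 0" "poly3_eval M v = 0"
  shows "L dvd M"
  using assms line_dvd[of V "{u, v}" L "Suc 0" M "\<lambda>_. Suc 0"]
  by (auto simp: mult_ge_1_iff is_line_def)

lemma dvd_imp_vanishes: "L dvd M \<Longrightarrow> poly3_eval L v = 0 \<Longrightarrow> poly3_eval M v = 0"
  by (elim dvdE) (simp add: eval.hom_mult)

lemma irreducible_factor_degree:
  assumes "irreducible C" "is_form a C" "is_form b D" "irreducible D" "C dvd (D :: 'k::field poly3)"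
  shows "a = b"
proof -
  obtain u where u: "u \<noteq> 0" "C = const u * D"
    using irreducible_dvd_irreducible[OF assms(1,4,5)] .
  then show ?thesis
    using is_form_unique[OF assms(2), of b] is_form_const_mult[OF assms(3), of u] assms(1) by auto
qed

lemma irreducible_dvd_sym:
  assumes "irreducible C" "irreducible D" "C dvd D"
  shows "D dvd (C :: 'k::field poly3)"
  using irreducible_dvd_irreducible[OF assms] by (metis dvd_triv_right)

text \<open>If \<open>u\<close> were a double point, the line through \<open>u\<close> and
  \<open>v\<close> would meet the conic with multiplicity 2 + 1 > 2 and split off.\<close>

lemma mult_at_conic:
  assumes V: "distinct_points V" "u \<in> V" "v \<in> V" "u \<noteq> v" and K: "irreducible K" "is_form 2 K"
    and on: "poly3_eval K u = 0" "poly3_eval K v = 0"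
  shows "mult_at u K = 1"
proof (rule ccontr)
  assume *: "mult_at u K \<noteq> 1"
  have K0: "K \<noteq> 0" using K(1) by auto
  have "mult_at u K \<ge> 1" using one_le_mult_at_iff[OF K0, of u] on by simp
  then have 2: "mult_ge u 2 K" using * K0 by (simp add: mult_ge_iff_mult_at)
  obtain L where L: "is_line L" "poly3_eval L u = 0" "poly3_eval L v = 0"
    using exists_line[OF V(1-3)] by (elim exE conjE) (rule that)
  have "L dvd K"
    by (rule line_dvd[OF V(1) _ L(1) K(2), of "{u, v}" "\<lambda>w. if w = u then 2 else 1"])
       (use V L on 2 in \<open>auto simp: mult_ge_1_iff\<close>)
  then have "Suc 0 = 2"
    using L(1) by (intro irreducible_factor_degree[OF irreducible_line[OF L(1)] _ K(2,1)]) (auto simp: is_line_def)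
  then show False by simp
qed

text \<open>A pair of lines would cover at most 2 + 2 of the five points.\<close>

lemma irreducible_conic:
  assumes K: "K \<noteq> 0" "is_form 2 K" and V: "\<And>v. v \<in> V \<Longrightarrow> poly3_eval K v = 0" "card V = 5" "finite V"
    and no3: "\<And>L W. is_line L \<Longrightarrow> W \<subseteq> V \<Longrightarrow> card W = 3 \<Longrightarrow> \<exists>v\<in>W. poly3_eval L v \<noteq> 0"
  shows "irreducible (K :: 'k::field poly3)"
proof (rule irreducibleI)
  show "K \<noteq> 0" by fact
  show "\<not> K dvd 1"
  proof
    assume "K dvd 1"
    then obtain c where c: "K = const c" "c \<noteq> 0" by (rule unit_imp_const)
    then show False using is_form_unique[OF K(2) _ K(1), of 0] by simp
  qed
  fix A B assume AB: "K = A * B"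
  then have nz: "A \<noteq> 0" "B \<noteq> 0" using K(1) by auto
  obtain a b where ab: "is_form a A" "is_form b B" "a + b = 2"
    using dvd_form_imp_form[OF K(2,1) AB] .
  have "\<not> (a = 1 \<and> b = 1)"
  proof
    assume "a = 1 \<and> b = 1"
    then have l: "is_line A" "is_line B" using ab nz by (auto simp: is_line_def)
    let ?f = "\<lambda>F. {v \<in> V. poly3_eval F v = 0}"
    have small: "card (?f L) < 3" if "is_line L" for L
    proof (rule ccontr)
      assume "\<not> card (?f L) < 3"
      then obtain W where W: "W \<subseteq> ?f L" "card W = 3" using obtain_subset_with_card_n[of 3 "?f L"] by auto
      then show False using no3[OF that, of W] by auto
    qed
    have "V \<subseteq> ?f A \<union> ?f B" using V(1) unfolding AB by (auto simp: eval.hom_mult)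
    then have "card V \<le> card (?f A \<union> ?f B)" by (rule card_mono[rotated]) (use V(3) in simp)
    also have "\<dots> \<le> card (?f A) + card (?f B)" by (rule card_Un_le)
    finally show False using small[OF l(1)] small[OF l(2)] unfolding V(2) by linarith
  qed
  then have "a = 0 \<or> b = 0" using ab(3) by auto
  then show "A dvd 1 \<or> B dvd 1" using form_degree_0_unit ab nz by blast
qed

section \<open>Splitting prescribed components off a form\<close>

lemma extract_factors:
  assumes "finite S" "\<And>C. C \<in> S \<Longrightarrow> irreducible C" "is_form t F" "(F :: 'k::field poly3) \<noteq> 0"
  shows "\<exists>x G. F = (\<Prod>C\<in>S. C ^ x C) * G \<and> (\<forall>C\<in>S. \<not> C dvd G)"
  using assms(1,2)
proof (induction rule: finite_induct)
  case empty
  show ?case by (intro exI[of _ "\<lambda>_. 0"] exI[of _ F]) simp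
next
  case (insert C S)
  have "\<exists>x G. F = (\<Prod>C\<in>S. C ^ x C) * G \<and> (\<forall>C\<in>S. \<not> C dvd G)"
    using insert.prems by (intro insert.IH) auto
  then obtain x G where G: "F = (\<Prod>C\<in>S. C ^ x C) * G" "\<forall>C\<in>S. \<not> C dvd G" by (elim exE conjE) (rule that)
  obtain b g where "is_form g G" using dvd_form_imp_form[OF assms(3,4) G(1)] .
  moreover have "G \<noteq> 0" using G(1) assms(4) by auto
  ultimately obtain k H where H: "G = C ^ k * H" "\<not> C dvd H"
    using max_power_factor[of C g G] insert.prems by auto
  let ?x = "x(C := k)"
  have "(\<Prod>D\<in>insert C S. D ^ ?x D) = C ^ k * (\<Prod>D\<in>S. D ^ x D)"
  proof -
    have "(\<Prod>D\<in>S. D ^ ?x D) = (\<Prod>D\<in>S. D ^ x D)"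
    proof (rule prod.cong[OF refl])
      fix D assume "D \<in> S"
      then have "D \<noteq> C" using insert.hyps by blast
      then show "D ^ ?x D = D ^ x D" by simp
    qed
    then show ?thesis using insert.hyps by simp
  qed
  then have "F = (\<Prod>D\<in>insert C S. D ^ ?x D) * H" unfolding G(1) H(1) by (simp add: ac_simps)
  moreover have "\<forall>D\<in>insert C S. \<not> D dvd H" using G(2) H by (auto dest: dvd_mult)
  ultimately show ?case by (intro exI[of _ ?x] exI[of _ H] conjI)
qed

lemma prod_not_dvd:
  assumes "irreducible C" "\<And>D. D \<in> T \<Longrightarrow> \<not> C dvd D" "\<not> C dvd G"
  shows "\<not> C dvd (\<Prod>D\<in>T. D ^ x D) * (G :: 'k::field poly3)"
  using assms(2)
proof (induction T rule: infinite_finite_induct)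
  case (insert D T)
  have D: "\<not> C dvd D ^ x D" by (rule prime_not_dvd_power[OF assms(1)]) (rule insert.prems, simp)
  show ?case
  proof
    assume "C dvd (\<Prod>D\<in>insert D T. D ^ x D) * G"
    then have "C dvd D ^ x D * ((\<Prod>D\<in>T. D ^ x D) * G)"
      unfolding prod.insert[OF insert.hyps, of "\<lambda>D. D ^ x D"] mult.assoc .
    then have "C dvd (\<Prod>D\<in>T. D ^ x D) * G" by (rule prime_dvd_mult_cancel[OF assms(1) D])
    moreover have "\<not> C dvd (\<Prod>D\<in>T. D ^ x D) * G" by (rule insert.IH) (rule insert.prems, simp)
    ultimately show False by simp
  qed
qed (use assms(3) in auto)

text \<open>With \<open>C ^ x\<close> removed, the cofactor has degree \<open>t - a * x\<close> and
  multiplicity at least \<open>n - x\<close> on \<open>W\<close>. Bezout with \<open>C\<close> gives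
  card W (n - x) <= a (t - a x), stated here without subtraction. A line through three points yields
  3 n <= 2 x + t, an irreducible conic through five yields 5 n <= x + 2 t.\<close>

lemma exponent_bound:
  assumes C: "irreducible C" "is_form a C" and F: "is_form t F" "F \<noteq> 0" "F = C ^ x * G" "\<not> C dvd G"
    and W: "distinct_points W" "\<And>v. v \<in> W \<Longrightarrow> mult_at v C = 1 \<and> mult_ge v n F"
  shows "card W * n + a * a * x \<le> card W * x + a * t"
proof -
  have nz: "C \<noteq> 0" "G \<noteq> 0" using F C(1) by auto
  then have nz': "C ^ x \<noteq> 0" by simp
  obtain b g where bg: "is_form b (C ^ x)" "is_form g G" "b + g = t" using dvd_form_imp_form[OF F(1-3)] .
  have b: "b = x * a" using is_form_unique[OF bg(1) is_form_power[OF C(2)] nz'] .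
  have "(\<Sum>v\<in>W. n) \<le> (\<Sum>v\<in>W. x + mult_at v C * mult_at v G)"
  proof (rule sum_mono)
    fix v assume v: "v \<in> W"
    have "n \<le> mult_at v F" using W(2)[OF v] F(2) by (simp add: mult_ge_iff_mult_at)
    also have "\<dots> = x + mult_at v G"
      using W(2)[OF v] nz nz' unfolding F(3) by (simp add: mult_at_mult mult_at_power)
    finally show "n \<le> x + mult_at v C * mult_at v G" using W(2)[OF v] by simp
  qed
  also have "\<dots> \<le> card W * x + a * g"
    using bezout_inequality[OF C bg(2) F(4) W(1)] by (simp add: sum.distrib)
  finally have "card W * n \<le> card W * x + a * g" by simp
  then show ?thesis using bg(3) unfolding b by (auto simp: algebra_simps)
qed

lemma prod_dvd_form:
  assumes "finite S" "\<And>C. C \<in> S \<Longrightarrow> irreducible C" "\<And>C D. C \<in> S \<Longrightarrow> D \<in> S \<Longrightarrow> C \<noteq> D \<Longrightarrow> \<not> C dvd D"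
    and "\<And>C. C \<in> S \<Longrightarrow> C dvd F"
  shows "(\<Prod>C\<in>S. C) dvd (F :: 'k::field poly3)"
  using assms
proof (induction rule: finite_induct)
  case (insert C S)
  have "(\<Prod>C\<in>S. C) dvd F" using insert.prems by (intro insert.IH) auto
  then obtain G where G: "F = (\<Prod>D\<in>S. D) * G" by (rule dvdE)
  have irr: "irreducible C" by (rule insert.prems) simp
  have "\<not> C dvd (\<Prod>D\<in>S. D ^ 1) * 1"
  proof (rule prod_not_dvd[OF irr])
    show "\<not> C dvd D" if "D \<in> S" for D by (rule insert.prems(2)) (use that insert.hyps in auto)
    show "\<not> C dvd 1" using irr by (auto simp: irreducible_def)
  qed
  then have "\<not> C dvd (\<Prod>D\<in>S. D)" by (simp only: power_one_right mult_1_right not_False_eq_True)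
  moreover have "C dvd (\<Prod>D\<in>S. D) * G" using insert.prems(3)[of C] G by simp
  ultimately have "C dvd G" by (rule prime_dvd_mult_cancel[OF irr])
  then obtain H where H: "G = C * H" by (rule dvdE)
  have "F = (\<Prod>C\<in>insert C S. C) * H"
    unfolding prod.insert[OF insert.hyps] G H by (simp only: ac_simps)
  then show ?case by (rule dvdI)
qed simp

subsection \<open>Two equal jumps by one\<close>

lemma collinear_if_low_degree:
  fixes V :: "('k::field ^ 3) set"
  assumes V: "distinct_points V" and m: "0 < m" and F: "has_form V m a" and le: "a \<le> m"
  shows "has_form V (Suc 0) (Suc 0)"
proof (cases "card V \<le> Suc 0")
  case True
  then show ?thesis by (intro has_form_few_points[OF V]) simp
next
  case False
  then have "\<not> (\<forall>u\<in>V. \<forall>v\<in>V. u = v)" using V by (auto simp: card_le_Suc0_iff_eq distinct_points_def)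
  then obtain u v where uv: "u \<in> V" "v \<in> V" "u \<noteq> v" by blast
  obtain L where L: "is_line L" "poly3_eval L u = 0" "poly3_eval L v = 0"
    using exists_line[OF V uv(1,2)] by (elim exE conjE) (rule that)
  have V0: "w \<noteq> 0" if "w \<in> V" for w using V that by (auto simp: distinct_points_def)
  obtain F where F: "F \<noteq> 0" "is_form a F" "\<forall>v\<in>V. mult_ge v m F"
    using F unfolding has_form_def by (elim exE conjE) (rule that)
  obtain x G where G: "F = L ^ x * G" "\<not> L dvd G"
    using max_power_factor[OF irreducible_line[OF L(1)] F(2,1)] .
  have nz: "L \<noteq> 0" "G \<noteq> 0" "L ^ x \<noteq> 0" using F(1) L(1) G(1) by (auto simp: is_line_def)
  obtain b g where bg: "is_form b (L ^ x)" "is_form g G" "b + g = a" using dvd_form_imp_form[OF F(2,1) G(1)] .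
  have "b = x * Suc 0" using L(1) by (intro is_form_unique[OF bg(1) is_form_power nz(3)]) (simp add: is_line_def)
  then have b: "b = x" by simp
  have "card {u, v} * m + Suc 0 * Suc 0 * x \<le> card {u, v} * x + Suc 0 * a"
    by (rule exponent_bound[OF irreducible_line[OF L(1)] _ F(2,1) G distinct_points_pair[OF V uv(1,2)]])
       (use L F(3) uv V0 mult_at_line[OF L(1)] in \<open>auto simp: is_line_def\<close>)
  \<comment> \<open>The bound says 2 m <= x + a; together with x <= a <= m this is an equality, so
    \<open>G\<close> is constant.\<close>
  then have "x = m" "g = 0" using uv(3) bg(3) b le by auto
  have "poly3_eval L w = 0" if w: "w \<in> V" for w
  proof -
    have "m \<le> mult_at w F" using F w by (simp add: mult_ge_iff_mult_at)
    also have "\<dots> = m * mult_at w L + mult_at w G"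
      using nz \<open>x = m\<close> by (simp add: G(1) mult_at_mult mult_at_power)
    also have "mult_at w G = 0" using mult_at_le_degree[OF V0[OF w] bg(2) nz(2)] \<open>g = 0\<close> by simp
    finally have "mult_at w L \<noteq> 0" using m by (cases "mult_at w L = 0") auto
    then show ?thesis using mult_at_line[OF L(1) V0[OF w]] by (simp split: if_splits)
  qed
  then show ?thesis using L(1) by (auto simp: has_form_def is_line_def mult_ge_1_iff)
qed

lemma alpha_collinear:
  assumes V: "distinct_points V" "V \<noteq> {}" and line: "has_form V (Suc 0) (Suc 0)"
  shows "alpha V m = m"
proof (rule antisym)
  obtain L where L: "L \<noteq> 0" "is_form (Suc 0) L" "\<forall>v\<in>V. mult_ge v (Suc 0) L"
    using line unfolding has_form_def by (elim exE conjE) (rule that)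
  have "has_form V m m"
    unfolding has_form_def
    using L is_form_power[OF L(2), of m] mult_ge_power[of _ "Suc 0" L m] by (intro exI[of _ "L ^ m"]) auto
  then show "alpha V m \<le> m" by (rule alpha_le)
  obtain v where "v \<in> V" using V(2) by blast
  then show "m \<le> alpha V m"
    using has_form_le_degree[OF has_form_alpha[OF V(1)]] V(1) by (auto simp: distinct_points_def)
qed

lemma alpha_jump_one:
  fixes V :: "('k::field_char_0 ^ 3) set"
  assumes V: "distinct_points V" "V \<noteq> {}" and m: "0 < m" and jump: "alpha V (m + 2) = alpha V m + 2"
  shows "has_form V (Suc 0) (Suc 0)"
proof (rule collinear_if_low_degree[OF V(1) m has_form_alpha[OF V(1)]])
  show "alpha V m \<le> m"
  proof (rule ccontr)
    assume *: "\<not> alpha V m \<le> m"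
    then have "alpha V (m + 2) * m < alpha V m * (m + 2)" unfolding jump by (simp add: algebra_simps)
    \<comment> \<open>With a the initial degree at m, (a + 1)(m + 2) <= (m + 1)(a + 2) simplifies to
      a <= m.\<close>
    then have "(alpha V m + 1) * (m + 2) \<le> (m + 1) * alpha V (m + 2)"
      by (intro initial_degree_growth_alpha[OF V(1)]) auto
    then show False using * unfolding jump by (simp add: algebra_simps)
  qed
qed

subsection \<open>Five equal jumps by two\<close>

definition incident :: "'k::field ^ 3 \<Rightarrow> 'k poly3 \<Rightarrow> bool" where
  "incident v L \<longleftrightarrow> is_line L \<and> poly3_eval L v = 0"

definition coll :: "'k::field ^ 3 \<Rightarrow> 'k ^ 3 \<Rightarrow> 'k ^ 3 \<Rightarrow> bool" where
  "coll u v w \<longleftrightarrow> (\<exists>L. incident u L \<and> incident v L \<and> incident w L)"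

lemma incident_line: "incident v L \<Longrightarrow> is_line L"
  by (simp add: incident_def)

lemma coll_commute: "coll u v w = coll v u w" "coll u v w = coll u w v"
  by (auto simp: coll_def)

lemma no_three_of_five:
  assumes "\<not> coll a b c" "\<not> coll a b d" "\<not> coll a b e" "\<not> coll a c d" "\<not> coll a c e"
    "\<not> coll a d e" "\<not> coll b c d" "\<not> coll b c e" "\<not> coll b d e" "\<not> coll c d e"
    and L: "is_line L" "W \<subseteq> {a, b, c, d, e}" "card W = 3"
  shows "\<exists>v\<in>W. poly3_eval L v \<noteq> 0"
proof (rule ccontr)
  assume *: "\<not> ?thesis"
  obtain u v w where W: "W = {u, v, w}" "u \<noteq> v" "u \<noteq> w" "v \<noteq> w" using L(3) by (auto simp: card_3_iff)
  define I where "I x \<longleftrightarrow> poly3_eval L x = 0" for x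
  have N: "\<not> (I x \<and> I y \<and> I z)" if "\<not> coll x y z" for x y z
    using that L(1) by (auto simp: coll_def incident_def I_def)
  have "I u" "I v" "I w" using * W by (auto simp: I_def)
  moreover have "u \<in> {a, b, c, d, e}" "v \<in> {a, b, c, d, e}" "w \<in> {a, b, c, d, e}" using L(2) W by auto
  ultimately show False
    using assms(1-10)[THEN N] W(2-4) by (elim insertE emptyE) (simp_all)
qed

text \<open>The hypothetical counterexample, indexed by the last exponent \<open>n\<close> of the
  five jumps so that \<open>growth\<close> looks backwards: components may be removed from a form
  with multiplicity \<open>n\<close>. The condition on \<open>n\<close> ensures that the estimated
  exponents are at least 2 where a square is split off.\<close>

locale double_growth =
  fixes V :: "('k::field_char_0 ^ 3) set" and n :: nat
  assumes V: "distinct_points V" and n: "5 < n"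
    and growth: "\<And>j. j \<le> 5 \<Longrightarrow> alpha V n = alpha V (n - j) + 2 * j"
    and bound: "4 * alpha V n \<le> 9 * n"
    and nonconic: "\<not> has_form V (Suc 0) 2"
begin

abbreviation t :: nat where "t \<equiv> alpha V n"

definition F :: "'k poly3" where
  "F = (SOME F. F \<noteq> 0 \<and> is_form t F \<and> (\<forall>v\<in>V. mult_ge v n F))"

lemma F: "F \<noteq> 0" "is_form t F" "v \<in> V \<Longrightarrow> mult_ge v n F"
proof -
  have "F \<noteq> 0 \<and> is_form t F \<and> (\<forall>v\<in>V. mult_ge v n F)"
    unfolding F_def by (rule someI_ex) (rule has_form_alpha[OF V, unfolded has_form_def])
  then show "F \<noteq> 0" "is_form t F" "v \<in> V \<Longrightarrow> mult_ge v n F" by auto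
qed

lemma V0: "v \<in> V \<Longrightarrow> v \<noteq> 0"
  using V by (auto simp: distinct_points_def)

text \<open>The cofactor of \<open>K\<close> has multiplicity \<open>n - j\<close> at all points,
  hence degree at least \<open>t - 2 * j\<close>. Curves of degree 9 with multiplicities at most 4,
  and of degree 7 with at most 3, are refuted this way.\<close>

lemma removal:
  assumes K: "is_form k K" "K dvd F" and mult: "\<And>v. v \<in> V \<Longrightarrow> mult_at v K \<le> j" and j: "j \<le> 5"
  shows "k \<le> 2 * j"
proof -
  obtain H where H: "F = K * H" using K(2) by (rule dvdE)
  have nz: "K \<noteq> 0" "H \<noteq> 0" using H F(1) by auto
  obtain a b where ab: "is_form a K" "is_form b H" "a + b = t" using dvd_form_imp_form[OF F(2,1) H] .
  have "a = k" by (rule is_form_unique[OF ab(1) K(1) nz(1)])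
  have "mult_ge v (n - j) H" if v: "v \<in> V" for v
  proof -
    have "n \<le> mult_at v K + mult_at v H"
      using F(3)[OF v] F(1) nz by (simp add: mult_ge_iff_mult_at H mult_at_mult)
    then show ?thesis using mult[OF v] nz by (simp add: mult_ge_iff_mult_at)
  qed
  then have "alpha V (n - j) \<le> b" using nz ab by (intro alpha_le) (auto simp: has_form_def)
  then show ?thesis using growth[OF j] ab(3) \<open>a = k\<close> by simp
qed

lemma same_line:
  assumes "incident u L" "incident v L" "incident u M" "incident v M" "u \<noteq> v" "u \<in> V" "v \<in> V" "incident w L"
  shows "incident w M"
  using line_unique[OF V assms(6,7,5), of L M] dvd_imp_vanishes[of L M w] assms by (auto simp: incident_def)

lemma line_exponent:
  assumes "incident u L" "incident v L" "incident w L" "u \<in> V" "v \<in> V" "w \<in> V" "u \<noteq> v" "u \<noteq> w" "v \<noteq> w"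
    and "F = L ^ x * G" "\<not> L dvd G"
  shows "3 * n \<le> 2 * x + t"
proof -
  have L: "is_line L" using assms(1) by (rule incident_line)
  have "card {u, v, w} * n + Suc 0 * Suc 0 * x \<le> card {u, v, w} * x + Suc 0 * t"
    by (rule exponent_bound[OF irreducible_line[OF L] _ F(2,1) assms(10,11)])
       (use assms V0 F(3) mult_at_line[OF L] in \<open>auto simp: is_line_def incident_def intro: distinct_points_subset[OF V]\<close>)
  then show ?thesis using assms(7-9) by simp
qed

lemma conic_mult:
  assumes "irreducible K" "is_form 2 K" "u \<in> V" "v \<in> V" "u \<noteq> v" "poly3_eval K u = 0" "poly3_eval K v = 0"
  shows "mult_at u K = 1"
  using mult_at_conic[OF V assms(3-5,1,2,6,7)] .

lemma conic_exponent:
  assumes K: "irreducible K" "is_form 2 K" and W: "W \<subseteq> V" "card W = 5" "\<And>v. v \<in> W \<Longrightarrow> poly3_eval K v = 0"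
    and G: "F = K ^ x * G" "\<not> K dvd G"
  shows "5 * n \<le> x + 2 * t"
proof -
  have "card W * n + 2 * 2 * x \<le> card W * x + 2 * t"
  proof (rule exponent_bound[OF K F(2,1) G distinct_points_subset[OF V W(1)]])
    fix v assume v: "v \<in> W"
    have "\<not> W \<subseteq> {v}" using W(2) card_mono[of "{v}" W] by auto
    then obtain u where "u \<in> W" "v \<noteq> u" by blast
    then show "mult_at v K = 1 \<and> mult_ge v n F" using conic_mult[OF K, of v u] v W F(3) by auto
  qed
  then show ?thesis unfolding W(2) by simp
qed

lemma exists_conic:
  assumes "W \<subseteq> V" "card W = 5"
  shows "\<exists>K. K \<noteq> 0 \<and> is_form 2 K \<and> (\<forall>v\<in>W. poly3_eval K v = 0)"
  using has_form_few_points[OF distinct_points_subset[OF V assms(1)], of 2] assms(2)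
  by (simp add: has_form_def mult_ge_1_iff)

lemma finite_V: "finite V"
  using V by (simp add: distinct_points_def)

lemma line_not_dvd_conic:
  assumes "irreducible K" "is_form 2 K" "is_line L"
  shows "\<not> L dvd K"
proof
  assume "L dvd K"
  then have "Suc 0 = 2"
    using assms(3) by (intro irreducible_factor_degree[OF irreducible_line[OF assms(3)] _ assms(2,1)]) (simp_all add: is_line_def)
  then show False by simp
qed

lemma conic_not_dvd_line:
  assumes "irreducible K" "is_form 2 K" "is_line L"
  shows "\<not> K dvd L"
  using irreducible_dvd_sym[OF assms(1) irreducible_line[OF assms(3)]] line_not_dvd_conic[OF assms] by auto

lemma line_meets_conic:
  assumes K: "irreducible K" "is_form 2 K" and L: "incident u L" "incident v L" "incident w L"
    and pts: "u \<in> V" "v \<in> V" "w \<in> V" "u \<noteq> v" "u \<noteq> w" "v \<noteq> w" "poly3_eval K u = 0" "poly3_eval K v = 0"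
  shows "poly3_eval K w \<noteq> 0"
proof
  assume "poly3_eval K w = 0"
  then have "L dvd K"
    by (intro line_dvd[OF V, of "{u, v, w}" L 2 K "\<lambda>_. 1"]) (use assms in \<open>auto simp: incident_def mult_ge_1_iff\<close>)
  then show False using line_not_dvd_conic[OF K] incident_line[OF L(1)] by blast
qed

text \<open>The bookkeeping after several curves are split off \<open>F\<close>. The last clause
  keeps a cofactor for each curve separately, since \<open>exponent_bound\<close> treats one curve
  at a time.\<close>

definition residual :: "'k poly3 set \<Rightarrow> ('k poly3 \<Rightarrow> nat) \<Rightarrow> 'k poly3 \<Rightarrow> nat \<Rightarrow> bool" where
  "residual S x G g \<longleftrightarrow>
    F = (\<Prod>C\<in>S. C ^ x C) * G \<and> is_form g G \<and> G \<noteq> 0 \<and> (\<Sum>C\<in>S. x C * ord0 C) + g = t \<and>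
    (\<forall>v\<in>V. n \<le> (\<Sum>C\<in>S. x C * mult_at v C) + mult_at v G) \<and>
    (\<forall>C\<in>S. \<exists>H. F = C ^ x C * H \<and> \<not> C dvd H)"

lemma exists_residual:
  assumes S: "finite S" "\<And>C. C \<in> S \<Longrightarrow> irreducible C \<and> is_form (ord0 C) C"
    and ne: "\<And>C D. C \<in> S \<Longrightarrow> D \<in> S \<Longrightarrow> C \<noteq> D \<Longrightarrow> \<not> C dvd D"
  shows "\<exists>x G g. residual S x G g"
proof -
  obtain x G where G: "F = (\<Prod>C\<in>S. C ^ x C) * G" "\<forall>C\<in>S. \<not> C dvd G"
    using extract_factors[OF S(1) _ F(2,1)] S(2) by auto
  let ?P = "\<Prod>C\<in>S. C ^ x C"
  have nz: "?P \<noteq> 0" "G \<noteq> 0" using G(1) F(1) by auto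
  obtain a g where ag: "is_form a ?P" "is_form g G" "a + g = t" using dvd_form_imp_form[OF F(2,1) G(1)] .
  have P: "is_form (\<Sum>C\<in>S. x C * ord0 C) ?P" using S(2) by (intro is_form_prod is_form_power) auto
  have a: "a = (\<Sum>C\<in>S. x C * ord0 C)" by (rule is_form_unique[OF ag(1) P nz(1)])
  have m: "n \<le> (\<Sum>C\<in>S. x C * mult_at v C) + mult_at v G" if v: "v \<in> V" for v
  proof -
    have "n \<le> mult_at v F" using F(3)[OF v] F(1) by (simp add: mult_ge_iff_mult_at)
    also have "\<dots> = mult_at v ?P + mult_at v G" unfolding G(1) using nz by (rule mult_at_mult)
    also have "mult_at v ?P = (\<Sum>C\<in>S. x C * mult_at v C)"
      using mult_at_factorization[OF S(1) _ one_neq_zero, of ?P x v] S(2) by simp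
    finally show ?thesis .
  qed
  have H: "\<exists>H. F = C ^ x C * H \<and> \<not> C dvd H" if C: "C \<in> S" for C
  proof (intro exI conjI)
    show "F = C ^ x C * ((\<Prod>D\<in>S - {C}. D ^ x D) * G)"
      unfolding G(1) by (subst prod.remove[OF S(1) C]) (simp add: mult.assoc)
    show "\<not> C dvd (\<Prod>D\<in>S - {C}. D ^ x D) * G"
      by (rule prod_not_dvd) (use S(2) G(2) C ne[OF C] in auto)
  qed
  have deg: "(\<Sum>C\<in>S. x C * ord0 C) + g = t" using ag(3) unfolding a .
  show ?thesis unfolding residual_def
    by (rule exI[of _ x], rule exI[of _ G], rule exI[of _ g]) (intro conjI ballI G(1) ag(2) nz(2) deg m H)
qed

lemma ord0_conic: "irreducible K \<Longrightarrow> is_form 2 K \<Longrightarrow> ord0 K = 2"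
  by (rule ord_form) auto

lemma ord0_line: "is_line L \<Longrightarrow> ord0 L = Suc 0"
  unfolding is_line_def by (rule ord_form) auto

text \<open>The conic through the five points other than \<open>w\<^sub>i\<close> divides \<open>F\<close> at least \<open>5 n - 2 t\<close> times, and three of these are too many for
  the degree of \<open>F\<close>.\<close>

lemma three_conics:
  assumes W: "W \<subseteq> V" "card W = 6" and w: "w1 \<in> W" "w2 \<in> W" "w3 \<in> W" "w1 \<noteq> w2" "w1 \<noteq> w3" "w2 \<noteq> w3"
    and noconic: "\<And>K. K \<noteq> 0 \<Longrightarrow> is_form 2 K \<Longrightarrow> \<exists>v\<in>W. poly3_eval K v \<noteq> 0"
    and no3: "\<And>w L U. w \<in> {w1, w2, w3} \<Longrightarrow> is_line L \<Longrightarrow> U \<subseteq> W - {w} \<Longrightarrow> card U = 3 \<Longrightarrow> \<exists>v\<in>U. poly3_eval L v \<noteq> 0"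
  shows False
proof -
  have finW: "finite W" using finite_subset[OF W(1) finite_V] .
  have "\<exists>K. irreducible K \<and> is_form 2 K \<and> (\<forall>v\<in>W - {w}. poly3_eval K v = 0) \<and> poly3_eval K w \<noteq> 0"
    if w': "w \<in> {w1, w2, w3}" for w
  proof -
    have card: "card (W - {w}) = 5" using w' w W(2) finW by auto
    have "W - {w} \<subseteq> V" using W(1) by blast
    from exists_conic[OF this card] obtain K where K: "K \<noteq> 0" "is_form 2 K" "\<forall>v\<in>W - {w}. poly3_eval K v = 0"
      by (elim exE conjE) (rule that)
    have "irreducible K"
      by (rule irreducible_conic[OF K(1,2), of "W - {w}"]) (use K(3) card finW no3[OF w'] in auto)
    moreover have "poly3_eval K w \<noteq> 0" using noconic[OF K(1,2)] K(3) by auto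
    ultimately show ?thesis using K by blast
  qed
  then obtain K where K: "\<And>w. w \<in> {w1, w2, w3} \<Longrightarrow> irreducible (K w) \<and> is_form 2 (K w) \<and>
      (\<forall>v\<in>W - {w}. poly3_eval (K w) v = 0) \<and> poly3_eval (K w) w \<noteq> 0"
    by metis
  have ne: "\<not> K u dvd K v" if "u \<in> {w1, w2, w3}" "v \<in> {w1, w2, w3}" "u \<noteq> v" for u v
  proof
    assume "K u dvd K v"
    moreover have "poly3_eval (K u) v = 0" using K[OF that(1)] that w by auto
    ultimately show False using dvd_imp_vanishes[of "K u" "K v" v] K[OF that(2)] by blast
  qed
  let ?S = "{K w1, K w2, K w3}"
  have dist: "K w1 \<noteq> K w2" "K w1 \<noteq> K w3" "K w2 \<noteq> K w3"
    using ne[of w1 w2] ne[of w1 w3] ne[of w2 w3] w(4-6) by auto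
  have ord: "ord0 (K w) = 2" if "w \<in> {w1, w2, w3}" for w using K[OF that] ord0_conic by blast
  have "\<exists>x G g. residual ?S x G g"
  proof (rule exists_residual)
    show "irreducible C \<and> is_form (ord0 C) C" if "C \<in> ?S" for C using that K ord by auto
    show "\<not> C dvd D" if "C \<in> ?S" "D \<in> ?S" "C \<noteq> D" for C D
    proof -
      obtain u v where "C = K u" "u \<in> {w1, w2, w3}" "D = K v" "v \<in> {w1, w2, w3}" using \<open>C \<in> ?S\<close> \<open>D \<in> ?S\<close> by blast
      then show ?thesis using ne \<open>C \<noteq> D\<close> by metis
    qed
  qed simp
  then obtain x g where deg: "(\<Sum>C\<in>?S. x C * ord0 C) + g = t"
    and H: "\<forall>C\<in>?S. \<exists>H. F = C ^ x C * H \<and> \<not> C dvd H"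
    unfolding residual_def by (elim exE conjE) (rule that)
  have ex: "5 * n \<le> x (K w) + 2 * t" if w': "w \<in> {w1, w2, w3}" for w
  proof -
    have "K w \<in> ?S" using w' by auto
    then obtain H where H: "F = K w ^ x (K w) * H" "\<not> K w dvd H" using H by blast
    show ?thesis
    proof (rule conic_exponent[OF _ _ _ _ _ H])
      show "irreducible (K w)" "is_form 2 (K w)" using K[OF w'] by auto
      show "W - {w} \<subseteq> V" "card (W - {w}) = 5" using W finW w w' by auto
      show "poly3_eval (K w) v = 0" if "v \<in> W - {w}" for v using K[OF w'] that by blast
    qed
  qed
  have "2 * (x (K w1) + x (K w2) + x (K w3)) \<le> t" using deg dist ord by simp
  \<comment> \<open>Three exponents of at least 5 n - 2 t and 2 (sum) <= t give 30 n <= 13 t,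
    against 4 t <= 9 n.\<close>
  then show False using ex[of w1] ex[of w2] ex[of w3] bound n by simp
qed

lemma dvd_incident: "L dvd M \<Longrightarrow> incident v L \<Longrightarrow> is_line M \<Longrightarrow> incident v M"
  by (auto simp: incident_def dest: dvd_imp_vanishes)

lemma off_line:
  assumes "incident u L" "incident v L" "u \<noteq> v" "u \<in> V" "v \<in> V" "incident u M" "incident w M" "\<not> incident w L"
  shows "\<not> incident v M"
  using same_line[of u M v L w] assms by blast

lemma mult_line: "is_line L \<Longrightarrow> v \<in> V \<Longrightarrow> mult_at v L = (if incident v L then 1 else 0)"
  using mult_at_line[of L v] V0 by (simp add: incident_def)

lemma join: "u \<in> V \<Longrightarrow> v \<in> V \<Longrightarrow> \<exists>L. incident u L \<and> incident v L"
  using exists_line[OF V] by (auto simp: incident_def)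

lemma irreducible_line_ord0: "is_line L \<Longrightarrow> irreducible L \<and> is_form (ord0 L) L"
  using irreducible_line[of L] ord0_line[of L] by (simp add: is_line_def)

text \<open>The sides of the triangle divide \<open>F\<close> at least three times, and then so do once the lines \<open>m\<^sub>i\<close> joining two of the \<open>M\<^sub>j\<close>. The
  curve \<open>l\<^sub>1\<^sup>2 l\<^sub>2\<^sup>2 l\<^sub>3\<^sup>2 m\<^sub>1 m\<^sub>2 m\<^sub>3\<close> has degree 9 and multiplicity at most 4 at the points.\<close>

lemma triangle:
  assumes mem: "P1 \<in> V" "P2 \<in> V" "P3 \<in> V" "M1 \<in> V" "M2 \<in> V" "M3 \<in> V"
    and l1: "incident P2 l1" "incident P3 l1" "incident M1 l1" "\<not> incident P1 l1"
    and l2: "incident P1 l2" "incident P3 l2" "incident M2 l2" "\<not> incident P2 l2"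
    and l3: "incident P1 l3" "incident P2 l3" "incident M3 l3" "\<not> incident P3 l3"
    and M: "M1 \<noteq> P2" "M1 \<noteq> P3" "M2 \<noteq> P1" "M2 \<noteq> P3" "M3 \<noteq> P1" "M3 \<noteq> P2" "\<not> coll M1 M2 M3"
  shows False
proof -
  note lines = l1(1)[THEN incident_line] l2(1)[THEN incident_line] l3(1)[THEN incident_line]
  have P: "P1 \<noteq> P2" "P1 \<noteq> P3" "P2 \<noteq> P3" using l1 l2 l3 by auto
  have two: "v = P3" if "incident v l1" "incident v l2" "v \<in> V" for v
    using off_line[of P3 l1 v l2 P1] that l1 l2 mem by auto
  have two': "v = P2" if "incident v l1" "incident v l3" "v \<in> V" for v
    using off_line[of P2 l1 v l3 P1] that l1 l3 mem by auto
  have two'': "v = P1" if "incident v l2" "incident v l3" "v \<in> V" for v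
    using off_line[of P1 l2 v l3 P2] that l2 l3 mem by auto
  have off: "\<not> incident M1 l2" "\<not> incident M1 l3" "\<not> incident M2 l1" "\<not> incident M2 l3"
    "\<not> incident M3 l1" "\<not> incident M3 l2"
    using two two' two'' l1(3) l2(3) l3(3) mem M(1-6) by metis+
  have Mne: "M1 \<noteq> M2" "M1 \<noteq> M3" "M2 \<noteq> M3" using off l1(3) l2(3) l3(3) by auto
  obtain m1 where m1: "incident M2 m1" "incident M3 m1" using join[OF mem(5,6)] by (elim exE conjE) (rule that)
  obtain m2 where m2: "incident M1 m2" "incident M3 m2" using join[OF mem(4,6)] by (elim exE conjE) (rule that)
  obtain m3 where m3: "incident M1 m3" "incident M2 m3" using join[OF mem(4,5)] by (elim exE conjE) (rule that)
  note mlines = m1(1)[THEN incident_line] m2(1)[THEN incident_line] m3(1)[THEN incident_line]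
  have Mm: "\<not> incident M1 m1" "\<not> incident M2 m2" "\<not> incident M3 m3"
    using M(7) m1 m2 m3 by (auto simp: coll_def)
  have P1m: "\<not> incident P1 m1" "\<not> incident P1 m2" "\<not> incident P1 m3"
    using off_line[of M2 l2 P1 m1 M3] off_line[of M3 l3 P1 m2 M1] off_line[of M2 l2 P1 m3 M1]
      l2 l3 m1 m2 m3 M off mem by blast+
  have P2m: "\<not> incident P2 m1" "\<not> incident P2 m2" "\<not> incident P2 m3"
    using off_line[of M3 l3 P2 m1 M2] off_line[of M1 l1 P2 m2 M3] off_line[of M1 l1 P2 m3 M2]
      l1 l3 m1 m2 m3 M off mem by blast+
  have P3m: "\<not> incident P3 m1" "\<not> incident P3 m2" "\<not> incident P3 m3"
    using off_line[of M2 l2 P3 m1 M3] off_line[of M1 l1 P3 m2 M3] off_line[of M1 l1 P3 m3 M2]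
      l1 l2 m1 m2 m3 M off mem by blast+
  have lne: "\<not> l1 dvd l2" "\<not> l1 dvd l3" "\<not> l2 dvd l1" "\<not> l2 dvd l3" "\<not> l3 dvd l1" "\<not> l3 dvd l2"
    using dvd_incident lines l1 l2 l3 by blast+
  then have lne': "l1 \<noteq> l2" "l1 \<noteq> l3" "l2 \<noteq> l3" by auto
  let ?S = "{l1, l2, l3}"
  have "\<exists>x G g. residual ?S x G g"
    by (rule exists_residual) (use lines lne irreducible_line_ord0 in auto)
  then obtain x G g where G: "F = (\<Prod>C\<in>?S. C ^ x C) * G" "is_form g G" "G \<noteq> 0" "(\<Sum>C\<in>?S. x C * ord0 C) + g = t"
    "\<forall>v\<in>V. n \<le> (\<Sum>C\<in>?S. x C * mult_at v C) + mult_at v G"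
    "\<forall>C\<in>?S. \<exists>H. F = C ^ x C * H \<and> \<not> C dvd H"
    unfolding residual_def by (elim exE conjE) (rule that)
  have Geq: "F = l1 ^ x l1 * l2 ^ x l2 * l3 ^ x l3 * G" unfolding G(1) using lne' by (simp add: mult.assoc)
  have deg: "x l1 + x l2 + x l3 + g = t" using G(4) lne' ord0_line[OF lines(1)] ord0_line[OF lines(2)] ord0_line[OF lines(3)] by simp
  have mult: "n \<le> x l1 * mult_at v l1 + x l2 * mult_at v l2 + x l3 * mult_at v l3 + mult_at v G" if "v \<in> V" for v
    using G(5) that lne' by (simp add: add.assoc)
  have x1: "3 * n \<le> 2 * x l1 + t"
  proof -
    obtain H where "F = l1 ^ x l1 * H" "\<not> l1 dvd H" using G(6) by blast
    then show ?thesis by (rule line_exponent[OF l1(1-3) mem(2,3,4) P(3) M(1,2)[symmetric]])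
  qed
  have x2: "3 * n \<le> 2 * x l2 + t"
  proof -
    obtain H where "F = l2 ^ x l2 * H" "\<not> l2 dvd H" using G(6) by blast
    then show ?thesis by (rule line_exponent[OF l2(1-3) mem(1,3,5) P(2) M(3,4)[symmetric]])
  qed
  have x3: "3 * n \<le> 2 * x l3 + t"
  proof -
    obtain H where "F = l3 ^ x l3 * H" "\<not> l3 dvd H" using G(6) by blast
    then show ?thesis by (rule line_exponent[OF l3(1-3) mem(1,2,6) P(1) M(5,6)[symmetric]])
  qed
  have mG: "mult_ge M1 (n - x l1) G" "mult_ge M2 (n - x l2) G" "mult_ge M3 (n - x l3) G"
    using mult[OF mem(4)] mult[OF mem(5)] mult[OF mem(6)] l1(3) l2(3) l3(3) off mem lines G(3)
    by (simp_all add: mult_line mult_ge_iff_mult_at)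
  have side: "m dvd G" if "incident A m" "incident B m" "A \<in> V" "B \<in> V" "A \<noteq> B"
      "mult_ge A a G" "mult_ge B b G" "g < a + b" for m A B a b
    by (rule line_dvd[OF V, of "{A, B}" m g G "\<lambda>v. if v = A then a else b"])
       (use that G(2) in \<open>auto simp: incident_def\<close>)
  \<comment> \<open>The line meets the cofactor, of degree t - x1 - x2 - x3, in multiplicities n -
    x2 and n - x3. This is too much once t < 2 n + x1, which follows from 2 x1 >= 3 n - t and 4 t <=
    9 n.\<close>
  have "m1 dvd G" by (rule side[OF m1 mem(5,6) Mne(3) mG(2,3)]) (use deg x1 bound n in linarith)
  moreover have "m2 dvd G" by (rule side[OF m2 mem(4,6) Mne(2) mG(1,3)]) (use deg x2 bound n in linarith)
  moreover have "m3 dvd G" by (rule side[OF m3 mem(4,5) Mne(1) mG(1,2)]) (use deg x3 bound n in linarith)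
  moreover have mne: "\<not> m1 dvd m2" "\<not> m1 dvd m3" "\<not> m2 dvd m1" "\<not> m2 dvd m3" "\<not> m3 dvd m1" "\<not> m3 dvd m2"
    using dvd_incident mlines m1 m2 m3 Mm by blast+
  ultimately have "(\<Prod>C\<in>{m1, m2, m3}. C) dvd G"
    using mlines by (intro prod_dvd_form) (auto simp: irreducible_line)
  moreover have "m1 \<noteq> m2" "m1 \<noteq> m3" "m2 \<noteq> m3" using mne by auto
  ultimately have mG: "m1 * m2 * m3 dvd G" by (simp add: mult.assoc)
  let ?K = "l1 ^ 2 * l2 ^ 2 * l3 ^ 2 * (m1 * m2 * m3)"
  \<comment> \<open>The exponents of the sides are at least (3 n - t)/2 >= 3 n/8, which exceeds 2
    because n > 5.\<close>
  have "?K dvd F"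
    unfolding Geq using x1 x2 x3 bound n mG by (intro mult_dvd_mono le_imp_power_dvd) linarith+
  moreover have nz: "l1 \<noteq> 0" "l2 \<noteq> 0" "l3 \<noteq> 0" "m1 \<noteq> 0" "m2 \<noteq> 0" "m3 \<noteq> 0"
    and forms: "is_form 1 l1" "is_form 1 l2" "is_form 1 l3" "is_form 1 m1" "is_form 1 m2" "is_form 1 m3"
    using lines mlines by (auto simp: is_line_def)
  moreover have "is_form (2 * 1 + 2 * 1 + 2 * 1 + (1 + 1 + 1)) ?K"
    by (intro is_form_mult is_form_power forms)
  \<comment> \<open>A point of \<open>V\<close> on two sides is a vertex and lies on no
    \<open>mi\<close>; no point of \<open>V\<close> lies on all three \<open>mi\<close>. The worst
    cases are 2 + 2 and 2 + 1 + 1.\<close>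
  moreover have "mult_at v ?K \<le> 4" if v: "v \<in> V" for v
  proof -
    have a: "incident v l1 \<Longrightarrow> incident v l2 \<Longrightarrow> \<not> incident v l3 \<and> \<not> incident v m1 \<and> \<not> incident v m2 \<and> \<not> incident v m3"
      using two[OF _ _ v] P3m l3(4) by blast
    have b: "incident v l1 \<Longrightarrow> incident v l3 \<Longrightarrow> \<not> incident v l2 \<and> \<not> incident v m1 \<and> \<not> incident v m2 \<and> \<not> incident v m3"
      using two'[OF _ _ v] P2m l2(4) by blast
    have c: "incident v l2 \<Longrightarrow> incident v l3 \<Longrightarrow> \<not> incident v l1 \<and> \<not> incident v m1 \<and> \<not> incident v m2 \<and> \<not> incident v m3"
      using two''[OF _ _ v] P1m l1(4) by blast
    have d: "\<not> (incident v m1 \<and> incident v m2 \<and> incident v m3)"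
      using off_line[of M3 m1 v m2 M1] m1 m2 Mm mem v by metis
    have "mult_at v ?K = 2 * mult_at v l1 + 2 * mult_at v l2 + 2 * mult_at v l3 + (mult_at v m1 + mult_at v m2 + mult_at v m3)"
      using nz by (simp add: mult_at_mult mult_at_power)
    also have "\<dots> \<le> 4" using a b c d lines mlines v by (simp add: mult_line)
    finally show ?thesis .
  qed
  ultimately have "2 * 1 + 2 * 1 + 2 * 1 + (1 + 1 + 1) \<le> 2 * (4::nat)" by (intro removal) auto
  then show False by simp
qed

text \<open>Four lines in general position and their six intersection points.\<close>

definition quad :: "'k poly3 \<Rightarrow> 'k poly3 \<Rightarrow> 'k poly3 \<Rightarrow> 'k poly3 \<Rightarrow>
    'k ^ 3 \<Rightarrow> 'k ^ 3 \<Rightarrow> 'k ^ 3 \<Rightarrow> 'k ^ 3 \<Rightarrow> 'k ^ 3 \<Rightarrow> 'k ^ 3 \<Rightarrow> bool" where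
  "quad a b c d ab ac ad bc bd cd \<longleftrightarrow>
    {ab, ac, ad, bc, bd, cd} \<subseteq> V \<and>
    incident ab a \<and> incident ac a \<and> incident ad a \<and> \<not> incident bc a \<and> \<not> incident bd a \<and> \<not> incident cd a \<and>
    incident ab b \<and> incident bc b \<and> incident bd b \<and> \<not> incident ac b \<and> \<not> incident ad b \<and> \<not> incident cd b \<and>
    incident ac c \<and> incident bc c \<and> incident cd c \<and> \<not> incident ab c \<and> \<not> incident ad c \<and> \<not> incident bd c \<and>
    incident ad d \<and> incident bd d \<and> incident cd d \<and> \<not> incident ab d \<and> \<not> incident ac d \<and> \<not> incident bc d"

lemma quad_perm:
  assumes "quad a b c d ab ac ad bc bd cd"
  shows "quad b a c d ab bc bd ac ad cd" "quad c a b d ac bc cd ab ad bd" "quad d a b c ad bd cd ab ac bc"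
  using assms by (auto simp: quad_def)

lemma quad_distinct:
  assumes "quad a b c d ab ac ad bc bd cd"
  shows "ab \<noteq> ac" "ab \<noteq> ad" "ac \<noteq> ad"
  using assms unfolding quad_def by metis+

lemma quad_lines:
  assumes "quad a b c d ab ac ad bc bd cd"
  shows "is_line a" "is_line b" "is_line c" "is_line d"
  using assms unfolding quad_def by (blast intro: incident_line)+

text \<open>The sides \<open>a\<close>, \<open>b\<close>, \<open>c\<close> form a triangle with
  third points \<open>X\<close>, \<open>bd\<close>, \<open>cd\<close>. The last two span
  \<open>d\<close>, which does not contain \<open>X\<close>, so the triangle argument
  applies.\<close>

lemma quad_extra_on_line:
  assumes Q: "quad a b c d ab ac ad bc bd cd" and X: "X \<in> V" "incident X a" "X \<noteq> ab" "X \<noteq> ac" "X \<noteq> ad"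
  shows False
proof (rule triangle[of bc ac ab X bd cd a b c])
  have mem: "ab \<in> V" "ac \<in> V" "ad \<in> V" "bc \<in> V" "bd \<in> V" "cd \<in> V" using Q by (auto simp: quad_def)
  have "\<not> incident X d" using off_line[of ad a X d bd] Q X mem by (auto simp: quad_def)
  moreover have "incident X d" if "incident bd L" "incident cd L" "incident X L" for L
    using same_line[of bd L cd d X] that Q mem by (auto simp: quad_def)
  ultimately show "\<not> coll X bd cd" by (auto simp: coll_def)
  show "bd \<noteq> bc" "bd \<noteq> ab" "cd \<noteq> bc" "cd \<noteq> ac" using Q unfolding quad_def by metis+
qed (use Q X in \<open>auto simp: quad_def\<close>)

lemma quad_not_dvd:
  assumes "quad a b c d ab ac ad bc bd cd" and L: "L \<in> {a, b, c, d}" "M \<in> {a, b, c, d}" "L \<noteq> M"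
  shows "\<not> L dvd M"
proof -
  have "\<not> a' dvd b' \<and> \<not> a' dvd c' \<and> \<not> a' dvd d'" if "quad a' b' c' d' u1 u2 u3 u4 u5 u6" for a' b' c' d' u1 u2 u3 u4 u5 u6
    using that quad_lines[OF that] dvd_incident[of a'] unfolding quad_def by blast
  from this[OF assms(1)] this[OF quad_perm(1)[OF assms(1)]] this[OF quad_perm(2)[OF assms(1)]] this[OF quad_perm(3)[OF assms(1)]]
  show ?thesis using L by auto
qed

text \<open>The cofactor of the four lines keeps multiplicity \<open>n\<close> at \<open>X\<close>,
  hence degree at least \<open>n\<close>. With four exponents of at least (3 n - t)/2 this gives 7 n
  <= 3 t, against 4 t <= 9 n.\<close>

lemma quad_extra_off_lines:
  assumes Q: "quad a b c d ab ac ad bc bd cd"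
    and X: "X \<in> V" "\<not> incident X a" "\<not> incident X b" "\<not> incident X c" "\<not> incident X d"
  shows False
proof -
  let ?S = "{a, b, c, d}"
  have mem: "ab \<in> V" "ac \<in> V" "ad \<in> V" "bc \<in> V" "bd \<in> V" "cd \<in> V" using Q by (auto simp: quad_def)
  note lines = quad_lines[OF Q]
  have ne: "a \<noteq> b" "a \<noteq> c" "a \<noteq> d" "b \<noteq> c" "b \<noteq> d" "c \<noteq> d" using Q by (auto simp: quad_def)
  have "\<exists>x G g. residual ?S x G g"
  proof (rule exists_residual)
    show "irreducible C \<and> is_form (ord0 C) C" if "C \<in> ?S" for C using that lines irreducible_line_ord0 by auto
  qed (simp, rule quad_not_dvd[OF Q])
  then obtain x G g where G: "is_form g G" "G \<noteq> 0" "(\<Sum>C\<in>?S. x C * ord0 C) + g = t"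
    "\<forall>v\<in>V. n \<le> (\<Sum>C\<in>?S. x C * mult_at v C) + mult_at v G"
    "\<forall>C\<in>?S. \<exists>H. F = C ^ x C * H \<and> \<not> C dvd H"
    unfolding residual_def by (elim exE conjE) (rule that)
  have deg: "x a + x b + x c + x d + g = t" using G(3) ne lines by (simp add: ord0_line)
  have "n \<le> mult_at X G" using G(4)[rule_format, OF X(1)] X ne lines by (simp add: mult_line)
  also have "\<dots> \<le> g" by (rule mult_at_le_degree[OF V0[OF X(1)] G(1,2)])
  finally have "n \<le> g" .
  have ex: "3 * n \<le> 2 * x L + t" if L: "L \<in> ?S" "quad L l1 l2 l3 u1 u2 u3 u4 u5 u6" for L l1 l2 l3 u1 u2 u3 u4 u5 u6
  proof -
    obtain H where "F = L ^ x L * H" "\<not> L dvd H" using G(5) L(1) by blast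
    then show ?thesis using L(2) quad_distinct[OF L(2)] by (intro line_exponent[of u1 L u2 u3]) (auto simp: quad_def)
  qed
  have "3 * n \<le> 2 * x a + t" by (rule ex[OF _ Q]) simp
  moreover have "3 * n \<le> 2 * x b + t" by (rule ex[OF _ quad_perm(1)[OF Q]]) simp
  moreover have "3 * n \<le> 2 * x c + t" by (rule ex[OF _ quad_perm(2)[OF Q]]) simp
  moreover have "3 * n \<le> 2 * x d + t" by (rule ex[OF _ quad_perm(3)[OF Q]]) simp
  ultimately show False using deg \<open>n \<le> g\<close> bound n by linarith
qed

lemma quad_mult:
  assumes Q: "quad a b c d ab ac ad bc bd cd" and v: "v \<in> {ab, ac, ad, bc, bd, cd}"
  shows "mult_at v (a * b * c * d) = 2"
proof -
  have "v \<in> V" using Q v by (auto simp: quad_def)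
  then have "mult_at v (a * b * c * d) = (if incident v a then 1 else 0) + (if incident v b then 1 else 0)
      + (if incident v c then 1 else 0) + (if incident v d then 1 else 0)"
    using quad_lines[OF Q] mult_line[of _ v] by (simp add: mult_at_mult is_line_def)
  then show ?thesis using Q v unfolding quad_def by auto
qed

lemma quad_form: "quad a b c d ab ac ad bc bd cd \<Longrightarrow> is_form 4 (a * b * c * d) \<and> a * b * c * d \<noteq> 0"
proof -
  assume "quad a b c d ab ac ad bc bd cd"
  then have "is_form (1 + 1 + 1 + 1) (a * b * c * d) \<and> a * b * c * d \<noteq> 0"
    using quad_lines[of a b c d] by (intro conjI is_form_mult) (auto simp: is_line_def)
  moreover have "1 + 1 + 1 + 1 = (4::nat)" by simp
  ultimately show ?thesis by metis
qed

text \<open>Each line carries three vertices and 3 k > 2 k >= e, so all four lines divide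
  \<open>G\<close>. Dividing by their product lowers \<open>k\<close> by 2 and the degree by 4; an
  odd \<open>k\<close> descends to 1, where degree at most 2 leaves no room for four lines.\<close>

lemma quad_no_odd:
  assumes Q: "quad a b c d ab ac ad bc bd cd"
    and "odd k" "G \<noteq> 0" "is_form e G" "e \<le> 2 * k" "\<forall>v\<in>{ab, ac, ad, bc, bd, cd}. mult_ge v k G"
  shows False
  using assms(2-)
proof (induction k arbitrary: G e rule: less_induct)
  case (less k)
  let ?S = "{a, b, c, d}" and ?Q = "a * b * c * d"
  have k: "0 < k" using less.prems(1) by (cases k) auto
  have dvd: "L dvd G" if "quad L l1 l2 l3 u1 u2 u3 u4 u5 u6" "{u1, u2, u3} \<subseteq> {ab, ac, ad, bc, bd, cd}"
    for L l1 l2 l3 u1 u2 u3 u4 u5 u6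
    using that quad_lines[OF that(1)] quad_distinct[OF that(1)] k less.prems(4,5)
    by (intro line_dvd[OF V, of "{u1, u2, u3}" L e G "\<lambda>_. k"]) (auto simp: quad_def incident_def less.prems(3))
  have "(\<Prod>L\<in>?S. L) dvd G"
  proof (rule prod_dvd_form)
    show "irreducible C" if "C \<in> ?S" for C using that quad_lines[OF Q] irreducible_line by auto
    have "a dvd G" by (rule dvd[OF Q]) simp
    moreover have "b dvd G" by (rule dvd[OF quad_perm(1)[OF Q]]) simp
    moreover have "c dvd G" by (rule dvd[OF quad_perm(2)[OF Q]]) simp
    moreover have "d dvd G" by (rule dvd[OF quad_perm(3)[OF Q]]) simp
    ultimately show "C dvd G" if "C \<in> ?S" for C using that by auto
  qed (simp, rule quad_not_dvd[OF Q])
  moreover have "a \<noteq> b" "a \<noteq> c" "a \<noteq> d" "b \<noteq> c" "b \<noteq> d" "c \<noteq> d" using Q by (auto simp: quad_def)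
  ultimately have "?Q dvd G" by (simp add: mult.assoc)
  then obtain H where H: "G = ?Q * H" by (rule dvdE)
  have Qf: "is_form 4 ?Q" "?Q \<noteq> 0" using quad_form[OF Q] by auto
  have H0: "H \<noteq> 0" using H less.prems(2) by auto
  obtain i h where ih: "is_form i ?Q" "is_form h H" "i + h = e" using dvd_form_imp_form[OF less.prems(3,2) H] .
  have "i = 4" by (rule is_form_unique[OF ih(1) Qf])
  then have "2 < k" using ih(3) less.prems(1,4) by (cases "k = 2") auto
  show False
  proof (rule less.IH[of "k - 2" H h])
    show "\<forall>v\<in>{ab, ac, ad, bc, bd, cd}. mult_ge v (k - 2) H"
    proof
      fix v assume v: "v \<in> {ab, ac, ad, bc, bd, cd}"
      then have "k \<le> mult_at v G" using less.prems(2,5) mult_ge_iff_mult_at by blast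
      also have "\<dots> = 2 + mult_at v H" unfolding H using quad_mult[OF Q v] mult_at_mult[OF Qf(2) H0] by simp
      finally show "mult_ge v (k - 2) H" using H0 by (simp add: mult_ge_iff_mult_at)
    qed
  qed (use \<open>2 < k\<close> less.prems ih H0 \<open>i = 4\<close> in auto)
qed

text \<open>If \<open>V\<close> consists of the six vertices of a complete quadrilateral, the initial degree for even \<open>k\<close> is at most \<open>2 k\<close>,
  attained by powers of the product of the four lines, but for odd \<open>k\<close> it is larger than \<open>2 k\<close>.\<close>

lemma not_quad:
  assumes Q: "quad a b c d ab ac ad bc bd cd"
  shows False
proof -
  let ?P = "{ab, ac, ad, bc, bd, cd}" and ?Q = "a * b * c * d"
  have "X \<in> ?P" if X: "X \<in> V" for X
    using quad_extra_off_lines[OF Q X] quad_extra_on_line[OF Q X] quad_extra_on_line[OF quad_perm(1)[OF Q] X]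
      quad_extra_on_line[OF quad_perm(2)[OF Q] X] quad_extra_on_line[OF quad_perm(3)[OF Q] X] by blast
  then have P: "V = ?P" using Q by (auto simp: quad_def)
  \<comment> \<open>Twice \<open>i\<close> is \<open>n\<close> or \<open>n - 1\<close>; in the
    second case one jump of \<open>growth\<close> carries the bound 2 n over to
    \<open>n\<close>.\<close>
  define i where "i = n div 2"
  have "has_form V (2 * i) (4 * i)"
    unfolding has_form_def
  proof (intro exI conjI ballI)
    show "?Q ^ i \<noteq> 0" using quad_form[OF Q] by simp
    show "is_form (4 * i) (?Q ^ i)" using is_form_power[of 4 ?Q i] quad_form[OF Q] by (simp only: mult.commute)
    fix v assume "v \<in> V"
    then have "mult_at v (?Q ^ i) = i * 2"
      using quad_mult[OF Q, of v] mult_at_power[of ?Q v i] quad_form[OF Q] P by auto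
    then show "mult_ge v (2 * i) (?Q ^ i)" using mult_ge_mult_at[of v "?Q ^ i"] by (simp add: mult.commute)
  qed
  then have "alpha V (2 * i) \<le> 4 * i" by (rule alpha_le)
  moreover have "alpha V n = alpha V (2 * i) + 2 * (n - 2 * i)"
    using growth[of "n - 2 * i"] by (simp add: i_def)
  moreover have "2 * i \<le> n" by (simp add: i_def)
  ultimately have t: "t \<le> 2 * n" by linarith
  \<comment> \<open>Stepping back to an odd index, if needed, preserves slope at most 2, which
    \<open>quad_no_odd\<close> refutes.\<close>
  define k where "k = (if odd n then n else n - 1)"
  have k: "odd k" "k \<le> n" "n - k \<le> 5" using n by (auto simp: k_def)
  have "alpha V n = alpha V k + 2 * (n - k)" using growth[OF k(3)] k(2) by simp
  then have "alpha V k \<le> 2 * k" using t k(2) by linarith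
  moreover obtain G where "G \<noteq> 0" "is_form (alpha V k) G" "\<forall>v\<in>V. mult_ge v k G"
    using has_form_alpha[OF V, of k] unfolding has_form_def by (elim exE conjE) (rule that)
  ultimately show False using quad_no_odd[OF Q k(1)] P by metis
qed

text \<open>The lines \<open>l\<close>, \<open>r\<close>, \<open>q\<close> form a triangle with
  vertices \<open>B1\<close>, \<open>A1\<close>, \<open>P\<close> and third points
  \<open>A2\<close>, \<open>B2\<close>, \<open>R\<close>. If these are not collinear,
  \<open>triangle\<close> applies; otherwise their line completes a quadrilateral.\<close>

lemma two_lines_and_transversal:
  assumes mem: "P \<in> V" "A1 \<in> V" "A2 \<in> V" "B1 \<in> V" "B2 \<in> V" "R \<in> V"
    and l: "incident P l" "incident A1 l" "incident A2 l" and r: "incident P r" "incident B1 r" "incident B2 r"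
    and q: "incident A1 q" "incident B1 q" "incident R q"
    and off: "\<not> incident R l" "\<not> incident R r" "\<not> incident B1 l" "\<not> incident B2 l"
    and ne: "P \<noteq> A1" "P \<noteq> A2" "A1 \<noteq> A2" "P \<noteq> B1" "P \<noteq> B2" "B1 \<noteq> B2"
  shows False
proof -
  have r': "\<not> incident A1 r" "\<not> incident A2 r"
    using off_line[of P l A1 r B1] off_line[of P l A2 r B1] l r ne mem off by auto
  have q': "\<not> incident P q" "\<not> incident A2 q" "\<not> incident B2 q"
    using off_line[of A1 l P q R] off_line[of A1 l A2 q R] off_line[of B1 r B2 q R] l r q ne mem off by auto
  show False
  proof (cases "coll A2 B2 R")
    case False
    show False
      by (rule triangle[of B1 A1 P A2 B2 R l r q]) (use l r q off r' q' ne mem False in auto)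
  next
    case True
    then obtain s where s: "incident A2 s" "incident B2 s" "incident R s" by (auto simp: coll_def)
    have "\<not> incident P s" "\<not> incident A1 s" "\<not> incident B1 s"
      using off_line[of A2 l P s R] off_line[of A2 l A1 s R] off_line[of B2 r B1 s R] l r s ne mem off by auto
    then have "quad l r q s P A1 A2 B1 B2 R" unfolding quad_def using l r q s off r' q' mem by simp
    then show False by (rule not_quad)
  qed
qed

text \<open>If the conic \<open>K\<close> through \<open>A\<^sub>1, A\<^sub>2, B\<^sub>1, B\<^sub>2, R\<close> is irreducible, then \<open>K\<^sup>2 l r m\<close> with \<open>m\<close> the line \<open>P R\<close> divides \<open>F\<close>; it has
  degree 7 and multiplicity at most 3 at the points.\<close>

lemma two_lines_and_point:
  assumes mem: "P \<in> V" "A1 \<in> V" "A2 \<in> V" "B1 \<in> V" "B2 \<in> V" "R \<in> V"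
    and l: "incident P l" "incident A1 l" "incident A2 l" and r: "incident P r" "incident B1 r" "incident B2 r"
    and off: "\<not> incident R l" "\<not> incident R r" "\<not> incident B1 l" "\<not> incident B2 l"
    and ne: "P \<noteq> A1" "P \<noteq> A2" "A1 \<noteq> A2" "P \<noteq> B1" "P \<noteq> B2" "B1 \<noteq> B2"
  shows False
proof -
  note lines = l(1)[THEN incident_line] r(1)[THEN incident_line]
  have r': "\<not> incident A1 r" "\<not> incident A2 r"
    using off_line[of P l A1 r B1] off_line[of P l A2 r B1] l r ne mem off by auto
  have nc1: "\<not> coll A1 B1 R"
    using two_lines_and_transversal[OF mem l r _ _ _ off ne] by (auto simp: coll_def)
  have nc2: "\<not> coll A2 B1 R"
    using two_lines_and_transversal[OF mem(1,3,2,4-6) l(1,3,2) r _ _ _ off] ne by (auto simp: coll_def)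
  have nc3: "\<not> coll A1 B2 R"
    using two_lines_and_transversal[OF mem(1-3,5,4,6) l r(1,3,2) _ _ _ off(1,2,4,3)] ne by (auto simp: coll_def)
  have nc4: "\<not> coll A2 B2 R"
    using two_lines_and_transversal[OF mem(1,3,2,5,4,6) l(1,3,2) r(1,3,2) _ _ _ off(1,2,4,3)] ne by (auto simp: coll_def)
  have onl: "\<not> coll A1 A2 w" if "\<not> incident w l" for w
    using same_line[of A1 _ A2 l w] l ne mem that by (auto simp: coll_def)
  have onr: "\<not> coll w B1 B2" if "\<not> incident w r" for w
    using same_line[of B1 _ B2 r w] r ne mem that by (auto simp: coll_def)
  let ?W = "{A1, A2, B1, B2, R}"
  have W: "?W \<subseteq> V" "card ?W = 5"
    using mem ne l off r r' by (auto simp: card_insert_if)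
  obtain K where K0: "K \<noteq> 0" "is_form 2 K" "\<forall>v\<in>?W. poly3_eval K v = 0"
    using exists_conic[OF W] by (elim exE conjE) (rule that)
  have "irreducible K"
  proof (rule irreducible_conic[OF K0(1,2), of ?W])
    show "\<exists>v\<in>U. poly3_eval L v \<noteq> 0" if "is_line L" "U \<subseteq> ?W" "card U = 3" for L U
      by (rule no_three_of_five[of A1 A2 B1 B2 R, OF onl onl onl onr nc1 nc3 onr nc2 nc4 _ that])
         (use off r' onr[OF off(2)] coll_commute(1)[of R B1 B2] coll_commute(2)[of B1 R B2] in auto)
  qed (use K0(3) W in auto)
  note K = this K0(2)
  have KW: "poly3_eval K A1 = 0" "poly3_eval K A2 = 0" "poly3_eval K B1 = 0" "poly3_eval K B2 = 0" "poly3_eval K R = 0"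
    using K0(3) by auto
  have Kl: "v = A1 \<or> v = A2" if "v \<in> V" "incident v l" "poly3_eval K v = 0" for v
    using line_meets_conic[OF K l(2,3) that(2) mem(2,3) that(1) ne(3) _ _ KW(1,2)] that(3) by blast
  have Kr: "v = B1 \<or> v = B2" if "v \<in> V" "incident v r" "poly3_eval K v = 0" for v
    using line_meets_conic[OF K r(2,3) that(2) mem(4,5) that(1) ne(6) _ _ KW(3,4)] that(3) by blast
  have KP: "poly3_eval K P \<noteq> 0" using Kl[OF mem(1) l(1)] ne by auto
  have Kmult: "mult_at v K = (if poly3_eval K v = 0 then 1 else 0)" if v: "v \<in> V" for v
  proof (cases "poly3_eval K v = 0")
    case True
    obtain u where "u \<in> V" "v \<noteq> u" "poly3_eval K u = 0" using mem(2,3) KW(1,2) ne(3) by metis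
    then show ?thesis using conic_mult[OF K v] True by simp
  next
    case False
    then show ?thesis using one_le_mult_at_iff[OF K0(1), of v] by simp
  qed
  obtain m where m: "incident P m" "incident R m" using join[OF mem(1,6)] by (elim exE conjE) (rule that)
  have ml: "\<not> incident A1 m" "\<not> incident A2 m" "\<not> incident B1 m" "\<not> incident B2 m"
    using off_line[of P l A1 m R] off_line[of P l A2 m R] off_line[of P r B1 m R] off_line[of P r B2 m R] l r m ne mem off by auto
  have mline: "is_line m" using m(1) by (rule incident_line)
  have dist: "\<not> K dvd l" "\<not> K dvd r" "\<not> l dvd K" "\<not> r dvd K" "\<not> l dvd r" "\<not> r dvd l"
    using conic_not_dvd_line[OF K] line_not_dvd_conic[OF K] lines dvd_incident[of l r A1] dvd_incident[of r l B1] l r r' off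
    by blast+
  then have ne': "K \<noteq> l" "K \<noteq> r" "l \<noteq> r" by auto
  let ?S = "{K, l, r}"
  have "\<exists>x G g. residual ?S x G g"
    by (rule exists_residual) (use K ord0_conic[OF K] lines dist irreducible_line_ord0 in auto)
  then obtain x G g where G: "F = (\<Prod>C\<in>?S. C ^ x C) * G" "is_form g G" "G \<noteq> 0" "(\<Sum>C\<in>?S. x C * ord0 C) + g = t"
    "\<forall>v\<in>V. n \<le> (\<Sum>C\<in>?S. x C * mult_at v C) + mult_at v G"
    "\<forall>C\<in>?S. \<exists>H. F = C ^ x C * H \<and> \<not> C dvd H"
    unfolding residual_def by (elim exE conjE) (rule that)
  have Geq: "F = K ^ x K * l ^ x l * r ^ x r * G" unfolding G(1) using ne' by (simp add: mult.assoc)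
  have deg: "2 * x K + x l + x r + g = t"
    using G(4) ne' ord0_conic[OF K] ord0_line[OF lines(1)] ord0_line[OF lines(2)] by simp
  have mult: "n \<le> x K * mult_at v K + x l * mult_at v l + x r * mult_at v r + mult_at v G" if "v \<in> V" for v
    using G(5) that ne' by (simp add: add.assoc)
  have xK: "5 * n \<le> x K + 2 * t"
  proof -
    obtain H where H: "F = K ^ x K * H" "\<not> K dvd H" using G(6) by blast
    show ?thesis by (rule conic_exponent[OF K W _ H]) (use K0(3) in blast)
  qed
  have xl: "3 * n \<le> 2 * x l + t"
  proof -
    obtain H where "F = l ^ x l * H" "\<not> l dvd H" using G(6) by blast
    then show ?thesis by (rule line_exponent[OF l mem(1-3) ne(1-3)])
  qed
  have xr: "3 * n \<le> 2 * x r + t"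
  proof -
    obtain H where "F = r ^ x r * H" "\<not> r dvd H" using G(6) by blast
    then show ?thesis by (rule line_exponent[OF r mem(1,4,5) ne(4-6)])
  qed
  have mG: "mult_ge P (n - (x l + x r)) G" "mult_ge R (n - x K) G"
    using mult[OF mem(1)] mult[OF mem(6)] l(1) r(1) off mem lines G(3) KP KW(5)
    by (simp_all add: mult_line mult_ge_iff_mult_at Kmult)
  have "P \<noteq> R" using l(1) off(1) by auto
  \<comment> \<open>The two multiplicities on \<open>m\<close> exceed the degree of the cofactor as
    soon as t < 2 n + x K. By x K >= 5 n - 2 t it suffices that 3 t < 7 n.\<close>
  have "m dvd G"
  proof (rule line_dvd[OF V, of "{P, R}" m g G "\<lambda>v. if v = P then n - (x l + x r) else n - x K"])
    show "g < (\<Sum>v\<in>{P, R}. if v = P then n - (x l + x r) else n - x K)"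
      using \<open>P \<noteq> R\<close> deg xK bound n by simp
  qed (use m mG mem G(2) in \<open>auto simp: incident_def\<close>)
  let ?K = "K ^ 2 * l ^ 1 * r ^ 1 * m"
  \<comment> \<open>Here x K >= 5 n - 2 t >= n/2, which exceeds 2, and the exponents of both lines
    are at least 3 n/8.\<close>
  have "?K dvd F"
    unfolding Geq using xK xl xr bound n \<open>m dvd G\<close> by (intro mult_dvd_mono le_imp_power_dvd) linarith+
  moreover have nz: "K \<noteq> 0" "l \<noteq> 0" "r \<noteq> 0" "m \<noteq> 0" and forms: "is_form 1 l" "is_form 1 r" "is_form 1 m"
    using lines mline K0(1) by (auto simp: is_line_def)
  moreover have "is_form (2 * 2 + 1 * 1 + 1 * 1 + 1) ?K"
    by (intro is_form_mult is_form_power forms K(2))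
  \<comment> \<open>The conic meets \<open>l\<close> and \<open>r\<close> within \<open>V\<close>
    only in the chosen points, which lie on no other factor: at most 2 + 1 on the conic, at most
    three lines off it.\<close>
  moreover have "mult_at v ?K \<le> 3" if v: "v \<in> V" for v
  proof -
    have a: "poly3_eval K v = 0 \<Longrightarrow> incident v l \<Longrightarrow> \<not> incident v r \<and> \<not> incident v m"
      using Kl[OF v] r' ml by blast
    have b: "poly3_eval K v = 0 \<Longrightarrow> incident v r \<Longrightarrow> \<not> incident v l \<and> \<not> incident v m"
      using Kr[OF v] off ml by blast
    have "mult_at v ?K = 2 * mult_at v K + mult_at v l + mult_at v r + mult_at v m"
      using nz by (simp add: mult_at_mult mult_at_power)
    also have "\<dots> \<le> 3" using a b lines mline v by (simp add: mult_line Kmult)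
    finally show ?thesis .
  qed
  ultimately have "2 * 2 + 1 * 1 + 1 * 1 + 1 \<le> 2 * (3::nat)" by (intro removal) auto
  then show False by simp
qed

section \<open>Excluding three collinear points, and the final contradiction\<close>

lemma exists_off_two_lines:
  assumes "is_line l" "is_line m"
  shows "\<exists>v\<in>V. \<not> incident v l \<and> \<not> incident v m"
proof (rule ccontr)
  assume *: "\<not> ?thesis"
  have "l * m \<noteq> 0" using assms by (simp add: is_line_def)
  moreover have "is_form (Suc 0 + Suc 0) (l * m)" using assms unfolding is_line_def by (intro is_form_mult) auto
  moreover have "poly3_eval (l * m) v = 0" if "v \<in> V" for v
    using * that assms by (auto simp: incident_def eval.hom_mult)
  ultimately have "has_form V (Suc 0) 2"
    unfolding has_form_def by (intro exI[of _ "l * m"]) (simp add: mult_ge_1_iff numeral_2_eq_2)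
  then show False using nonconic by simp
qed

text \<open>No two lines contain \<open>V\<close>, so three noncollinear points can be chosen off
  the line. A line through one point of the first triple and two of the second would be excluded by
  \<open>two_lines_and_point\<close>. Hence, after removal of any \<open>Ti\<close>, no three of the
  remaining five points are collinear, and \<open>three_conics\<close> applies.\<close>

lemma no_three_on_line:
  assumes l: "incident T1 l" "incident T2 l" "incident T3 l" and T: "T1 \<in> V" "T2 \<in> V" "T3 \<in> V" "T1 \<noteq> T2" "T1 \<noteq> T3" "T2 \<noteq> T3"
  shows False
proof -
  note lline = l(1)[THEN incident_line]
  obtain R1 where R1: "R1 \<in> V" "\<not> incident R1 l" using exists_off_two_lines[OF lline lline] by blast
  \<comment> \<open>Joining \<open>R1\<close> to itself merely provides some line through it; a
    point off that line differs from \<open>R1\<close>.\<close>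
  obtain m where m: "incident R1 m" using join[OF R1(1) R1(1)] by blast
  obtain R2 where R2: "R2 \<in> V" "\<not> incident R2 l" "\<not> incident R2 m"
    using exists_off_two_lines[OF lline incident_line[OF m]] by blast
  have R12: "R1 \<noteq> R2" using m R2 by auto
  obtain m' where m': "incident R1 m'" "incident R2 m'" using join[OF R1(1) R2(1)] by (elim exE conjE) (rule that)
  obtain R3 where R3: "R3 \<in> V" "\<not> incident R3 l" "\<not> incident R3 m'"
    using exists_off_two_lines[OF lline incident_line[OF m'(1)]] by blast
  have R: "\<not> coll R1 R2 R3" using same_line[of R1 _ R2 m' R3] R12 R1 R2 m' R3(3) by (auto simp: coll_def)
  have R3': "R3 \<noteq> R1" "R3 \<noteq> R2" using m' R3 by auto
  have nc: "\<not> coll T Ra Rb" if T': "T \<in> {T1, T2, T3}" and R': "{Ra, Rb, Rc} = {R1, R2, R3}" "Ra \<noteq> Rb" "Ra \<noteq> Rc" "Rb \<noteq> Rc" for T Ra Rb Rc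
  proof
    assume "coll T Ra Rb"
    then obtain r where r: "incident T r" "incident Ra r" "incident Rb r" by (auto simp: coll_def)
    obtain T' T'' where TT: "T' \<in> {T1, T2, T3}" "T'' \<in> {T1, T2, T3}" "T \<noteq> T'" "T \<noteq> T''" "T' \<noteq> T''"
      using T' T by blast
    have Rs: "Ra \<in> {R1, R2, R3}" "Rb \<in> {R1, R2, R3}" "Rc \<in> {R1, R2, R3}" using R'(1) by auto
    have Roff: "\<not> incident Ra l" "\<not> incident Rb l" "\<not> incident Rc l" and RV: "Ra \<in> V" "Rb \<in> V" "Rc \<in> V"
      using Rs R1 R2 R3 by auto
    have "\<not> incident Rc r"
    proof
      assume "incident Rc r"
      then have "\<forall>R\<in>{Ra, Rb, Rc}. incident R r" using r by simp
      then show False using R unfolding R'(1) by (auto simp: coll_def)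
    qed
    moreover have "T \<noteq> Ra" "T \<noteq> Rb" using T' l Roff by auto
    ultimately show False
      using two_lines_and_point[of T T' T'' Ra Rb Rc l r] T T' TT RV l r Roff R' by auto
  qed
  have onl: "\<not> coll A B w" if "A \<in> {T1, T2, T3}" "B \<in> {T1, T2, T3}" "A \<noteq> B" "\<not> incident w l" for A B w
    using same_line[of A _ B l w] l T that by (auto simp: coll_def)
  let ?W = "{T1, T2, T3, R1, R2, R3}"
  have TR: "T1 \<noteq> R1" "T1 \<noteq> R2" "T1 \<noteq> R3" "T2 \<noteq> R1" "T2 \<noteq> R2" "T2 \<noteq> R3" "T3 \<noteq> R1" "T3 \<noteq> R2" "T3 \<noteq> R3"
    using l R1 R2 R3 by auto
  show False
  proof (rule three_conics[of ?W T1 T2 T3])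
    show "?W \<subseteq> V" using T R1 R2 R3 by auto
    show "card ?W = 6" using T(4-6) TR R12 R3' by simp
    show "\<exists>v\<in>?W. poly3_eval K v \<noteq> 0" if K: "K \<noteq> 0" "is_form 2 K" for K
    proof (rule ccontr)
      assume *: "\<not> ?thesis"
      have "l dvd K"
        by (rule line_dvd[OF V, of "{T1, T2, T3}" l 2 K "\<lambda>_. 1"]) (use T l lline K * in \<open>auto simp: incident_def mult_ge_1_iff\<close>)
      then obtain H where H: "K = l * H" by (rule dvdE)
      obtain i h where ih: "is_form i l" "is_form h H" "i + h = 2" using dvd_form_imp_form[OF K(2,1) H] .
      have "i = Suc 0" using is_form_unique[OF ih(1)] lline by (auto simp: is_line_def)
      then have Hline: "is_line H" using ih K(1) H by (auto simp: is_line_def)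
      have "poly3_eval H R = 0" if "R \<in> {R1, R2, R3}" for R
      proof -
        have "poly3_eval l R \<noteq> 0" using that R1(2) R2(2) R3(2) lline by (auto simp: incident_def)
        moreover have "poly3_eval K R = 0" using * that by blast
        ultimately show ?thesis unfolding H by (simp add: eval.hom_mult)
      qed
      then have "coll R1 R2 R3" using Hline by (auto simp: coll_def incident_def)
      then show False using R by simp
    qed
    show "\<exists>v\<in>U. poly3_eval L v \<noteq> 0" if w: "w \<in> {T1, T2, T3}" and U: "is_line L" "U \<subseteq> ?W - {w}" "card U = 3" for w L U
    proof -
      obtain A B where AB: "A \<in> {T1, T2, T3}" "B \<in> {T1, T2, T3}" "A \<noteq> B" "?W - {w} = {A, B, R1, R2, R3}"
      proof -
        consider "w = T1" | "w = T2" | "w = T3" using w by blast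
        then show ?thesis
        proof cases
          case 1
          then show ?thesis using that[of T2 T3] T(4-6) TR by auto
        next
          case 2
          then show ?thesis using that[of T1 T3] T(4-6) TR by auto
        next
          case 3
          then show ?thesis using that[of T1 T2] T(4-6) TR by auto
        qed
      qed
      have n12: "\<not> coll X R1 R2" and n13: "\<not> coll X R1 R3" and n23: "\<not> coll X R2 R3" if "X \<in> {T1, T2, T3}" for X
        using nc[OF that, of R1 R2 R3] nc[OF that, of R1 R3 R2] nc[OF that, of R2 R3 R1] R12 R3' by auto
      show ?thesis
        by (rule no_three_of_five[OF onl[OF AB(1-3)] onl[OF AB(1-3)] onl[OF AB(1-3)] n12[OF AB(1)] n13[OF AB(1)] n23[OF AB(1)]
              n12[OF AB(2)] n13[OF AB(2)] n23[OF AB(2)] R U(1) _ U(3)])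
           (use R1 R2 R3 U(2) AB(4) in auto)
    qed
  qed (use T in auto)
qed

text \<open>With no collinear triples, five points lie on an irreducible conic and a sixth point
  \<open>P\<close> lies off it. A second conic through the five would meet the first in more than 4
  points, so no conic contains all six and \<open>three_conics\<close> applies.\<close>

lemma contradiction: False
proof -
  have no3: "\<exists>v\<in>U. poly3_eval L v \<noteq> 0" if U: "is_line L" "U \<subseteq> V" "card U = 3" for L U
  proof (rule ccontr)
    assume *: "\<not> ?thesis"
    obtain u v w where "U = {u, v, w}" "u \<noteq> v" "u \<noteq> w" "v \<noteq> w" using U(3) by (auto simp: card_3_iff)
    then show False using no_three_on_line[of u L v w] * U by (auto simp: incident_def)
  qed
  have "\<not> card V \<le> 5" using has_form_few_points[OF V, of 2] nonconic by auto
  then obtain W where W: "W \<subseteq> V" "card W = 5" using obtain_subset_with_card_n[of 5 V] by auto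
  have finW: "finite W" by (rule finite_subset[OF W(1) finite_V])
  obtain K where K: "K \<noteq> 0" "is_form 2 K" "\<forall>v\<in>W. poly3_eval K v = 0"
    using exists_conic[OF W] by (elim exE conjE) (rule that)
  have irr: "irreducible K"
    by (rule irreducible_conic[OF K(1,2), of W]) (use K(3) W finW no3 in auto)
  obtain P where P: "P \<in> V" "poly3_eval K P \<noteq> 0"
    using nonconic K(1,2) by (auto simp: has_form_def mult_ge_1_iff)
  have PW: "P \<notin> W" using K(3) P(2) by blast
  obtain U where U: "U \<subseteq> W" "card U = 2" using obtain_subset_with_card_n[of 2 W] W(2) by auto
  obtain w1 w2 where w: "U = {w1, w2}" "w1 \<noteq> w2" using U(2) by (auto simp: card_2_iff)
  show False
  proof (rule three_conics[of "insert P W" P w1 w2])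
    show "card (insert P W) = 6" using W PW finW by simp
    show "\<exists>v\<in>insert P W. poly3_eval D v \<noteq> 0" if D: "D \<noteq> 0" "is_form 2 D" for D
    proof (rule ccontr)
      assume *: "\<not> ?thesis"
      have "K dvd D"
      proof (rule bezout_dvd[OF irr K(2) D(2) distinct_points_subset[OF V W(1)]])
        have "(\<Sum>v\<in>W. 1) \<le> (\<Sum>v\<in>W. mult_at v K * mult_at v D)"
        proof (rule sum_mono)
          fix v assume "v \<in> W"
          then have "Suc 0 \<le> mult_at v K" "Suc 0 \<le> mult_at v D"
            using K(1,3) D(1) * by (simp_all add: one_le_mult_at_iff)
          then show "1 \<le> mult_at v K * mult_at v D" by (simp add: Suc_le_eq)
        qed
        then show "2 * 2 < (\<Sum>v\<in>W. mult_at v K * mult_at v D)" using W(2) by simp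
      qed
      then obtain H where H: "D = K * H" by (rule dvdE)
      obtain i h where ih: "is_form i K" "is_form h H" "i + h = 2" using dvd_form_imp_form[OF D(2,1) H] .
      have "i = 2" by (rule is_form_unique[OF ih(1) K(2,1)])
      then have "H = const (coef H 0)" using is_form_0_eq_const[of H] ih by simp
      then obtain c where c: "H = const c" by blast
      have "c \<noteq> 0" using c H D(1) by auto
      moreover have "poly3_eval D P = poly3_eval K P * c" unfolding H c by (simp add: eval.hom_mult)
      ultimately show False using * P(2) by auto
    qed
    show "\<exists>v\<in>U. poly3_eval L v \<noteq> 0" if "is_line L" "U \<subseteq> insert P W - {w}" "card U = 3" for w L U
      using no3[OF that(1) _ that(3)] that(2) W(1) P(1) by blast
  qed (use W P PW U w in auto)
qed

end

theorem alpha_jump_two: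
  fixes V :: "('k::field_char_0 ^ 3) set"
  assumes V: "distinct_points V" and m: "0 < m"
    and jump: "\<And>j. j \<le> 5 \<Longrightarrow> alpha V (m + j) = alpha V m + 2 * j"
  shows "has_form V (Suc 0) 2"
proof (rule ccontr)
  assume *: "\<not> has_form V (Suc 0) 2"
  have t: "alpha V (m + 5) = alpha V m + 10" using jump[of 5] by simp
  interpret double_growth V "m + 5"
  proof
    show "alpha V (m + 5) = alpha V (m + 5 - j) + 2 * j" if "j \<le> 5" for j
      using jump[of "5 - j"] t that by simp
    show "4 * alpha V (m + 5) \<le> 9 * (m + 5)"
    proof (cases "alpha V m \<le> 2 * m")
      case False
      then have "alpha V (m + 5) * m < alpha V m * (m + 5)" unfolding t by (simp add: algebra_simps)
      \<comment> \<open>Clearing products leaves 4 a <= 9 m + 5 for the initial degree a at m;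
        adding 40 gives the bound at m + 5.\<close>
      then have "(alpha V m + 1) * (m + 5) \<le> (m + 1) * alpha V (m + 5)"
        by (intro initial_degree_growth_alpha[OF V]) auto
      then show ?thesis unfolding t by (simp add: algebra_simps)
    qed (simp add: t)
  qed (use V m * in auto)
  show False by (rule contradiction)
qed

subsection \<open>A grid together with the points at infinity of its two directions\<close>

definition point :: "'k \<Rightarrow> 'k \<Rightarrow> 'k \<Rightarrow> 'k::field ^ 3" where
  "point a b c = (\<chi> i. if i = 1 then a else if i = 2 then b else c)"

lemma point_nth [simp]: "point a b c $ 1 = a" "point a b c $ 2 = b" "point a b c $ 3 = c"
  by (simp_all add: point_def)

lemma point_eq_iff: "point a b c = v \<longleftrightarrow> a = v $ 1 \<and> b = v $ 2 \<and> c = v $ 3"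
  by (auto simp: Finite_Cartesian_Product.vec_eq_iff forall_3)

abbreviation grid_point :: "nat \<Rightarrow> nat \<Rightarrow> 'k::field_char_0 ^ 3" where
  "grid_point i j \<equiv> point (of_nat i) (of_nat j) 1"

text \<open>The two extra points are the centres of the pencils of grid lines: every
  \<open>grid_line 1 i\<close> passes through \<open>point 0 1 0\<close>, every
  \<open>grid_line 2 j\<close> through \<open>point 1 0 0\<close>.\<close>

definition grid :: "nat \<Rightarrow> ('k::field_char_0 ^ 3) set" where
  "grid d = (\<lambda>(i, j). grid_point i j) ` ({..<d} \<times> {..<d}) \<union> {point 1 0 0, point 0 1 0}"

definition grid_line :: "3 \<Rightarrow> nat \<Rightarrow> 'k::field_char_0 poly3" where
  "grid_line k i = var k - const (of_nat i) * var 3"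

lemma eval_grid_line: "poly3_eval (grid_line k i) v = v $ k - of_nat i * v $ 3"
  by (simp add: grid_line_def eval.hom_minus eval.hom_mult del: single_of_nat)

lemma is_line_grid_line:
  assumes "k \<noteq> 3"
  shows "is_line (grid_line k i :: 'k::field_char_0 poly3)"
  unfolding is_line_def
proof
  have "poly3_eval (grid_line k i :: 'k poly3) (\<chi> l. if l = k then 1 else 0) = 1"
    using assms by (simp add: eval_grid_line)
  then show "grid_line k i \<noteq> (0 :: 'k poly3)" by auto
  have "is_form (0 + Suc 0) (const (of_nat i) * var 3 :: 'k poly3)" by (intro is_form_mult is_form_const is_form_var)
  then show "is_form (Suc 0) (grid_line k i :: 'k poly3)"
    unfolding grid_line_def by (intro is_form_diff is_form_var) simp
qed

lemma three_ne: "(1::3) \<noteq> 3" "(2::3) \<noteq> 3" "(1::3) \<noteq> 2"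
  by simp_all

lemma distinct_points_grid: "distinct_points (grid d :: ('k::field_char_0 ^ 3) set)"
proof -
  have nz: "v \<noteq> 0" if "v \<in> grid d" for v :: "'k ^ 3"
    using that by (auto simp: grid_def point_eq_iff)
  have eq: "v = w" if vw: "v \<in> grid d" "w \<in> grid d" "v = c *s w" for v w :: "'k ^ 3" and c
  proof -
    have comp: "v $ i = c * w $ i" for i using vw(3) by simp
    have c: "c \<noteq> 0" using nz[OF vw(1)] vw(3) by auto
    have grid: "u $ 3 = 1 \<or> u = point 1 0 0 \<or> u = point 0 1 0" if "u \<in> grid d" for u :: "'k ^ 3"
      using that by (auto simp: grid_def)
    from grid[OF vw(1)] show ?thesis
    proof (elim disjE)
      assume v: "v $ 3 = 1"
      then have "w $ 3 \<noteq> 0" using comp[of 3] by auto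
      then have "w $ 3 = 1" using grid[OF vw(2)] by auto
      then have "c = 1" using comp[of 3] v by simp
      then show ?thesis using vw(3) by simp
    next
      assume v: "v = point 1 0 0"
      then have "w $ 2 = 0" "w $ 3 = 0" using comp[of 2] comp[of 3] c by simp_all
      then have "w = point 1 0 0" using grid[OF vw(2)] by auto
      then show ?thesis using v by simp
    next
      assume v: "v = point 0 1 0"
      then have "w $ 1 = 0" "w $ 3 = 0" using comp[of 1] comp[of 3] c by simp_all
      then have "w = point 0 1 0" using grid[OF vw(2)] by auto
      then show ?thesis using v by simp
    qed
  qed
  show ?thesis unfolding distinct_points_def
  proof (intro conjI ballI impI allI notI)
    show "finite (grid d)" by (simp add: grid_def)
    show False if "v \<in> grid d" "v = 0" for v :: "'k ^ 3" using nz that by blast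
    show False if "v \<in> grid d" "w \<in> grid d" "v \<noteq> w" "v = c *s w" for v w :: "'k ^ 3" and c
      using eq[OF that(1,2,4)] that(3) by simp
  qed
qed

lemma grid_line_not_dvd:
  assumes "k \<noteq> 3" "l \<noteq> 3" "(k, i) \<noteq> (l, j)"
  shows "\<not> grid_line k i dvd (grid_line l j :: 'k::field_char_0 poly3)"
proof
  assume dvd: "grid_line k i dvd (grid_line l j :: 'k poly3)"
  \<comment> \<open>A point of the first line at which the second form takes the nonzero value i - j
    for equal directions and (j + 1) - j = 1 for different ones.\<close>
  let ?v = "(\<chi> p. if p = k then of_nat i else if p = 3 then 1 else of_nat (Suc j)) :: 'k ^ 3"
  have "poly3_eval (grid_line k i) ?v = 0" using assms by (simp add: eval_grid_line)
  then have "poly3_eval (grid_line l j) ?v = 0" by (rule dvd_imp_vanishes[OF dvd])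
  then show False using assms by (auto simp: eval_grid_line split: if_splits)
qed

abbreviation grid_lines :: "nat \<Rightarrow> 'k::field_char_0 poly3" where
  "grid_lines d \<equiv> (\<Prod>i<d. grid_line 1 i) * (\<Prod>j<d. grid_line 2 j)"

lemma prod_grid_lines_dvd:
  assumes "\<And>k i. k \<in> {1, 2} \<Longrightarrow> i < d \<Longrightarrow> grid_line k i dvd G"
  shows "grid_lines d dvd (G :: 'k::field_char_0 poly3)"
proof -
  let ?g = "\<lambda>(k, i). grid_line k i :: 'k poly3" and ?I = "{1, 2} \<times> {..<d}"
  have nd: "\<not> ?g x dvd ?g y" if "x \<in> ?I" "y \<in> ?I" "x \<noteq> y" for x y
    using that grid_line_not_dvd[of "fst x" "fst y" "snd x" "snd y", where 'k = 'k] by auto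
  then have inj: "inj_on ?g ?I" by (intro inj_onI) (metis dvd_refl)
  have "(\<Prod>C\<in>?g ` ?I. C) dvd G"
  proof (rule prod_dvd_form)
    show "irreducible C" if "C \<in> ?g ` ?I" for C
      using that by (auto intro!: irreducible_line is_line_grid_line)
    show "C dvd G" if "C \<in> ?g ` ?I" for C using that assms by auto
    fix C D assume CD: "C \<in> ?g ` ?I" "D \<in> ?g ` ?I" "C \<noteq> D"
    obtain x where x: "C = ?g x" "x \<in> ?I" using CD(1) by (rule imageE)
    obtain y where y: "D = ?g y" "y \<in> ?I" using CD(2) by (rule imageE)
    have "x \<noteq> y" using CD(3) x(1) y(1) by metis
    then show "\<not> C dvd D" unfolding x(1) y(1) by (rule nd[OF x(2) y(2)])
  qed simp
  then have "(\<Prod>x\<in>?I. ?g x) dvd G" using inj by (simp add: prod.reindex)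
  then show ?thesis by (simp flip: prod.cartesian_product)
qed

definition on_grid_line :: "nat \<Rightarrow> 3 \<Rightarrow> nat \<Rightarrow> ('k::field_char_0 ^ 3) set" where
  "on_grid_line d k i = (\<lambda>j. if k = 1 then grid_point i j else grid_point j i) ` {..<d}"

lemma on_grid_line:
  assumes "k \<in> {1, 2}" "i < d"
  shows "card (on_grid_line d k i :: ('k::field_char_0 ^ 3) set) = d"
    and "v \<in> on_grid_line d k i \<Longrightarrow> poly3_eval (grid_line k i) (v :: 'k ^ 3) = 0"
    and "(on_grid_line d k i :: ('k ^ 3) set) \<subseteq> (\<lambda>(i, j). grid_point i j) ` ({..<d} \<times> {..<d})"
proof -
  have "inj_on (\<lambda>j. if k = 1 then grid_point i j else grid_point j i :: 'k ^ 3) {..<d}"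
    by (auto simp: inj_on_def point_eq_iff)
  then show "card (on_grid_line d k i :: ('k ^ 3) set) = d" unfolding on_grid_line_def by (subst card_image) simp_all
qed (use assms in \<open>auto simp: on_grid_line_def eval_grid_line\<close>)

text \<open>Each grid line carries \<open>d\<close> grid points of multiplicity \<open>m\<close>,
  more than the degree allows.\<close>

lemma grid_lines_dvd:
  fixes G :: "'k::field_char_0 poly3"
  assumes G: "is_form e G" "\<And>i j. i < d \<Longrightarrow> j < d \<Longrightarrow> mult_ge (grid_point i j) m G" "e < d * m"
  shows "grid_lines d dvd G"
proof (rule prod_grid_lines_dvd)
  fix k :: 3 and i assume k: "k \<in> {1, 2}" "i < d"
  have "mult_ge v m G" if "v \<in> on_grid_line d k i" for v
    using on_grid_line(3)[OF k] that G(2) by auto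
  then show "grid_line k i dvd G"
    using on_grid_line[OF k, where 'k = 'k] k G(3)
    by (intro line_dvd[OF distinct_points_grid[of d] _ is_line_grid_line G(1), of "on_grid_line d k i" k i "\<lambda>_. m"])
       (auto simp: grid_def)
qed

text \<open>The point at infinity is the additional zero that makes d + 1 > e on every grid
  line.\<close>

lemma grid_lines_dvd_reduced:
  fixes G :: "'k::field_char_0 poly3"
  assumes G: "is_form e G" "\<And>v. v \<in> grid d \<Longrightarrow> mult_ge v (Suc 0) G" "e \<le> d"
  shows "grid_lines d dvd G"
proof (rule prod_grid_lines_dvd)
  fix k :: 3 and i assume k: "k \<in> {1, 2}" "i < d"
  let ?inf = "if k = 1 then point 0 1 0 else point 1 0 0 :: 'k ^ 3"
  have fin: "finite (on_grid_line d k i :: ('k ^ 3) set)" by (simp add: on_grid_line_def)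
  have "?inf \<notin> on_grid_line d k i" by (auto simp: on_grid_line_def point_eq_iff)
  then have card: "card (insert ?inf (on_grid_line d k i)) = Suc d"
    using on_grid_line(1)[OF k, where 'k = 'k] fin by simp
  show "grid_line k i dvd G"
  proof (rule line_dvd[OF distinct_points_grid[of d] _ is_line_grid_line G(1), of "insert ?inf (on_grid_line d k i)" k i "\<lambda>_. Suc 0"])
    show "e < (\<Sum>v\<in>insert ?inf (on_grid_line d k i). Suc 0)" using card G(3) by simp
    show sub: "insert ?inf (on_grid_line d k i) \<subseteq> grid d" using on_grid_line(3)[OF k, where 'k = 'k] by (auto simp: grid_def)
    fix v assume v: "v \<in> insert ?inf (on_grid_line d k i)"
    then have "poly3_eval (grid_line k i) v = 0"
      using on_grid_line(2)[OF k] k(1) by (auto simp: eval_grid_line)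
    then show "poly3_eval (grid_line k i) v = 0 \<and> mult_ge v (Suc 0) G" using sub v G(2) by blast
  qed (use k in auto)
qed

lemma is_form_prod_grid_line:
  assumes "k \<noteq> 3"
  shows "is_form d (\<Prod>i<d. grid_line k i :: 'k::field_char_0 poly3)" "(\<Prod>i<d. grid_line k i :: 'k poly3) \<noteq> 0"
proof -
  have "is_form (\<Sum>i<d. Suc 0) (\<Prod>i<d. grid_line k i :: 'k poly3)"
    using is_line_grid_line[OF assms] by (intro is_form_prod) (auto simp: is_line_def)
  then show "is_form d (\<Prod>i<d. grid_line k i :: 'k poly3)" by simp
  show "(\<Prod>i<d. grid_line k i :: 'k poly3) \<noteq> 0"
    using is_line_grid_line[OF assms] by (auto simp: is_line_def)
qed

lemma mult_at_grid_line:
  assumes "k \<noteq> 3" "v \<in> grid d"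
  shows "mult_at v (grid_line k i :: 'k::field_char_0 poly3) = (if v $ k = of_nat i * v $ 3 then 1 else 0)"
  using assms mult_at_line[OF is_line_grid_line[OF assms(1)], of v i] distinct_points_grid[where 'k = 'k, of d]
  by (auto simp: distinct_points_def eval_grid_line)

lemma mult_at_prod_grid_line:
  assumes "k \<noteq> 3" "v \<in> grid d"
  shows "mult_at v (\<Prod>i<d. grid_line k i :: 'k::field_char_0 poly3) = card {i. i < d \<and> v $ k = of_nat i * v $ 3}"
proof -
  have "mult_at v (\<Prod>i<d. grid_line k i :: 'k poly3) = (\<Sum>i<d. mult_at v (grid_line k i))"
    using is_line_grid_line[OF assms(1)] by (intro mult_at_prod) (auto simp: is_line_def)
  also have "\<dots> = (\<Sum>i<d. if v $ k = of_nat i * v $ 3 then 1 else 0)"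
    using mult_at_grid_line[OF assms] by simp
  also have "\<dots> = card {i. i < d \<and> v $ k = of_nat i * v $ 3}"
    by (simp add: sum.If_cases Int_def lessThan_def)
  finally show ?thesis .
qed

lemma mult_at_grid_point:
  assumes "i < d" "j < d"
  shows "mult_at (grid_point i j) (\<Prod>i<d. grid_line 1 i :: 'k::field_char_0 poly3) = 1"
    and "mult_at (grid_point i j) (\<Prod>j<d. grid_line 2 j :: 'k poly3) = 1"
proof -
  have "grid_point i j \<in> (grid d :: ('k ^ 3) set)" using assms by (auto simp: grid_def)
  moreover have "{p. p < d \<and> (of_nat i :: 'k) = of_nat p} = {i}" "{p. p < d \<and> (of_nat j :: 'k) = of_nat p} = {j}"
    using assms by auto
  ultimately show "mult_at (grid_point i j) (\<Prod>i<d. grid_line 1 i :: 'k poly3) = 1"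
    "mult_at (grid_point i j) (\<Prod>j<d. grid_line 2 j :: 'k poly3) = 1"
    by (simp_all add: mult_at_prod_grid_line)
qed

lemma mult_at_infinite_point:
  "mult_at (point 1 0 0) (\<Prod>j<d. grid_line 2 j :: 'k::field_char_0 poly3) = d"
  "mult_at (point 0 1 0) (\<Prod>i<d. grid_line 1 i :: 'k poly3) = d"
  using mult_at_prod_grid_line[of 2 "point 1 0 0 :: 'k ^ 3" d] mult_at_prod_grid_line[of 1 "point 0 1 0 :: 'k ^ 3" d]
  by (simp_all add: grid_def)

text \<open>Products of powers of the two pencils, with exponents a + b = m. A grid point gets
  multiplicity a + b, the points at infinity get a d and b d. Halving \<open>m\<close> keeps both at
  least \<open>m\<close>, since m <= 3 (m div 2) for m >= 2 and d >= 3.\<close>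

lemma grid_form:
  assumes d: "3 \<le> d" and m: "2 \<le> m"
  shows "has_form (grid d :: ('k::field_char_0 ^ 3) set) m (d * m)"
proof -
  let ?X = "\<Prod>i<d. grid_line 1 i :: 'k poly3" and ?Y = "\<Prod>j<d. grid_line 2 j :: 'k poly3"
  define a where "a = m div 2"
  define b where "b = m - a"
  have ab: "a + b = m" "m \<le> 3 * b" "m \<le> 3 * a" using m by (auto simp: a_def b_def)
  have "m \<le> a * d" "m \<le> b * d" using ab(2,3) mult_left_mono[OF d, of a] mult_left_mono[OF d, of b] by linarith+
  note X = is_form_prod_grid_line[OF three_ne(1), where 'k = 'k, of d] is_form_prod_grid_line[OF three_ne(2), where 'k = 'k, of d]
  have nz: "?X ^ a * ?Y ^ b \<noteq> 0" using X by simp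
  have "is_form (a * d + b * d) (?X ^ a * ?Y ^ b)" by (intro is_form_mult is_form_power X)
  moreover have "a * d + b * d = d * m" using ab(1) by (simp flip: add_mult_distrib add: mult.commute)
  moreover have "mult_ge v m (?X ^ a * ?Y ^ b)" if v: "v \<in> grid d" for v
  proof -
    have e: "mult_at v (?X ^ a * ?Y ^ b) = a * mult_at v ?X + b * mult_at v ?Y"
      using X by (simp add: mult_at_mult mult_at_power)
    consider i j where "i < d" "j < d" "v = grid_point i j" | "v = point 1 0 0" | "v = point 0 1 0"
      using v by (auto simp: grid_def)
    then have "m \<le> a * mult_at v ?X + b * mult_at v ?Y"
      using mult_at_grid_point[where 'k = 'k] mult_at_infinite_point[where 'k = 'k, of d] ab(1) \<open>m \<le> a * d\<close> \<open>m \<le> b * d\<close>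
      by cases simp_all
    then show ?thesis using nz e by (simp add: mult_ge_iff_mult_at)
  qed
  ultimately show ?thesis using nz unfolding has_form_def by metis
qed

text \<open>Descent by 2: below degree d m all 2 d grid lines split off, which lowers the degree by
  2 d and the multiplicities at the grid points by 2.\<close>

lemma grid_lower_bound:
  fixes G :: "'k::field_char_0 poly3"
  assumes "0 < d" "is_form e G" "G \<noteq> 0" "\<And>i j. i < d \<Longrightarrow> j < d \<Longrightarrow> mult_ge (grid_point i j) m G"
  shows "d * m \<le> e"
  using assms(2-)
proof (induction m arbitrary: e G rule: less_induct)
  case (less m)
  show ?case
  proof (rule ccontr)
    assume *: "\<not> d * m \<le> e"
    let ?X = "\<Prod>i<d. grid_line 1 i :: 'k poly3" and ?Y = "\<Prod>j<d. grid_line 2 j :: 'k poly3"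
    have "grid_lines d dvd G" by (rule grid_lines_dvd[OF less.prems(1,3)]) (use * in auto)
    then obtain H where H: "G = ?X * ?Y * H" by (rule dvdE)
    note X = is_form_prod_grid_line[OF three_ne(1), where 'k = 'k, of d] is_form_prod_grid_line[OF three_ne(2), where 'k = 'k, of d]
    have nz: "?X * ?Y \<noteq> 0" "H \<noteq> 0" using H less.prems(2) by auto
    obtain a b where ab: "is_form a (?X * ?Y)" "is_form b H" "a + b = e"
      using dvd_form_imp_form[OF less.prems(1,2) H] .
    have a: "a = d + d" by (rule is_form_unique[OF ab(1) is_form_mult[OF X(1,3)] nz(1)])
    have "d * (m - 2) \<le> b"
    proof (rule less.IH)
      show "m - 2 < m" using * by (cases m) auto
      fix i j assume ij: "i < d" "j < d"
      have "m \<le> mult_at (grid_point i j) G"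
        using less.prems(2) less.prems(3)[OF ij] by (simp add: mult_ge_iff_mult_at)
      also have "\<dots> = 2 + mult_at (grid_point i j) H"
        unfolding H using nz X mult_at_grid_point[OF ij, where 'k = 'k] by (simp add: mult_at_mult)
      finally show "mult_ge (grid_point i j) (m - 2) H" using nz(2) by (simp add: mult_ge_iff_mult_at)
    qed (use ab nz in auto)
    \<comment> \<open>For \<open>m\<close> equal to 1 the difference \<open>m - 2\<close> is
      truncated to 0; the contradiction is then e >= 2 d > d.\<close>
    then show False
      using * ab(3) a assms(1) by (cases "2 \<le> m") (auto simp: diff_mult_distrib2 not_le less_2_cases_iff)
  qed
qed

lemma alpha_grid:
  assumes "3 \<le> d" "2 \<le> m"
  shows "alpha (grid d :: ('k::field_char_0 ^ 3) set) m = d * m"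
proof (rule antisym)
  show "alpha (grid d :: ('k ^ 3) set) m \<le> d * m" by (rule alpha_le[OF grid_form[OF assms]])
  obtain G :: "'k poly3" where "G \<noteq> 0" "is_form (alpha (grid d :: ('k ^ 3) set) m) G" "\<forall>v\<in>grid d. mult_ge v m G"
    using has_form_alpha[OF distinct_points_grid, where 'k1 = 'k, of d m] unfolding has_form_def by (elim exE conjE) (rule that)
  then show "d * m \<le> alpha (grid d :: ('k ^ 3) set) m"
    using assms by (intro grid_lower_bound) (auto simp: grid_def)
qed

text \<open>A curve of degree at most d through all points would contain all 2 d grid lines.\<close>

lemma alpha_grid_reduced:
  assumes "0 < d"
  shows "d < alpha (grid d :: ('k::field_char_0 ^ 3) set) (Suc 0)"
proof (rule ccontr)
  assume *: "\<not> ?thesis"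
  obtain G :: "'k poly3" where G: "G \<noteq> 0" "is_form (alpha (grid d :: ('k ^ 3) set) (Suc 0)) G" "\<forall>v\<in>grid d. mult_ge v (Suc 0) G"
    using has_form_alpha[OF distinct_points_grid, where 'k1 = 'k, of d "Suc 0"] unfolding has_form_def by (elim exE conjE) (rule that)
  let ?X = "\<Prod>i<d. grid_line 1 i :: 'k poly3" and ?Y = "\<Prod>j<d. grid_line 2 j :: 'k poly3"
  have "grid_lines d dvd G" by (rule grid_lines_dvd_reduced[OF G(2)]) (use * G(3) in auto)
  then obtain H where H: "G = ?X * ?Y * H" by (rule dvdE)
  note X = is_form_prod_grid_line[OF three_ne(1), where 'k = 'k, of d] is_form_prod_grid_line[OF three_ne(2), where 'k = 'k, of d]
  obtain a b where ab: "is_form a (?X * ?Y)" "is_form b H" "a + b = alpha (grid d :: ('k ^ 3) set) (Suc 0)"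
    using dvd_form_imp_form[OF G(2,1) H] .
  have "a = d + d" using X by (intro is_form_unique[OF ab(1) is_form_mult[OF X(1,3)]]) simp
  then show False using ab(3) * assms by simp
qed

theorem corollaryA:
  shows "(\<forall>Z :: 'k::{alg_closed_field, field_char_0} proj_plane set.
            finite Z \<longrightarrow> (\<exists>m\<ge>1. beta_seq Z m = 1 \<and> beta_seq Z (m + 1) = 1) \<longrightarrow>
            initial_degree (radical_ideal Z) = 1 \<and> (\<exists>L. plane_curve 1 L \<and> Z \<subseteq> L))
       \<and> (\<forall>Z :: 'k proj_plane set.
            finite Z \<longrightarrow>
            (\<exists>m\<ge>1. beta_seq Z m = 2 \<and> beta_seq Z (m + 1) = 2 \<and> beta_seq Z (m + 2) = 2 \<and>
                   beta_seq Z (m + 3) = 2 \<and> beta_seq Z (m + 4) = 2) \<longrightarrow>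
            initial_degree (radical_ideal Z) = 2 \<and> (\<exists>C. plane_curve 2 C \<and> Z \<subseteq> C))
       \<and> (\<forall>d\<ge>3. \<exists>Z :: 'k proj_plane set.
            finite Z \<and> (\<forall>m\<ge>2. beta_seq Z m = int d) \<and> initial_degree (radical_ideal Z) \<ge> d + 1)"
proof (intro conjI allI impI)
  fix Z :: "'k proj_plane set"
  assume Z: "finite Z"
  obtain V where V: "distinct_points V" "abs_proj_plane ` V = Z"
    using coordinate_vectors[OF Z] by (elim exE conjE) (rule that)
  have V0: "v \<noteq> 0" if "v \<in> V" for v using V(1) that by (simp add: distinct_points_def)
  have rad: "initial_degree (radical_ideal Z) = alpha V (Suc 0)"
    using initial_degree_radical_ideal[of V] V0 V(2) by simp
  have beta: "beta_seq Z m = int (alpha V (m + 1)) - int (alpha V m)" if "1 \<le> m" for m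
    using that initial_degree_symbolic_power[of V] V0 by (simp add: beta_seq_def V(2)[symmetric])
  have pos: "0 < alpha V (Suc 0)" if "V \<noteq> {}"
  proof -
    obtain v where "v \<in> V" using \<open>V \<noteq> {}\<close> by blast
    then show ?thesis using has_form_le_degree[OF has_form_alpha[OF V(1), of "Suc 0"]] V0 by fastforce
  qed
  {
    assume "\<exists>m\<ge>1. beta_seq Z m = 1 \<and> beta_seq Z (m + 1) = 1"
    then obtain m where m: "1 \<le> m" "beta_seq Z m = 1" "beta_seq Z (m + 1) = 1" by blast
    \<comment> \<open>The empty set has initial degree 0 for every exponent, so its jumps
      vanish.\<close>
    have ne: "V \<noteq> {}" using m(2) beta[OF m(1)] by (auto simp: alpha_empty)
    have jump: "alpha V (m + 2) = alpha V m + 2" using m beta[of m] beta[of "m + 1"] by (simp add: numeral_eq_Suc)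
    have line: "has_form V (Suc 0) (Suc 0)"
      by (rule alpha_jump_one[OF V(1) ne _ jump]) (use m in simp)
    show "initial_degree (radical_ideal Z) = 1" using alpha_collinear[OF V(1) ne line] rad by simp
    show "\<exists>L. plane_curve 1 L \<and> Z \<subseteq> L"
      using has_form_imp_plane_curve[of V, OF V0 line] unfolding V(2) by simp
  next
    assume "\<exists>m\<ge>1. beta_seq Z m = 2 \<and> beta_seq Z (m + 1) = 2 \<and> beta_seq Z (m + 2) = 2 \<and>
                   beta_seq Z (m + 3) = 2 \<and> beta_seq Z (m + 4) = 2"
    then obtain m where m: "1 \<le> m" "beta_seq Z m = 2" "beta_seq Z (m + 1) = 2" "beta_seq Z (m + 2) = 2"
      "beta_seq Z (m + 3) = 2" "beta_seq Z (m + 4) = 2" by (elim exE conjE) (rule that)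
    have ne: "V \<noteq> {}" using m(2) beta[OF m(1)] by (auto simp: alpha_empty)
    have step: "alpha V (m + Suc j) = alpha V (m + j) + 2" if "j < 5" for j
    proof -
      have "j = 0 \<or> j = 1 \<or> j = 2 \<or> j = 3 \<or> j = 4" using that by auto
      then have "beta_seq Z (m + j) = 2" using m by auto
      then show ?thesis using beta[of "m + j"] m(1) by simp
    qed
    have jump: "alpha V (m + j) = alpha V m + 2 * j" if "j \<le> 5" for j
      using that
    proof (induction j)
      case (Suc j)
      then show ?case using step[of j] by simp
    qed simp
    have conic: "has_form V (Suc 0) 2"
      by (rule alpha_jump_two[OF V(1) _ jump]) (use m in simp_all)
    \<comment> \<open>Points on a line have initial degree m for every m, so their jumps would be 1
      instead of 2.\<close>
    have "alpha V (Suc 0) \<noteq> 1"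
    proof
      assume "alpha V (Suc 0) = 1"
      then have "has_form V (Suc 0) (Suc 0)" using has_form_alpha[OF V(1), of "Suc 0"] by simp
      then show False using alpha_collinear[OF V(1) ne] step[of 0] by simp
    qed
    then show "initial_degree (radical_ideal Z) = 2" using alpha_le[OF conic] pos[OF ne] rad by simp
    show "\<exists>C. plane_curve 2 C \<and> Z \<subseteq> C"
      using has_form_imp_plane_curve[of V, OF V0 conic] unfolding V(2) by simp
  }
next
  fix d :: nat assume d: "3 \<le> d"
  let ?V = "grid d :: ('k ^ 3) set"
  have V0: "v \<noteq> 0" if "v \<in> ?V" for v using distinct_points_grid[where 'k = 'k, of d] that by (simp add: distinct_points_def)
  show "\<exists>Z :: 'k proj_plane set. finite Z \<and> (\<forall>m\<ge>2. beta_seq Z m = int d) \<and> d + 1 \<le> initial_degree (radical_ideal Z)"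
  proof (intro exI[of _ "abs_proj_plane ` ?V"] conjI allI impI)
    show "finite (abs_proj_plane ` ?V)" using distinct_points_grid[where 'k = 'k, of d] by (simp add: distinct_points_def)
    show "d + 1 \<le> initial_degree (radical_ideal (abs_proj_plane ` ?V))"
      using alpha_grid_reduced[where 'k = 'k, of d] d by (simp add: initial_degree_radical_ideal[of ?V, OF V0])
    fix m :: nat assume m: "2 \<le> m"
    show "beta_seq (abs_proj_plane ` ?V) m = int d"
      using m alpha_grid[OF d m, where 'k = 'k] alpha_grid[OF d, where 'k = 'k, of "m + 1"]
      by (simp add: beta_seq_def initial_degree_symbolic_power[of ?V, OF V0])
  qed
qed

end
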